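(* Let $K$ be a finite set, $\kappa\ge 0$, $\sigma_k\in\mathbb{R}^2$ for $k\in K$, and let $(G^k)_{k\in K}$ be independent, identically distributed, mean zero, continuous Gaussian processes with stationary increments, vanishing at zero, whose variance function $\gamma(t)=\mathrm{Var}(G^k_t)$ is a bounded variation function. Assume moreover that the measure $d\gamma(s)$ has a non-negative density $d\gamma(s)/ds$ with respect to Lebesgue measure and that there exists $C>0$ such that $d\gamma(s)/ds\le C$ for a.e. $s\ge 0$. Let $\theta_0\in L^2(\mathbb{R}^2)$. With $e(t,\xi)$ the limit as $\epsilon\to0$ of the expected Fourier modes $\mathbb{E}[\widehat{\theta_\epsilon}(t,\xi)]$ (see context), define $$\overline{\theta}(t,x):=\int_{\mathbb{R}^2}e^{2\pi i\xi\cdot x}e(t,\xi)\,d\xi .$$ Then $\overline\theta(t)\in L^2(\mathbb{R}^2)$, $\overline\theta$ is weakly continuous in time in $L^2(\mathbb{R}^2)$, and it satisfies, in the sense of distributions, $$\overline\theta(t,x)=\theta_0(x)+\int_0^t\kappa\Delta\overline\theta(s,x)\,ds+\int_0^t(\mathcal{L}\overline\theta(s))(x)\,d\gamma(s),$$ where $\mathcal{L}$ is the differential operator $(\mathcal{L}f)(x)=\operatorname{div}(Q\nabla f(x))$ with $Q=\sum_{k\in K}\sigma_k\otimes\sigma_k$.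
   Context: Fourier convention: $\widehat f(\xi)=\int_{\mathbb{R}^2}e^{-2\pi i\xi\cdot x}f(x)\,dx$, $f(x)=\int_{\mathbb{R}^2}e^{2\pi i\xi\cdot x}\widehat f(\xi)\,d\xi$, in a classical or generalized sense. For $\epsilon>0$ put $(s-\epsilon)_+=\max(s-\epsilon,0)$ and $\mathcal{G}^{k,\epsilon}_t=\int_0^t\frac{G^k_{s+\epsilon}-G^k_{(s-\epsilon)_+}}{2\epsilon}\,ds$. The regularized stochastic transport equation is $$\theta_\epsilon(t,x)=\theta_0(x)+\int_0^t\kappa\Delta\theta_\epsilon(s,x)\,ds+\sum_{k\in K}\int_0^t(\sigma_k\cdot\nabla)\theta_\epsilon(s,x)\frac{G^k_{s+\epsilon}-G^k_{(s-\epsilon)_+}}{2\epsilon}\,ds .$$ In Fourier transform the equation is written as $$\widehat{\theta_\epsilon}(t,\xi)=\widehat{\theta_0}(\xi)-\kappa|\xi|^2\int_0^t\widehat{\theta_\epsilon}(s,\xi)\,ds+i\sum_{k\in K}(\sigma_k\cdot\xi)\int_0^t\widehat{\theta_\epsilon}(s,\xi)\frac{G^k_{s+\epsilon}-G^k_{(s-\epsilon)_+}}{2\epsilon}\,ds,$$ with explicit solution $$\widehat{\theta_\epsilon}(t,\xi)=\widehat{\theta_0}(\xi)\exp\Big(-\kappa|\xi|^2t+i\sum_{k\in K}(\sigma_k\cdot\xi)\,\mathcal{G}^{k,\epsilon}_t\Big).$$ Set $e_\epsilon(t,\xi)=\mathbb{E}[\widehat{\theta_\epsilon}(t,\xi)]$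 and $e(t,\xi)=\lim_{\epsilon\to0}e_\epsilon(t,\xi)$ (the limit exists).
   Formalization: The dγ-integral of Lθ̄ carries a factor 1/2 (Var(G_t)=γ gives exp(-a²γ/2); with coefficient 1 the equation is false), and the Fourier-mode equation uses 4π²κ|ξ|² and 2πσ_k·ξ, as the stated Fourier convention requires, instead of κ|ξ|² and σ_k·ξ. *)

theory Defs
  imports "HOL-Probability.Probability"
begin

text \<open>Degenerate (almost surely constant) variables count as Gaussian; a process vanishing
  at time zero needs this.\<close>

definition gaussian_rv :: "'w measure \<Rightarrow> ('w \<Rightarrow> real) \<Rightarrow> bool" where
  "gaussian_rv M X \<longleftrightarrow> X \<in> borel_measurable M \<and>
     ((\<exists>m s. s > 0 \<and> distributed M lborel X (\<lambda>x. ennreal (normal_density m s x)))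
      \<or> (\<exists>c. AE w in M. X w = c))"

definition gaussian_process :: "'w measure \<Rightarrow> (real \<Rightarrow> 'w \<Rightarrow> real) \<Rightarrow> bool" where
  "gaussian_process M X \<longleftrightarrow>
     (\<forall>J c. finite J \<and> J \<subseteq> {0..} \<longrightarrow> gaussian_rv M (\<lambda>w. \<Sum>t\<in>J. c t * X t w))"

definition mean_zero :: "'w measure \<Rightarrow> (real \<Rightarrow> 'w \<Rightarrow> real) \<Rightarrow> bool" where
  "mean_zero M X \<longleftrightarrow> (\<forall>t\<ge>0. integrable M (X t) \<and> (LINT w|M. X t w) = 0)"

text \<open>The finite-dimensional laws of the process of increments from time \<open>h\<close> on do not depend
  on \<open>h\<close>.\<close>

definition stationary_increments :: "'w measure \<Rightarrow> (real \<Rightarrow> 'w \<Rightarrow> real) \<Rightarrow> bool" where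
  "stationary_increments M X \<longleftrightarrow>
     (\<forall>h\<ge>0. \<forall>J. finite J \<and> J \<subseteq> {0..} \<longrightarrow>
        distr M (PiM J (\<lambda>_. borel)) (\<lambda>w. \<lambda>t\<in>J. X (t + h) w - X h w)
      = distr M (PiM J (\<lambda>_. borel)) (\<lambda>w. \<lambda>t\<in>J. X t w - X 0 w))"

definition path_of :: "(real \<Rightarrow> 'w \<Rightarrow> real) \<Rightarrow> 'w \<Rightarrow> real \<Rightarrow> real" where
  "path_of X w = (\<lambda>t\<in>{0..}. X t w)"

abbreviation path_space :: "(real \<Rightarrow> real) measure" where
  "path_space \<equiv> PiM {0..} (\<lambda>_. borel)"

definition iid_processes :: "'w measure \<Rightarrow> 'k set \<Rightarrow> ('k \<Rightarrow> real \<Rightarrow> 'w \<Rightarrow> real) \<Rightarrow> bool" where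
  "iid_processes M K X \<longleftrightarrow>
     prob_space.indep_vars M (\<lambda>_. path_space) (\<lambda>k. path_of (X k)) K \<and>
     (\<forall>k\<in>K. \<forall>l\<in>K. distr M path_space (path_of (X k)) = distr M path_space (path_of (X l)))"

definition bounded_variation_on :: "real \<Rightarrow> real \<Rightarrow> (real \<Rightarrow> real) \<Rightarrow> bool" where
  "bounded_variation_on a b f \<longleftrightarrow>
     (\<exists>V. \<forall>n p. (\<forall>i\<le>n. p i \<in> {a..b}) \<and> (\<forall>i<n. p i \<le> p (Suc i)) \<longrightarrow>
        (\<Sum>i<n. \<bar>f (p (Suc i)) - f (p i)\<bar>) \<le> V)"

text \<open>The signed measure \<open>d\<gamma>\<close> on \<open>[0,\<infinity>)\<close> of a continuous \<open>\<gamma>\<close> has Lebesgue density \<open>g\<close>.\<close>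

definition has_lebesgue_density :: "(real \<Rightarrow> real) \<Rightarrow> (real \<Rightarrow> real) \<Rightarrow> bool" where
  "has_lebesgue_density \<gamma> g \<longleftrightarrow> g \<in> borel_measurable borel \<and>
     (\<forall>a b. 0 \<le> a \<and> a \<le> b \<longrightarrow>
        set_integrable lborel {a..b} g \<and> \<gamma> b - \<gamma> a = (LINT s:{a..b}|lborel. g s))"

text \<open>\<^const>\<open>interval_measure\<close> expects a function on the whole line (monotone and
  right-continuous); \<open>\<gamma>\<close> only matters at nonnegative times, so it is extended by a constant.\<close>

definition stieltjes_measure :: "(real \<Rightarrow> real) \<Rightarrow> real measure" where
  "stieltjes_measure \<gamma> = interval_measure (\<lambda>t. \<gamma> (max 0 t))"

definition L2 :: "(real^2 \<Rightarrow> complex) \<Rightarrow> bool" where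
  "L2 f \<longleftrightarrow> f \<in> borel_measurable borel \<and> integrable lborel (\<lambda>x. (cmod (f x))\<^sup>2)"

text \<open>A nonnegative integral is used because the Bochner integral of a non-integrable function
  is \<open>0\<close>.\<close>

definition L2_limit :: "(real \<Rightarrow> real^2 \<Rightarrow> complex) \<Rightarrow> (real^2 \<Rightarrow> complex) \<Rightarrow> bool" where
  "L2_limit F g \<longleftrightarrow> L2 g \<and>
     ((\<lambda>R. \<integral>\<^sup>+x. ennreal ((cmod (F R x - g x))\<^sup>2) \<partial>lborel) \<longlongrightarrow> 0) at_top"

text \<open>The integrals need not converge absolutely for a square integrable function: they are
  limits in \<open>L\<^sup>2\<close> of the integrals over balls. The result is some representative of its class;
  that the limit exists is Plancherel's theorem and is not built in.\<close>

definition fourier :: "(real^2 \<Rightarrow> complex) \<Rightarrow> real^2 \<Rightarrow> complex" where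
  "fourier f = (SOME g.
     L2_limit (\<lambda>R \<xi>. LINT x:cball 0 R|lborel. cis (- 2 * pi * (\<xi> \<bullet> x)) * f x) g)"

definition inverse_fourier :: "(real^2 \<Rightarrow> complex) \<Rightarrow> real^2 \<Rightarrow> complex" where
  "inverse_fourier f = (SOME g.
     L2_limit (\<lambda>R x. LINT \<xi>:cball 0 R|lborel. cis (2 * pi * (\<xi> \<bullet> x)) * f \<xi>) g)"

definition weakly_continuous_L2 :: "(real \<Rightarrow> real^2 \<Rightarrow> complex) \<Rightarrow> bool" where
  "weakly_continuous_L2 u \<longleftrightarrow>
     (\<forall>\<psi>. L2 \<psi> \<longrightarrow> continuous_on {0..} (\<lambda>t. LINT x|lborel. u t x * cnj (\<psi> x)))"

definition partial :: "2 \<Rightarrow> (real^2 \<Rightarrow> complex) \<Rightarrow> real^2 \<Rightarrow> complex" where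
  "partial i f x = frechet_derivative f (at x) (axis i 1)"

primrec C_k :: "nat \<Rightarrow> (real^2 \<Rightarrow> complex) \<Rightarrow> bool" where
  "C_k 0 f \<longleftrightarrow> continuous_on UNIV f"
| "C_k (Suc n) f \<longleftrightarrow> (\<forall>x. f differentiable (at x)) \<and> (\<forall>i. C_k n (partial i f))"

definition test_function :: "(real^2 \<Rightarrow> complex) \<Rightarrow> bool" where
  "test_function \<phi> \<longleftrightarrow> (\<forall>n. C_k n \<phi>) \<and> compact (closure {x. \<phi> x \<noteq> 0})"

type_synonym distribution = "(real^2 \<Rightarrow> complex) \<Rightarrow> complex"

definition dist_of :: "(real^2 \<Rightarrow> complex) \<Rightarrow> distribution" where
  "dist_of f \<phi> = (LINT x|lborel. f x * \<phi> x)"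

definition dist_grad :: "distribution \<Rightarrow> 2 \<Rightarrow> distribution" where
  "dist_grad T i \<phi> = - T (partial i \<phi>)"

definition dist_div :: "(2 \<Rightarrow> distribution) \<Rightarrow> distribution" where
  "dist_div F \<phi> = - (\<Sum>i\<in>UNIV. F i (partial i \<phi>))"

definition dist_laplacian :: "distribution \<Rightarrow> distribution" where
  "dist_laplacian T = dist_div (dist_grad T)"

definition tensor :: "real^2 \<Rightarrow> real^2 \<Rightarrow> real^2^2" where
  "tensor u v = (\<chi> i j. u $ i * v $ j)"

definition Q_matrix :: "'k set \<Rightarrow> ('k \<Rightarrow> real^2) \<Rightarrow> real^2^2" where
  "Q_matrix K \<sigma> = (\<Sum>k\<in>K. tensor (\<sigma> k) (\<sigma> k))"

text \<open>\<open>div(Q\<nabla>T)\<close>. With \<open>\<gamma>(t) = Var(G\<^sub>t)\<close> one has \<open>E exp(i a\<cdot>G\<^sub>t) = exp(-a\<^sup>2\<gamma>(t)/2)\<close>, so this operator enters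
  the equation for the mean with the factor \<open>1/2\<close> (as in the passage from a Stratonovich to
  an Ito integral for Brownian motion).\<close>

definition dist_L :: "real^2^2 \<Rightarrow> distribution \<Rightarrow> distribution" where
  "dist_L Q T =
     dist_div (\<lambda>i \<phi>. \<Sum>j\<in>UNIV. complex_of_real (Q $ i $ j) * dist_grad T j \<phi>)"

definition noise_rate :: "real \<Rightarrow> (real \<Rightarrow> real) \<Rightarrow> real \<Rightarrow> real" where
  "noise_rate \<epsilon> g s = (g (s + \<epsilon>) - g (max (s - \<epsilon>) 0)) / (2 * \<epsilon>)"

text \<open>The mode at frequency \<open>\<xi>\<close>, along noise paths \<open>g k\<close> and with initial value \<open>c\<close>, of the
  equation
  \<open>\<partial>\<^sub>t\<theta> = \<kappa>\<Delta>\<theta> + \<Sum>\<^sub>k (\<sigma>\<^sub>k\<cdot>\<nabla>)\<theta> (g\<^sub>k(t+\<epsilon>) - g\<^sub>k((t-\<epsilon>)\<^sub>+))/(2\<epsilon>)\<close>.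
  Under the transform with kernel \<open>exp(-2\<pi>i \<xi>\<cdot>x)\<close> the operators \<open>\<Delta>\<close> and \<open>\<sigma>\<cdot>\<nabla>\<close> have the
  symbols \<open>-4\<pi>\<^sup>2\<bar>\<xi>\<bar>\<^sup>2\<close> and \<open>2\<pi>i \<sigma>\<cdot>\<xi>\<close>.\<close>

definition regularized_mode ::
  "'k set \<Rightarrow> real \<Rightarrow> ('k \<Rightarrow> real^2) \<Rightarrow> ('k \<Rightarrow> real \<Rightarrow> real) \<Rightarrow> real \<Rightarrow> real^2
     \<Rightarrow> complex \<Rightarrow> (real \<Rightarrow> complex) \<Rightarrow> bool" where
  "regularized_mode K \<kappa> \<sigma> g \<epsilon> \<xi> c y \<longleftrightarrow> continuous_on {0..} y \<and>
     (\<forall>t\<ge>0. y t = c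
        - complex_of_real (4 * pi\<^sup>2 * \<kappa> * (norm \<xi>)\<^sup>2) * (LINT s:{0..t}|lborel. y s)
        + \<i> * (\<Sum>k\<in>K. complex_of_real (2 * pi * (\<sigma> k \<bullet> \<xi>)) *
             (LINT s:{0..t}|lborel. y s * complex_of_real (noise_rate \<epsilon> (g k) s))))"

definition expected_mode_eps ::
  "'w measure \<Rightarrow> (real \<Rightarrow> real \<Rightarrow> real^2 \<Rightarrow> 'w \<Rightarrow> complex) \<Rightarrow> real \<Rightarrow> real \<Rightarrow> real^2 \<Rightarrow> complex" where
  "expected_mode_eps M \<theta>h \<epsilon> t \<xi> = (LINT w|M. \<theta>h \<epsilon> t \<xi> w)"

definition expected_mode ::
  "'w measure \<Rightarrow> (real \<Rightarrow> real \<Rightarrow> real^2 \<Rightarrow> 'w \<Rightarrow> complex) \<Rightarrow> real \<Rightarrow> real^2 \<Rightarrow> complex" where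
  "expected_mode M \<theta>h t \<xi> = Lim (at_right 0) (\<lambda>\<epsilon>. expected_mode_eps M \<theta>h \<epsilon> t \<xi>)"

end

theory Submission
  imports Defs
begin

text \<open>The regularized equation is a linear ODE at each frequency. As \<open>\<epsilon> \<rightarrow> 0\<close> its phase tends to a
  combination of the independent Gaussian variables \<open>G\<^sup>k\<^sub>t\<close>, and averaging turns the phase into the
  factor \<open>exp(-a(\<xi>) t - b(\<xi>) \<gamma>(t))\<close> with \<open>a(\<xi>) = 4\<pi>\<^sup>2\<kappa>\<bar>\<xi>\<bar>\<^sup>2\<close> and \<open>b(\<xi>) = 2\<pi>\<^sup>2 \<xi>\<cdot>Q\<xi>\<close>. This factor is at
  most 1 and continuous in \<open>t\<close>, which gives square integrability and, by Parseval, weak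
  continuity. Being an exponential of an absolutely continuous function, it solves the integral
  equation with rate \<open>a dt + b d\<gamma>\<close>; pairing with a test function and exchanging the integrals in
  time and frequency gives the equation for the mean.\<close>

section \<open>The Fourier transform of integrable functions\<close>

text \<open>\<open>fourier\<close> and \<open>inverse_fourier\<close> choose some L2 limit of
  truncated integrals, so nothing is known about them until such limits are shown to exist; this
  forces a self-contained Plancherel theory. Fourier inversion is avoided: a pairing of
  \<open>\<theta> t\<close> with a function is moved to the frequency side by the multiplication
  formula, which at bottom is Fubini, and Parseval is used only to recognize the initial datum. The
  weights \<open>a\<close> and \<open>b\<close> are unbounded in frequency, but a pairing with a
  test function carries its transform, and the product of that transform with two coordinates of
  \<xi> is, up to a constant, the transform of a second derivative, hence again square integrable.
  The coefficient of \<open>b\<close> is 2 pi^2 and not 4 pi^2 because a centred Gaussian variable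
  of variance v has the characteristic function exp(-x^2 v / 2); the same half stands before the
  operator with matrix Q.\<close>

definition ft :: "real \<Rightarrow> ('a::euclidean_space \<Rightarrow> complex) \<Rightarrow> 'a \<Rightarrow> complex" where
  "ft s f \<xi> = (LINT x|lborel. cis (s * (2 * pi * (\<xi> \<bullet> x))) * f x)"

lemma borel_measurable_cis [measurable]: "cis \<in> borel_measurable borel"
  by (intro borel_measurable_continuous_onI continuous_on_cis continuous_on_id)

lemma borel_measurable_cnj [measurable]: "cnj \<in> borel_measurable borel"
  by (intro borel_measurable_continuous_onI continuous_on_cnj continuous_on_id)

lemma ft_measurable [measurable]:
  assumes [measurable]: "f \<in> borel_measurable borel"
  shows "ft s f \<in> borel_measurable borel"
  unfolding ft_def[abs_def] by measurable

lemma integrable_ft_kernel: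
  fixes f :: "'a::euclidean_space \<Rightarrow> complex"
  assumes "integrable lborel f"
  shows "integrable lborel (\<lambda>x. cis (s * (2 * pi * (\<xi> \<bullet> x))) * f x)"
proof (rule Bochner_Integration.integrable_bound[OF assms])
  have [measurable]: "f \<in> borel_measurable borel"
    using assms by auto
  show "(\<lambda>x. cis (s * (2 * pi * (\<xi> \<bullet> x))) * f x) \<in> borel_measurable lborel"
    by measurable
qed (simp add: norm_mult)

lemma norm_ft_le:
  fixes f :: "'a::euclidean_space \<Rightarrow> complex"
  shows "norm (ft s f \<xi>) \<le> (LINT x|lborel. norm (f x))"
proof -
  have "norm (ft s f \<xi>) \<le> (LINT x|lborel. norm (cis (s * (2 * pi * (\<xi> \<bullet> x))) * f x))"
    unfolding ft_def by (rule integral_norm_bound)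
  then show ?thesis by (simp add: norm_mult)
qed

text \<open>Conjugation exchanges the two kernels. This is one reason to carry the sign as a
  parameter: \<open>s = -1\<close> belongs to \<open>fourier\<close> and \<open>s = 1\<close> to
  \<open>inverse_fourier\<close>.\<close>

lemma cnj_ft: "cnj (ft s f \<xi>) = ft (- s) (\<lambda>x. cnj (f x)) \<xi>"
  unfolding ft_def by (simp flip: Bochner_Integration.integral_cnj add: cis_cnj)

lemma ft_diff:
  fixes f g :: "'a::euclidean_space \<Rightarrow> complex"
  assumes "integrable lborel f" "integrable lborel g"
  shows "ft s (\<lambda>x. f x - g x) \<xi> = ft s f \<xi> - ft s g \<xi>"
  unfolding ft_def using integrable_ft_kernel[OF assms(1)] integrable_ft_kernel[OF assms(2)]
  by (simp add: right_diff_distrib)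

lemma integrable_bounded_mult:
  fixes f h :: "'a \<Rightarrow> complex"
  assumes "integrable M f" "h \<in> borel_measurable M" "\<And>x. norm (h x) \<le> B"
  shows "integrable M (\<lambda>x. h x * f x)"
proof (rule Bochner_Integration.integrable_bound)
  show "integrable M (\<lambda>x. B * norm (f x))"
    using assms(1) by simp
  show "(\<lambda>x. h x * f x) \<in> borel_measurable M"
    using assms by measurable
  show "AE x in M. norm (h x * f x) \<le> norm (B * norm (f x))"
    using assms(3) by (auto simp: norm_mult abs_mult intro!: mult_mono order.trans[OF assms(3)])
qed

lemma integrable_ft_mult:
  fixes f h :: "'a::euclidean_space \<Rightarrow> complex"
  assumes "integrable lborel f" "integrable lborel h"
  shows "integrable lborel (\<lambda>\<xi>. ft s f \<xi> * h \<xi>)"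
proof (rule integrable_bounded_mult[OF assms(2) _ norm_ft_le])
  have [measurable]: "f \<in> borel_measurable borel"
    using assms by auto
  show "ft s f \<in> borel_measurable lborel"
    by measurable
qed

text \<open>By Tonelli the double integral of the two norms factors. The bounded kernel is left
  general because it is a plane wave in the multiplication formula and the damping factor in the
  exchange of time and frequency integrals.\<close>

lemma integrable_tensor:
  fixes f :: "'a::euclidean_space \<Rightarrow> complex" and h :: "'b::euclidean_space \<Rightarrow> complex"
    and k :: "'a \<times> 'b \<Rightarrow> complex"
  assumes "integrable lborel f" "integrable lborel h" "k \<in> borel_measurable borel"
    "\<And>z. norm (k z) \<le> 1"
  shows "integrable (lborel \<Otimes>\<^sub>M lborel) (\<lambda>(x, y). k (x, y) * f x * h y)"
proof (rule integrableI_bounded)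
  have [measurable]: "f \<in> borel_measurable borel" "h \<in> borel_measurable borel"
    using assms by auto
  have [measurable]: "k \<in> borel_measurable (borel \<Otimes>\<^sub>M borel)"
    using assms(3) by (simp add: borel_prod)
  show "(\<lambda>(x, y). k (x, y) * f x * h y) \<in> borel_measurable (lborel \<Otimes>\<^sub>M lborel)"
    by measurable
  have "(\<integral>\<^sup>+z. norm (case z of (x, y) \<Rightarrow> k (x, y) * f x * h y) \<partial>(lborel \<Otimes>\<^sub>M lborel))
      \<le> (\<integral>\<^sup>+z. (case z of (x, y) \<Rightarrow> ennreal (norm (f x)) * ennreal (norm (h y))) \<partial>(lborel \<Otimes>\<^sub>M lborel))"
    using assms(4) by (intro nn_integral_mono)
      (auto simp: norm_mult ennreal_mult'[symmetric] mult.assoc intro!: ennreal_leI mult_left_le_one_le)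
  also have "\<dots> = (\<integral>\<^sup>+x. \<integral>\<^sup>+y. ennreal (norm (f x)) * ennreal (norm (h y)) \<partial>lborel \<partial>lborel)"
    by (subst lborel.nn_integral_fst[symmetric]) simp_all
  also have "\<dots> = (\<integral>\<^sup>+x. norm (f x) \<partial>lborel) * (\<integral>\<^sup>+x. norm (h x) \<partial>lborel)"
    by (simp add: nn_integral_cmult nn_integral_multc)
  also have "\<dots> < \<infinity>"
    using assms(1,2) by (auto simp: integrable_iff_bounded ennreal_mult_less_top)
  finally show "(\<integral>\<^sup>+z. norm (case z of (x, y) \<Rightarrow> k (x, y) * f x * h y) \<partial>(lborel \<Otimes>\<^sub>M lborel)) < \<infinity>" .
qed

text \<open>Fubini, with a kernel symmetric in its two variables: the transform can be thrown from
  one factor onto the other. Every later passage between space and frequency goes back to this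
  identity.\<close>

lemma ft_mult_formula:
  fixes f h :: "'a::euclidean_space \<Rightarrow> complex"
  assumes "integrable lborel f" "integrable lborel h"
  shows "(LINT \<xi>|lborel. ft s f \<xi> * h \<xi>) = (LINT x|lborel. f x * ft s h x)"
proof -
  have [measurable]: "f \<in> borel_measurable borel" "h \<in> borel_measurable borel"
    using assms by auto
  define k where "k = (\<lambda>(x, \<xi>::'a). cis (s * (2 * pi * (\<xi> \<bullet> x))))"
  have "continuous_on UNIV k"
    unfolding k_def case_prod_beta by (intro continuous_intros)
  then have km: "k \<in> borel_measurable borel"
    by (rule borel_measurable_continuous_onI)
  have int: "integrable (lborel \<Otimes>\<^sub>M lborel) (\<lambda>(x, y). k (x, y) * f x * h y)"
    by (rule integrable_tensor[OF assms km]) (simp add: k_def case_prod_beta)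
  have "(LINT \<xi>|lborel. ft s f \<xi> * h \<xi>) = (LINT \<xi>|lborel. LINT x|lborel. k (x, \<xi>) * f x * h \<xi>)"
    unfolding ft_def k_def by simp
  also have "\<dots> = (LINT x|lborel. LINT \<xi>|lborel. k (x, \<xi>) * f x * h \<xi>)"
    by (rule lborel_pair.Fubini_integral[OF int])
  also have "\<dots> = (LINT x|lborel. LINT \<xi>|lborel. f x * (k (x, \<xi>) * h \<xi>))"
    by (simp add: ac_simps)
  also have "\<dots> = (LINT x|lborel. f x * ft s h x)"
    unfolding ft_def k_def by (simp add: inner_commute)
  finally show ?thesis .
qed

section \<open>Gaussians and their transforms\<close>

lemma integral_lborel_prod:
  fixes f :: "'a::euclidean_space \<Rightarrow> real \<Rightarrow> complex"
  assumes f: "\<And>b. b \<in> Basis \<Longrightarrow> integrable lborel (f b)"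
  shows "(LINT x|lborel. (\<Prod>b\<in>Basis. f b (x \<bullet> b))) = (\<Prod>b\<in>Basis. (LINT x|lborel. f b x))"
proof -
  interpret P: product_sigma_finite "\<lambda>_::'a. lborel :: real measure" ..
  have [measurable]: "\<And>b. b \<in> Basis \<Longrightarrow> f b \<in> borel_measurable borel"
    using f by (simp add: integrable_iff_bounded)
  have "(LINT x|(lborel :: 'a measure). (\<Prod>b\<in>Basis. f b (x \<bullet> b)))
      = (LINT x|(Pi\<^sub>M Basis (\<lambda>_. lborel)). (\<Prod>b\<in>Basis. f b ((\<Sum>i\<in>Basis. x i *\<^sub>R i) \<bullet> b)))"
    by (subst lborel_eq, rule integral_distr) measurable
  also have "\<dots> = (LINT x|(Pi\<^sub>M Basis (\<lambda>_. lborel)). (\<Prod>b\<in>Basis. f b (x b)))"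
    by (simp cong: prod.cong)
  also have "\<dots> = (\<Prod>b\<in>Basis. (LINT x|lborel. f b x))"
    by (rule P.product_integral_prod) (use f in auto)
  finally show ?thesis .
qed

lemma gaussian_fourier_real:
  fixes r t :: real
  assumes r: "r > 0"
  shows "(LINT x|lborel. complex_of_real (exp (- (pi * r * x\<^sup>2))) * cis (2 * pi * (t * x)))
     = complex_of_real (exp (- (pi * t\<^sup>2 / r)) / sqrt r)"
proof -
  \<comment> \<open>The substitution x -> c x turns the standard normal exponent into pi r x^2, and
    \<open>u\<close> is the frequency for which u c = 2 pi t; the integral then becomes the known
    characteristic function.\<close>
  define c where "c = sqrt (2 * pi * r)"
  have c: "c > 0" "c\<^sup>2 = 2 * pi * r" using r by (auto simp: c_def)
  define u where "u = 2 * pi * t / c"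
  have "complex_of_real (exp (- (u\<^sup>2) / 2)) = char std_normal_distribution u"
    by (simp add: char_std_normal_distribution)
  also have "\<dots> = (LINT x|lborel. std_normal_density x *\<^sub>R iexp (u * x))"
    unfolding char_def by (subst integral_density) auto
  also have "\<dots> = \<bar>c\<bar> *\<^sub>R (LINT x|lborel. std_normal_density (0 + c * x) *\<^sub>R iexp (u * (0 + c * x)))"
    by (rule lborel_integral_real_affine) (use c in simp)
  also have "(\<lambda>x. std_normal_density (0 + c * x) *\<^sub>R iexp (u * (0 + c * x)))
     = (\<lambda>x. complex_of_real (1 / sqrt (2 * pi)) * (complex_of_real (exp (- (pi * r * x\<^sup>2))) * cis (2 * pi * (t * x))))"
  proof
    fix x
    have "u * (0 + c * x) = 2 * pi * (t * x)"
      using c by (simp add: u_def)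
    moreover have "(c * x)\<^sup>2 / 2 = pi * r * x\<^sup>2"
      using c by (simp add: power_mult_distrib)
    ultimately show "std_normal_density (0 + c * x) *\<^sub>R iexp (u * (0 + c * x))
      = complex_of_real (1 / sqrt (2 * pi)) * (complex_of_real (exp (- (pi * r * x\<^sup>2))) * cis (2 * pi * (t * x)))"
      by (simp only: std_normal_density_def cis_conv_exp) (simp add: scaleR_conv_of_real mult_ac)
  qed
  also have "\<bar>c\<bar> *\<^sub>R (LINT x|lborel. complex_of_real (1 / sqrt (2 * pi)) * (complex_of_real (exp (- (pi * r * x\<^sup>2))) * cis (2 * pi * (t * x))))
     = complex_of_real (sqrt r) * (LINT x|lborel. complex_of_real (exp (- (pi * r * x\<^sup>2))) * cis (2 * pi * (t * x)))"
  proof -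
    have "\<bar>c\<bar> * (1 / sqrt (2 * pi)) = sqrt r"
      using r by (simp add: c_def real_sqrt_mult)
    then show ?thesis
      by (subst integral_mult_right_zero)
        (simp only: scaleR_conv_of_real mult.assoc[symmetric] of_real_mult[symmetric])
  qed
  finally have eq: "complex_of_real (exp (- (u\<^sup>2) / 2)) = complex_of_real (sqrt r) *
     (LINT x|lborel. complex_of_real (exp (- (pi * r * x\<^sup>2))) * cis (2 * pi * (t * x)))" .
  have "u\<^sup>2 / 2 = pi * t\<^sup>2 / r"
    using r c by (simp add: u_def power_divide power_mult_distrib) (simp add: field_simps power2_eq_square)
  with eq r show ?thesis
    by (simp add: field_simps)
qed

definition gauss :: "real \<Rightarrow> 'a::euclidean_space \<Rightarrow> real" where
  "gauss r x = exp (- (pi * r * (norm x)\<^sup>2))"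

text \<open>The transform of \<open>gauss r\<close>: a probability density that concentrates at the
  origin as r tends to 0.\<close>

definition gauss_kernel :: "real \<Rightarrow> 'a::euclidean_space \<Rightarrow> real" where
  "gauss_kernel r x = gauss (1 / r) x / sqrt r ^ DIM('a)"

lemma gauss_measurable [measurable]:
  "gauss r \<in> borel_measurable borel" "gauss_kernel r \<in> borel_measurable borel"
  unfolding gauss_def[abs_def] gauss_kernel_def[abs_def] by measurable

lemma gauss_nonneg: "gauss r x \<ge> 0" "r > 0 \<Longrightarrow> gauss_kernel r x \<ge> 0"
  by (auto simp: gauss_def gauss_kernel_def intro!: divide_nonneg_nonneg)

lemma gauss_le_1: "r \<ge> 0 \<Longrightarrow> gauss r x \<le> 1"
  by (simp add: gauss_def)

text \<open>Both the Gaussian and the plane wave factor over the coordinates, which leaves the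
  one-dimensional formula in each of them.\<close>

lemma gauss_fourier:
  fixes z :: "'a::euclidean_space"
  assumes r: "r > 0"
  shows "(LINT x|lborel. complex_of_real (gauss r x) * cis (2 * pi * (z \<bullet> x)))
    = complex_of_real (gauss_kernel r z)"
proof -
  define h where "h = (\<lambda>(b::'a) x. complex_of_real (exp (- (pi * r * x\<^sup>2))) * cis (2 * pi * ((z \<bullet> b) * x)))"
  have hi: "integrable lborel (h b)" for b
  proof (rule ccontr)
    \<comment> \<open>The Bochner integral of a non-integrable function is 0 by convention, so the
      nonzero value of the integral already proves integrability.\<close>
    have e: "(LINT x|lborel. complex_of_real (exp (- (pi * r * x\<^sup>2))) * cis (2 * pi * ((z \<bullet> b) * x))) \<noteq> 0"
      using r by (subst gaussian_fourier_real[OF r]) auto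
    assume "\<not> integrable lborel (h b)"
    then show False
      using e not_integrable_integral_eq[of lborel "h b"] by (simp add: h_def)
  qed
  have ex: "complex_of_real (exp (\<Sum>b\<in>A. f b)) = (\<Prod>b\<in>A. complex_of_real (exp (f b)))"
    if "finite A" for A :: "'a set" and f
    using that by (simp add: exp_sum)
  have ci: "cis (\<Sum>b\<in>A. f b) = (\<Prod>b\<in>A. cis (f b))" if "finite A" for A :: "'a set" and f
    using that by (induction A rule: finite_induct) (auto simp flip: cis_mult)
  have "complex_of_real (gauss r x) * cis (2 * pi * (z \<bullet> x)) = (\<Prod>b\<in>Basis. h b (x \<bullet> b))" for x
  proof -
    have 1: "- (pi * r * (norm x)\<^sup>2) = (\<Sum>b\<in>Basis. - (pi * r * (x \<bullet> b)\<^sup>2))"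
      unfolding power2_norm_eq_inner by (subst euclidean_inner)
        (simp add: sum_distrib_left sum_negf power2_eq_square)
    have 2: "2 * pi * (z \<bullet> x) = (\<Sum>b\<in>Basis. 2 * pi * ((z \<bullet> b) * (x \<bullet> b)))"
      by (subst euclidean_inner) (simp add: sum_distrib_left)
    show ?thesis
      unfolding gauss_def 1 2 ex[OF finite_Basis] ci[OF finite_Basis] h_def prod.distrib ..
  qed
  then have "(LINT x|lborel. complex_of_real (gauss r x) * cis (2 * pi * (z \<bullet> x)))
     = (\<Prod>b\<in>Basis. (LINT x|lborel. h b x))"
    using integral_lborel_prod[of h, OF hi] by simp
  also have "\<dots> = (\<Prod>b\<in>(Basis::'a set). complex_of_real (exp (- (pi * (z \<bullet> b)\<^sup>2 / r)) / sqrt r))"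
    unfolding h_def by (simp only: gaussian_fourier_real[OF r])
  also have "\<dots> = complex_of_real (gauss_kernel r z)"
  proof -
    have "(\<Prod>b\<in>(Basis::'a set). exp (- (pi * (z \<bullet> b)\<^sup>2 / r)) / sqrt r) = gauss_kernel r z"
      unfolding gauss_kernel_def gauss_def power2_norm_eq_inner
      by (subst euclidean_inner) (simp add: prod_dividef exp_sum[symmetric] sum_negf
          sum_distrib_left sum_divide_distrib power2_eq_square)
    then show ?thesis by (metis of_real_prod)
  qed
  finally show ?thesis .
qed

text \<open>Frequency 0 of the preceding formula gives the mass, and integrability follows again
  because this mass is not 0.\<close>

lemma integrable_gauss:
  assumes r: "r > 0"
  shows "integrable lborel (gauss r :: 'a::euclidean_space \<Rightarrow> real)"
    and "(LINT x|lborel. gauss r (x::'a)) = 1 / sqrt r ^ DIM('a)"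
proof -
  have "(LINT x|lborel. complex_of_real (gauss r (x::'a))) = complex_of_real (gauss_kernel r (0::'a))"
    using gauss_fourier[OF r, of "0::'a"] by simp
  then have e: "(LINT x|lborel. gauss r (x::'a)) = gauss_kernel r (0::'a)"
    by (simp add: integral_complex_of_real)
  then show "(LINT x|lborel. gauss r (x::'a)) = 1 / sqrt r ^ DIM('a)"
    by (simp add: gauss_kernel_def gauss_def)
  show "integrable lborel (gauss r :: 'a \<Rightarrow> real)"
  proof (rule ccontr)
    assume "\<not> ?thesis"
    then have "gauss_kernel r (0::'a) = 0"
      using e by (simp add: not_integrable_integral_eq)
    then show False
      using r by (simp add: gauss_kernel_def gauss_def)
  qed
qed

lemma integrable_gauss_kernel:
  assumes r: "r > 0"
  shows "integrable lborel (gauss_kernel r :: 'a::euclidean_space \<Rightarrow> real)"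
    and "(LINT x|lborel. gauss_kernel r (x::'a)) = 1"
  using integrable_gauss[of "1/r", where 'a='a] r
  by (simp_all add: gauss_kernel_def[abs_def] real_sqrt_divide power_divide)

lemma ft_gauss:
  fixes z :: "'a::euclidean_space"
  assumes "r > 0" "\<bar>s\<bar> = 1"
  shows "ft s (\<lambda>x. complex_of_real (gauss r x)) z = complex_of_real (gauss_kernel r z)"
proof -
  have "ft s (\<lambda>x. complex_of_real (gauss r x)) z
     = (LINT x|lborel. complex_of_real (gauss r x) * cis (2 * pi * ((s *\<^sub>R z) \<bullet> x)))"
    unfolding ft_def by (simp add: mult_ac)
  also have "\<dots> = complex_of_real (gauss_kernel r z)"
    using assms by (subst gauss_fourier) (auto simp: gauss_kernel_def gauss_def)
  finally show ?thesis .
qed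

text \<open>Two applications of the multiplication formula replace the usual triple Fubini argument.\<close>

lemma ft_gauss_pairing:
  fixes f h :: "'a::euclidean_space \<Rightarrow> complex"
  assumes f: "integrable lborel f" and h: "integrable lborel h" and "r > 0" "\<bar>s\<bar> = 1"
  shows "(LINT \<xi>|lborel. ft s f \<xi> * (cnj (ft s h \<xi>) * complex_of_real (gauss r \<xi>)))
     = (LINT x|lborel. f x * (LINT y|lborel. cnj (h y) * complex_of_real (gauss_kernel r (y - x))))"
proof -
  have [measurable]: "f \<in> borel_measurable borel" "h \<in> borel_measurable borel"
    using f h by auto
  have ch: "integrable lborel (\<lambda>x. cnj (h x))" using h by simp
  have gi: "integrable lborel (\<lambda>x. complex_of_real (gauss r (x::'a)))"
    using integrable_gauss(1)[OF \<open>r > 0\<close>] by (rule integrable_of_real)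
  have "integrable lborel (\<lambda>\<xi>. cnj (ft s h \<xi>) * complex_of_real (gauss r \<xi>))"
    unfolding cnj_ft using integrable_ft_mult[OF ch gi] .
  from ft_mult_formula[OF f this]
  have "(LINT \<xi>|lborel. ft s f \<xi> * (cnj (ft s h \<xi>) * complex_of_real (gauss r \<xi>)))
     = (LINT x|lborel. f x * ft s (\<lambda>\<xi>. cnj (ft s h \<xi>) * complex_of_real (gauss r \<xi>)) x)" .
  also have "ft s (\<lambda>\<xi>. cnj (ft s h \<xi>) * complex_of_real (gauss r \<xi>))
      = (\<lambda>x. LINT y|lborel. cnj (h y) * complex_of_real (gauss_kernel r (y - x)))"
  proof
    fix x
    have "ft s (\<lambda>\<xi>. cnj (ft s h \<xi>) * complex_of_real (gauss r \<xi>)) x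
       = (LINT \<xi>|lborel. ft (-s) (\<lambda>x. cnj (h x)) \<xi> * (cis (s * (2 * pi * (x \<bullet> \<xi>))) * complex_of_real (gauss r \<xi>)))"
      unfolding cnj_ft by (subst ft_def) (simp add: mult_ac)
    also have "\<dots> = (LINT y|lborel. cnj (h y) * ft (-s) (\<lambda>\<xi>. cis (s * (2 * pi * (x \<bullet> \<xi>))) * complex_of_real (gauss r \<xi>)) y)"
      by (rule ft_mult_formula[OF ch integrable_ft_kernel[OF gi]])
    \<comment> \<open>Modulation by a plane wave translates the transform, so the Gaussian kernel
      ends up centred at \<open>x\<close>.\<close>
    also have "ft (-s) (\<lambda>\<xi>. cis (s * (2 * pi * (x \<bullet> \<xi>))) * complex_of_real (gauss r \<xi>))
       = (\<lambda>y. ft (-s) (\<lambda>\<xi>. complex_of_real (gauss r \<xi>)) (y - x))"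
      unfolding ft_def mult.assoc[symmetric] cis_mult by (simp add: algebra_simps)
    also have "\<dots> = (\<lambda>y. complex_of_real (gauss_kernel r (y - x)))"
      by (intro ext ft_gauss) (use assms in auto)
    finally show "ft s (\<lambda>\<xi>. cnj (ft s h \<xi>) * complex_of_real (gauss r \<xi>)) x
      = (LINT y|lborel. cnj (h y) * complex_of_real (gauss_kernel r (y - x)))" .
  qed
  finally show ?thesis .
qed

section \<open>The square norm bound and Parseval's identity for integrable functions\<close>

lemma lborel_integral_affine:
  fixes F :: "'a::euclidean_space \<Rightarrow> 'b::{banach, second_countable_topology}"
  assumes [measurable]: "F \<in> borel_measurable borel" and c: "c \<noteq> 0"
  shows "(LINT x|lborel. F x) = \<bar>c\<bar> ^ DIM('a) *\<^sub>R (LINT x|lborel. F (t + c *\<^sub>R x))"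
  by (subst lborel_affine[OF c, of t])
     (simp add: integral_density integral_distr)

lemma lborel_nn_integral_translate:
  fixes F :: "'a::euclidean_space \<Rightarrow> ennreal"
  assumes [measurable]: "F \<in> borel_measurable borel"
  shows "(\<integral>\<^sup>+x. F (t + x) \<partial>lborel) = (\<integral>\<^sup>+x. F x \<partial>lborel)"
  by (subst lborel_affine[where c=1 and t=t, THEN sym, simplified, THEN sym])
     (simp_all add: nn_integral_density nn_integral_distr)

text \<open>If \<open>f\<close> is not integrable, the left side is 0 by convention. Iterated
  integrals can thus be estimated before their inner integrals are known to converge.\<close>

lemma ennreal_norm_integral_le:
  fixes f :: "'a \<Rightarrow> 'b::{banach, second_countable_topology}"
  shows "ennreal (norm (integral\<^sup>L M f)) \<le> (\<integral>\<^sup>+x. norm (f x) \<partial>M)"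
  by (cases "integrable M f") (auto simp: integral_norm_bound_ennreal not_integrable_integral_eq)

lemma nn_integral_gauss_kernel:
  assumes r: "r > 0"
  shows "(\<integral>\<^sup>+y. ennreal (gauss_kernel r (y - x :: 'a::euclidean_space)) \<partial>lborel) = 1"
    and "(\<integral>\<^sup>+y. ennreal (gauss_kernel r (x - y :: 'a)) \<partial>lborel) = 1"
proof -
  have "(\<integral>\<^sup>+y. ennreal (gauss_kernel r (y::'a)) \<partial>lborel) = ennreal 1"
    using integrable_gauss_kernel[OF r, where 'a='a] gauss_nonneg(2)[OF r]
    by (subst nn_integral_eq_integral) auto
  then show 1: "(\<integral>\<^sup>+y. ennreal (gauss_kernel r (y - x :: 'a)) \<partial>lborel) = 1"
    using lborel_nn_integral_translate[of "\<lambda>y. ennreal (gauss_kernel r (y :: 'a))" "- x"] by simp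
  have "gauss_kernel r (x - y) = gauss_kernel r (y - x)" for y
    by (simp add: gauss_kernel_def gauss_def norm_minus_commute)
  with 1 show "(\<integral>\<^sup>+y. ennreal (gauss_kernel r (x - y :: 'a)) \<partial>lborel) = 1"
    by simp
qed

text \<open>By AM-GM and Tonelli, the Gaussian pairing of \<open>f\<close> with itself is at most its square norm; letting
  the Gaussian tend to 1 gives the bound on \<open>ft s f\<close>, which is the only half of Plancherel's
  identity needed to extend \<open>ft\<close> by completeness.\<close>

lemma ft_gauss_L2_bound:
  fixes f :: "'a::euclidean_space \<Rightarrow> complex"
  assumes f: "integrable lborel f" and r: "r > 0" and s: "\<bar>s\<bar> = 1"
  shows "(\<integral>\<^sup>+\<xi>. ennreal ((cmod (ft s f \<xi>))\<^sup>2 * gauss r \<xi>) \<partial>lborel) \<le> (\<integral>\<^sup>+x. ennreal ((cmod (f x))\<^sup>2) \<partial>lborel)"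
proof -
  have [measurable]: "f \<in> borel_measurable borel"
    using f by auto
  have cf: "integrable lborel (\<lambda>x. cnj (f x))" using f by simp
  define G where "G = (gauss_kernel r :: 'a \<Rightarrow> real)"
  have [measurable]: "G \<in> borel_measurable borel" by (simp add: G_def)
  have G0: "G x \<ge> 0" for x using gauss_nonneg(2)[OF r] by (simp add: G_def)
  have gi: "integrable lborel (\<lambda>x. complex_of_real (gauss r (x::'a)))"
    using integrable_gauss(1)[OF r] by (rule integrable_of_real)
  have sq: "ft s f \<xi> * (cnj (ft s f \<xi>) * complex_of_real (gauss r \<xi>))
     = complex_of_real ((cmod (ft s f \<xi>))\<^sup>2 * gauss r \<xi>)" for \<xi>
    by (simp add: mult.assoc[symmetric] complex_norm_square[symmetric])
  have "integrable lborel (\<lambda>\<xi>. ft s f \<xi> * (cnj (ft s f \<xi>) * complex_of_real (gauss r \<xi>)))"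
    unfolding cnj_ft by (intro integrable_ft_mult f cf gi)
  then have int: "integrable lborel (\<lambda>\<xi>. (cmod (ft s f \<xi>))\<^sup>2 * gauss r \<xi>)"
    unfolding sq by (simp only: complex_of_real_integrable_eq)
  define A where "A = (\<integral>\<^sup>+x. ennreal ((cmod (f x))\<^sup>2) \<partial>lborel)"
  have "(\<integral>\<^sup>+\<xi>. ennreal ((cmod (ft s f \<xi>))\<^sup>2 * gauss r \<xi>) \<partial>lborel)
      = ennreal (LINT \<xi>|lborel. (cmod (ft s f \<xi>))\<^sup>2 * gauss r \<xi>)"
    by (intro nn_integral_eq_integral int) (simp add: gauss_nonneg)
  \<comment> \<open>Passing to the norm of a complex number allows the use of the pairing identity,
    whose space side is not visibly real or nonnegative.\<close>
  also have "\<dots> \<le> ennreal (norm (complex_of_real (LINT \<xi>|lborel. (cmod (ft s f \<xi>))\<^sup>2 * gauss r \<xi>)))"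
    by (intro ennreal_leI) simp
  also have "complex_of_real (LINT \<xi>|lborel. (cmod (ft s f \<xi>))\<^sup>2 * gauss r \<xi>)
     = (LINT \<xi>|lborel. ft s f \<xi> * (cnj (ft s f \<xi>) * complex_of_real (gauss r \<xi>)))"
    unfolding sq by (rule integral_complex_of_real[symmetric])
  also have "\<dots> = (LINT x|lborel. f x * (LINT y|lborel. cnj (f y) * complex_of_real (G (y - x))))"
    unfolding G_def by (rule ft_gauss_pairing[OF f f r s])
  also have "ennreal (norm \<dots>) \<le> (\<integral>\<^sup>+x. ennreal (norm (f x * (LINT y|lborel. cnj (f y) * complex_of_real (G (y - x))))) \<partial>lborel)"
    by (rule ennreal_norm_integral_le)
  also have "\<dots> \<le> (\<integral>\<^sup>+x. \<integral>\<^sup>+y. ennreal (norm (f x)) * ennreal (norm (f y) * G (y - x)) \<partial>lborel \<partial>lborel)"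
  proof (intro nn_integral_mono)
    fix x
    have "ennreal (norm (f x * (LINT y|lborel. cnj (f y) * complex_of_real (G (y - x)))))
      \<le> ennreal (norm (f x)) * (\<integral>\<^sup>+y. norm (cnj (f y) * complex_of_real (G (y - x))) \<partial>lborel)"
      unfolding norm_mult[of "f x"]
      by (subst ennreal_mult') (auto intro!: mult_left_mono ennreal_norm_integral_le simp del: norm_mult)
    also have "\<dots> = (\<integral>\<^sup>+y. ennreal (norm (f x)) * ennreal (norm (f y) * G (y - x)) \<partial>lborel)"
      using G0 by (subst nn_integral_cmult) (auto simp: norm_mult)
    finally show "ennreal (norm (f x * (LINT y|lborel. cnj (f y) * complex_of_real (G (y - x)))))
      \<le> (\<integral>\<^sup>+y. ennreal (norm (f x)) * ennreal (norm (f y) * G (y - x)) \<partial>lborel)" .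
  qed
  also have "\<dots> \<le> (\<integral>\<^sup>+x. \<integral>\<^sup>+y. ennreal (1/2) * (ennreal ((norm (f x))\<^sup>2) * ennreal (G (y - x)))
        + ennreal (1/2) * (ennreal ((norm (f y))\<^sup>2) * ennreal (G (y - x))) \<partial>lborel \<partial>lborel)"
  proof (intro nn_integral_mono)
    fix x y
    have "0 \<le> (norm (f x) - norm (f y))\<^sup>2" by simp
    then have "norm (f x) * norm (f y) \<le> 1/2 * (norm (f x))\<^sup>2 + 1/2 * (norm (f y))\<^sup>2"
      unfolding power2_eq_square by (simp add: algebra_simps)
    then have "norm (f x) * norm (f y) * G (y - x) \<le> (1/2 * (norm (f x))\<^sup>2 + 1/2 * (norm (f y))\<^sup>2) * G (y - x)"
      using G0 by (intro mult_right_mono) auto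
    then show "ennreal (norm (f x)) * ennreal (norm (f y) * G (y - x)) \<le>
      ennreal (1/2) * (ennreal ((norm (f x))\<^sup>2) * ennreal (G (y - x)))
        + ennreal (1/2) * (ennreal ((norm (f y))\<^sup>2) * ennreal (G (y - x)))"
      using G0[of "y - x"]
      by (simp only: ennreal_mult'[symmetric] ennreal_plus[symmetric] zero_le_power2 norm_ge_zero
            mult_nonneg_nonneg zero_le_divide_1_iff zero_le_numeral)
         (intro ennreal_leI, simp add: algebra_simps)
  qed
  also have "\<dots> = (\<integral>\<^sup>+x. \<integral>\<^sup>+y. ennreal (1/2) * (ennreal ((norm (f x))\<^sup>2) * ennreal (G (y - x))) \<partial>lborel \<partial>lborel)
     + (\<integral>\<^sup>+x. \<integral>\<^sup>+y. ennreal (1/2) * (ennreal ((norm (f y))\<^sup>2) * ennreal (G (y - x))) \<partial>lborel \<partial>lborel)"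
    by (simp add: nn_integral_add)
  also have "(\<integral>\<^sup>+x. \<integral>\<^sup>+y. ennreal (1/2) * (ennreal ((norm (f x))\<^sup>2) * ennreal (G (y - x))) \<partial>lborel \<partial>lborel)
     = ennreal (1/2) * A"
    unfolding A_def G_def by (simp add: nn_integral_cmult nn_integral_gauss_kernel[OF r])
  also have "(\<integral>\<^sup>+x. \<integral>\<^sup>+y. ennreal (1/2) * (ennreal ((norm (f y))\<^sup>2) * ennreal (G (y - x))) \<partial>lborel \<partial>lborel)
     = (\<integral>\<^sup>+y. \<integral>\<^sup>+x. ennreal (1/2) * (ennreal ((norm (f y))\<^sup>2) * ennreal (G (y - x))) \<partial>lborel \<partial>lborel)"
    by (rule lborel_pair.Fubini') measurable
  also have "\<dots> = ennreal (1/2) * A"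
    unfolding A_def G_def by (simp add: nn_integral_cmult nn_integral_gauss_kernel[OF r])
  also have "ennreal (1/2) * A + ennreal (1/2) * A = A"
    by (simp only: distrib_right[symmetric] ennreal_plus[symmetric] zero_le_divide_1_iff zero_le_numeral) simp
  finally show ?thesis unfolding A_def .
qed

text \<open>Fatou's lemma along Gaussian factors that increase to 1. Square integrability of the
  transform is a result here and is not presupposed.\<close>

lemma ft_L2_bound:
  fixes f :: "'a::euclidean_space \<Rightarrow> complex"
  assumes f: "integrable lborel f" and s: "\<bar>s\<bar> = 1"
  shows "(\<integral>\<^sup>+\<xi>. ennreal ((cmod (ft s f \<xi>))\<^sup>2) \<partial>lborel) \<le> (\<integral>\<^sup>+x. ennreal ((cmod (f x))\<^sup>2) \<partial>lborel)"
proof -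
  have [measurable]: "f \<in> borel_measurable borel"
    using f by auto
  define r where "r n = 1 / real (Suc n)" for n
  have r: "r n > 0" for n by (simp add: r_def)
  have r0: "r \<longlonglongrightarrow> 0"
    unfolding r_def[abs_def] by (rule LIMSEQ_Suc[OF lim_1_over_n])
  have "(\<lambda>n. ennreal ((cmod (ft s f \<xi>))\<^sup>2 * gauss (r n) \<xi>)) \<longlonglongrightarrow> ennreal ((cmod (ft s f \<xi>))\<^sup>2)" for \<xi>
  proof (rule tendsto_ennrealI)
    have "(\<lambda>n. (cmod (ft s f \<xi>))\<^sup>2 * exp (- (pi * r n * (norm \<xi>)\<^sup>2))) \<longlonglongrightarrow> (cmod (ft s f \<xi>))\<^sup>2 * exp (- (pi * 0 * (norm \<xi>)\<^sup>2))"
      by (intro tendsto_intros r0)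
    then show "(\<lambda>n. (cmod (ft s f \<xi>))\<^sup>2 * gauss (r n) \<xi>) \<longlonglongrightarrow> (cmod (ft s f \<xi>))\<^sup>2"
      by (simp add: gauss_def)
  qed
  then have "(\<integral>\<^sup>+\<xi>. ennreal ((cmod (ft s f \<xi>))\<^sup>2) \<partial>lborel)
     = (\<integral>\<^sup>+\<xi>. liminf (\<lambda>n. ennreal ((cmod (ft s f \<xi>))\<^sup>2 * gauss (r n) \<xi>)) \<partial>lborel)"
    by (intro nn_integral_cong lim_imp_Liminf[symmetric]) auto
  also have "\<dots> \<le> liminf (\<lambda>n. \<integral>\<^sup>+\<xi>. ennreal ((cmod (ft s f \<xi>))\<^sup>2 * gauss (r n) \<xi>) \<partial>lborel)"
    by (rule nn_integral_liminf) measurable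
  also have "\<dots> \<le> liminf (\<lambda>n::nat. \<integral>\<^sup>+x. ennreal ((cmod (f x))\<^sup>2) \<partial>lborel)"
    by (intro Liminf_mono always_eventually allI ft_gauss_L2_bound f r s)
  also have "\<dots> = (\<integral>\<^sup>+x. ennreal ((cmod (f x))\<^sup>2) \<partial>lborel)"
    by (simp add: Liminf_const)
  finally show ?thesis .
qed

text \<open>The substitution y = x + sqrt(r) u replaces the moving kernel by the fixed weight
  \<open>gauss 1\<close> of mass 1. Continuity of \<open>h\<close> then gives pointwise convergence
  of the integrand, and \<open>B * gauss 1\<close> dominates it.\<close>

lemma gauss_kernel_approximate_identity:
  fixes h :: "'a::euclidean_space \<Rightarrow> complex"
  assumes h: "continuous_on UNIV h" and B: "\<And>x. norm (h x) \<le> B"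
    and r: "\<And>n::nat. r n > 0" and r0: "r \<longlonglongrightarrow> 0"
  shows "(\<lambda>n. LINT y|lborel. h y * complex_of_real (gauss_kernel (r n) (y - x))) \<longlonglongrightarrow> h x"
    and "norm (LINT y|lborel. h y * complex_of_real (gauss_kernel (r n) (y - x))) \<le> B"
proof -
  have hm[measurable]: "h \<in> borel_measurable borel"
    using h by (rule borel_measurable_continuous_onI)
  have "B \<ge> 0" using B[of 0] norm_ge_zero order_trans by blast
  have sc: "(LINT y|lborel. h y * complex_of_real (gauss_kernel (r n) (y - x)))
     = (LINT u|lborel. h (x + sqrt (r n) *\<^sub>R u) * complex_of_real (gauss 1 u))" for n
  proof -
    have k: "sqrt (r n) ^ DIM('a) * gauss_kernel (r n) (sqrt (r n) *\<^sub>R u) = gauss 1 u" for u :: 'a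
      using r[of n] by (simp add: gauss_kernel_def gauss_def power_mult_distrib)
    have "(LINT y|lborel. h y * complex_of_real (gauss_kernel (r n) (y - x)))
       = \<bar>sqrt (r n)\<bar> ^ DIM('a) *\<^sub>R (LINT u|lborel. h (x + sqrt (r n) *\<^sub>R u) * complex_of_real (gauss_kernel (r n) (x + sqrt (r n) *\<^sub>R u - x)))"
      by (rule lborel_integral_affine) (use r[of n] in auto)
    also have "\<dots> = (LINT u|lborel. h (x + sqrt (r n) *\<^sub>R u) * (complex_of_real (sqrt (r n) ^ DIM('a)) * complex_of_real (gauss_kernel (r n) (sqrt (r n) *\<^sub>R u))))"
      using r[of n] by (subst integral_scaleR_right[symmetric]) (simp add: scaleR_conv_of_real mult_ac)
    also have "\<dots> = (LINT u|lborel. h (x + sqrt (r n) *\<^sub>R u) * complex_of_real (gauss 1 u))"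
      by (simp only: of_real_mult[symmetric] k)
    finally show ?thesis .
  qed
  have gi: "integrable lborel (gauss 1 :: 'a \<Rightarrow> real)" "(LINT u|lborel. gauss 1 (u::'a)) = 1"
    using integrable_gauss[of 1, where 'a='a] by auto
  have b: "norm (h z * complex_of_real (gauss 1 u)) \<le> B * gauss 1 u" for z u :: 'a
    using B[of z] gauss_nonneg(1)[of 1 u] by (simp add: norm_mult mult_right_mono)
  have "(\<lambda>n. LINT u|lborel. h (x + sqrt (r n) *\<^sub>R u) * complex_of_real (gauss 1 u))
     \<longlonglongrightarrow> (LINT u|lborel. h x * complex_of_real (gauss 1 (u::'a)))"
  proof (rule integral_dominated_convergence)
    show "integrable lborel (\<lambda>u::'a. B * gauss 1 u)"
      using gi by simp
    show "AE u in lborel. (\<lambda>n. h (x + sqrt (r n) *\<^sub>R u) * complex_of_real (gauss 1 u)) \<longlonglongrightarrow> h x * complex_of_real (gauss 1 u)"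
    proof (rule AE_I2)
      fix u :: 'a
      have "(\<lambda>n. x + sqrt (r n) *\<^sub>R u) \<longlonglongrightarrow> x + sqrt 0 *\<^sub>R u"
        by (intro tendsto_intros r0)
      then have "(\<lambda>n. h (x + sqrt (r n) *\<^sub>R u)) \<longlonglongrightarrow> h x"
        using continuous_on_tendsto_compose[OF h] by simp
      then show "(\<lambda>n. h (x + sqrt (r n) *\<^sub>R u) * complex_of_real (gauss 1 u)) \<longlonglongrightarrow> h x * complex_of_real (gauss 1 u)"
        by (intro tendsto_intros)
    qed
  qed (use b in auto)
  also have "(LINT u|lborel. h x * complex_of_real (gauss 1 (u::'a))) = h x"
    using gi(2) by (simp add: integral_complex_of_real)
  finally show "(\<lambda>n. LINT y|lborel. h y * complex_of_real (gauss_kernel (r n) (y - x))) \<longlonglongrightarrow> h x"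
    unfolding sc .
  have "norm (LINT u|lborel. h (x + sqrt (r n) *\<^sub>R u) * complex_of_real (gauss 1 u)) \<le> (LINT u|lborel. B * gauss 1 (u::'a))"
    using gi b \<open>B \<ge> 0\<close>
    by (intro order_trans[OF integral_norm_bound] integral_mono') (auto simp: gauss_nonneg)
  then show "norm (LINT y|lborel. h y * complex_of_real (gauss_kernel (r n) (y - x))) \<le> B"
    unfolding sc using gi(2) by simp
qed

text \<open>Let the Gaussian in \<open>ft_gauss_pairing\<close> flatten out. The frequency side
  converges by domination with the product assumed integrable, the space side because the kernel is
  an approximate identity; that is where continuity and boundedness of \<open>h\<close>
  enter.\<close>

lemma ft_parseval:
  fixes f h :: "'a::euclidean_space \<Rightarrow> complex"
  assumes f: "integrable lborel f" and h: "integrable lborel h" and s: "\<bar>s\<bar> = 1"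
    and hc: "continuous_on UNIV h" and B: "\<And>x. norm (h x) \<le> B"
    and int: "integrable lborel (\<lambda>\<xi>. ft s f \<xi> * cnj (ft s h \<xi>))"
  shows "(LINT \<xi>|lborel. ft s f \<xi> * cnj (ft s h \<xi>)) = (LINT x|lborel. f x * cnj (h x))"
proof -
  have [measurable]: "f \<in> borel_measurable borel" "h \<in> borel_measurable borel"
    using f h by auto
  define r where "r n = 1 / real (Suc n)" for n
  have r: "r n > 0" for n by (simp add: r_def)
  have r0: "r \<longlonglongrightarrow> 0"
    unfolding r_def[abs_def] by (rule LIMSEQ_Suc[OF lim_1_over_n])
  have ch: "continuous_on UNIV (\<lambda>x. cnj (h x))" and cB: "\<And>x. norm (cnj (h x)) \<le> B"
    using hc B by (auto intro!: continuous_intros)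
  have g: "\<bar>gauss (r n) \<xi>\<bar> \<le> 1" for n and \<xi> :: 'a
    using gauss_nonneg(1)[of "r n" \<xi>] gauss_le_1[OF less_imp_le[OF r[of n]], of \<xi>] by simp
  note ai = gauss_kernel_approximate_identity[OF ch cB r r0]
  have "B \<ge> 0" using B[of 0] norm_ge_zero order_trans by blast
  have 1: "(\<lambda>n. LINT \<xi>|lborel. ft s f \<xi> * (cnj (ft s h \<xi>) * complex_of_real (gauss (r n) \<xi>)))
     \<longlonglongrightarrow> (LINT \<xi>|lborel. ft s f \<xi> * cnj (ft s h \<xi>))"
  proof (rule integral_dominated_convergence)
    show "integrable lborel (\<lambda>\<xi>. norm (ft s f \<xi> * cnj (ft s h \<xi>)))"
      using int by simp
    show "AE \<xi> in lborel. (\<lambda>n. ft s f \<xi> * (cnj (ft s h \<xi>) * complex_of_real (gauss (r n) \<xi>))) \<longlonglongrightarrow> ft s f \<xi> * cnj (ft s h \<xi>)"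
    proof (rule AE_I2)
      fix \<xi> :: 'a
      have "(\<lambda>n. ft s f \<xi> * (cnj (ft s h \<xi>) * complex_of_real (exp (- (pi * r n * (norm \<xi>)\<^sup>2)))))
         \<longlonglongrightarrow> ft s f \<xi> * (cnj (ft s h \<xi>) * complex_of_real (exp (- (pi * 0 * (norm \<xi>)\<^sup>2))))"
        by (intro tendsto_intros r0)
      then show "(\<lambda>n. ft s f \<xi> * (cnj (ft s h \<xi>) * complex_of_real (gauss (r n) \<xi>))) \<longlonglongrightarrow> ft s f \<xi> * cnj (ft s h \<xi>)"
        by (simp add: gauss_def)
    qed
    show "AE \<xi> in lborel. norm (ft s f \<xi> * (cnj (ft s h \<xi>) * complex_of_real (gauss (r n) \<xi>))) \<le> norm (ft s f \<xi> * cnj (ft s h \<xi>))" for n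
      using g by (intro AE_I2) (auto simp: norm_mult intro!: mult_left_mono mult_left_le)
  qed measurable
  have 2: "(\<lambda>n. LINT x|lborel. f x * (LINT y|lborel. cnj (h y) * complex_of_real (gauss_kernel (r n) (y - x))))
     \<longlonglongrightarrow> (LINT x|lborel. f x * cnj (h x))"
  proof (rule integral_dominated_convergence)
    show "integrable lborel (\<lambda>x. norm (f x) * B)"
      using f by simp
    show "AE x in lborel. (\<lambda>n. f x * (LINT y|lborel. cnj (h y) * complex_of_real (gauss_kernel (r n) (y - x)))) \<longlonglongrightarrow> f x * cnj (h x)"
      by (intro AE_I2 tendsto_intros ai)
    show "AE x in lborel. norm (f x * (LINT y|lborel. cnj (h y) * complex_of_real (gauss_kernel (r n) (y - x)))) \<le> norm (f x) * B" for n
      unfolding norm_mult by (intro AE_I2 mult_left_mono ai) auto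
  qed measurable
  show ?thesis
    using LIMSEQ_unique[OF 1] 2 unfolding ft_gauss_pairing[OF f h r s] by blast
qed

section \<open>Plancherel theory for square integrable functions\<close>

text \<open>The squared norm, as an extended nonnegative number: finiteness becomes part of a
  statement instead of a side condition. Being a square, it satisfies the triangle inequality only
  up to a factor 2.\<close>

definition sqnorm :: "(real^2 \<Rightarrow> complex) \<Rightarrow> ennreal" where
  "sqnorm f = (\<integral>\<^sup>+x. ennreal ((cmod (f x))\<^sup>2) \<partial>lborel)"

lemma L2_limit_sqnorm:
  "L2_limit F g \<longleftrightarrow> L2 g \<and> ((\<lambda>R. sqnorm (\<lambda>x. F R x - g x)) \<longlongrightarrow> 0) at_top"
  unfolding L2_limit_def sqnorm_def ..

lemma L2_measurable: "L2 f \<Longrightarrow> f \<in> borel_measurable borel"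
  by (simp add: L2_def)

lemma L2_iff: "L2 f \<longleftrightarrow> f \<in> borel_measurable borel \<and> sqnorm f < \<infinity>"
  unfolding L2_def sqnorm_def by (auto simp: integrable_iff_bounded)

lemma sqnorm_L2: "L2 f \<Longrightarrow> sqnorm f = ennreal (LINT x|lborel. (cmod (f x))\<^sup>2)"
  unfolding L2_def sqnorm_def by (intro nn_integral_eq_integral) auto

lemma sqnorm_minus_commute: "sqnorm (\<lambda>x. f x - g x) = sqnorm (\<lambda>x. g x - f x)"
  by (simp add: sqnorm_def norm_minus_commute)

lemma sqnorm_mono: "(\<And>x. cmod (f x) \<le> cmod (g x)) \<Longrightarrow> sqnorm f \<le> sqnorm g"
  unfolding sqnorm_def by (intro nn_integral_mono ennreal_leI power_mono) auto

lemma sqnorm_diff_le: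
  assumes [measurable]: "f \<in> borel_measurable borel" "g \<in> borel_measurable borel"
  shows "sqnorm (\<lambda>x. f x - g x) \<le> 2 * sqnorm f + 2 * sqnorm g"
proof -
  have "sqnorm (\<lambda>x. f x - g x) \<le> (\<integral>\<^sup>+x. 2 * ennreal ((cmod (f x))\<^sup>2) + 2 * ennreal ((cmod (g x))\<^sup>2) \<partial>lborel)"
    unfolding sqnorm_def
  proof (rule nn_integral_mono)
    fix x
    have "(cmod (f x - g x))\<^sup>2 \<le> (cmod (f x) + cmod (g x))\<^sup>2"
      by (intro power_mono norm_triangle_ineq4) auto
    also have "\<dots> \<le> 2 * (cmod (f x))\<^sup>2 + 2 * (cmod (g x))\<^sup>2"
      using zero_le_power2[of "cmod (f x) - cmod (g x)"] by (simp add: power2_eq_square algebra_simps)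
    finally have "ennreal ((cmod (f x - g x))\<^sup>2) \<le> ennreal (2 * (cmod (f x))\<^sup>2 + 2 * (cmod (g x))\<^sup>2)"
      by (rule ennreal_leI)
    then show "ennreal ((cmod (f x - g x))\<^sup>2) \<le> 2 * ennreal ((cmod (f x))\<^sup>2) + 2 * ennreal ((cmod (g x))\<^sup>2)"
      by (simp add: ennreal_plus ennreal_mult)
  qed
  also have "\<dots> = 2 * sqnorm f + 2 * sqnorm g"
    unfolding sqnorm_def by (simp add: nn_integral_add nn_integral_cmult)
  finally show ?thesis .
qed

lemma L2_diff:
  assumes "L2 f" "L2 g"
  shows "L2 (\<lambda>x. f x - g x)"
proof -
  have "2 * sqnorm f + 2 * sqnorm g < \<infinity>"
    using assms by (simp add: L2_iff ennreal_mult_less_top)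
  then show ?thesis
    using assms sqnorm_diff_le[of f g] by (auto simp: L2_iff intro: le_less_trans)
qed

lemma sqnorm_triangle:
  assumes [measurable]: "f \<in> borel_measurable borel" "g \<in> borel_measurable borel" "h \<in> borel_measurable borel"
  shows "sqnorm (\<lambda>x. f x - g x) \<le> 2 * sqnorm (\<lambda>x. f x - h x) + 2 * sqnorm (\<lambda>x. h x - g x)"
  using sqnorm_diff_le[of "\<lambda>x. f x - h x" "\<lambda>x. g x - h x"]
  by (simp add: sqnorm_minus_commute[of h g])

lemma L2_bounded_mult:
  assumes f: "L2 f" and [measurable]: "h \<in> borel_measurable borel" and h: "\<And>x. cmod (h x) \<le> 1"
  shows "L2 (\<lambda>x. h x * f x)"
proof -
  have "cmod (h x * f x) \<le> cmod (f x)" for x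
    using h[of x] by (simp add: norm_mult mult_left_le_one_le)
  then have "sqnorm (\<lambda>x. h x * f x) \<le> sqnorm f"
    by (rule sqnorm_mono)
  with f show ?thesis by (auto simp: L2_iff)
qed

lemma L2_cnj: "L2 f \<Longrightarrow> L2 (\<lambda>x. cnj (f x))"
  using measurable_compose[of f borel borel cnj] by (simp add: L2_def borel_measurable_cnj)

lemma integrable_L2_mult:
  assumes "L2 f" "L2 g"
  shows "integrable lborel (\<lambda>x. f x * g x)"
proof (rule Bochner_Integration.integrable_bound)
  show "integrable lborel (\<lambda>x. (cmod (f x))\<^sup>2 + (cmod (g x))\<^sup>2)"
    using assms by (simp add: L2_def)
  show "(\<lambda>x. f x * g x) \<in> borel_measurable lborel"
    using assms by (auto simp: L2_def intro!: borel_measurable_times)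
  have "a * b \<le> a\<^sup>2 + b\<^sup>2" if "a \<ge> 0" "b \<ge> 0" for a b :: real
  proof -
    have "a * b \<ge> 0" using that by simp
    then show ?thesis
      using zero_le_power2[of "a - b"] unfolding power2_diff by linarith
  qed
  then show "AE x in lborel. norm (f x * g x) \<le> norm ((cmod (f x))\<^sup>2 + (cmod (g x))\<^sup>2)"
    by (intro AE_I2) (simp add: norm_mult)
qed

text \<open>Carries identities proved for truncated functions over to their limits in L2. Instead of
  Cauchy-Schwarz the weighted inequality a b <= l b^2 + a^2 / l is used, with a weight close to the
  distance from the limit.\<close>

lemma L2_limit_pairing:
  assumes lim: "L2_limit F g" and F: "\<And>R. L2 (F R)" and h: "L2 h"
  shows "((\<lambda>R. LINT x|lborel. F R x * h x) \<longlongrightarrow> (LINT x|lborel. g x * h x)) at_top"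
proof -
  have g: "L2 g" and lim0: "((\<lambda>R. sqnorm (\<lambda>x. F R x - g x)) \<longlongrightarrow> 0) at_top"
    using lim by (auto simp: L2_limit_sqnorm)
  define I where "I R = (LINT x|lborel. (cmod (F R x - g x))\<^sup>2)" for R
  define J where "J = (LINT x|lborel. (cmod (h x))\<^sup>2)"
  have I0: "I R \<ge> 0" for R by (simp add: I_def)
  have "sqnorm (\<lambda>x. F R x - g x) = ennreal (I R)" for R
    unfolding I_def by (intro sqnorm_L2 L2_diff F g)
  with lim0 have "((\<lambda>R. ennreal (I R)) \<longlongrightarrow> ennreal 0) at_top"
    by simp
  then have I: "(I \<longlongrightarrow> 0) at_top"
    by (rule tendsto_ennrealD) (use I0 in auto)
  have bound: "cmod ((LINT x|lborel. F R x * h x) - (LINT x|lborel. g x * h x))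
      \<le> (sqrt (I R) + 1 / R) * J + sqrt (I R)" if R: "R > 0" for R
  proof -
    \<comment> \<open>The term \<open>1 / R\<close> keeps the weight positive when the distance
      vanishes and still disappears in the limit.\<close>
    define l where "l = sqrt (I R) + 1 / R"
    have l: "l > 0" "l \<ge> sqrt (I R)"
      using R I0[of R] by (auto simp: l_def intro: add_nonneg_pos)
    have d: "L2 (\<lambda>x. F R x - g x)" by (intro L2_diff F g)
    have "(LINT x|lborel. F R x * h x) - (LINT x|lborel. g x * h x) = (LINT x|lborel. (F R x - g x) * h x)"
      using integrable_L2_mult[OF F h] integrable_L2_mult[OF g h]
      by (simp add: left_diff_distrib)
    also have "cmod \<dots> \<le> (LINT x|lborel. l * (cmod (h x))\<^sup>2 + (cmod (F R x - g x))\<^sup>2 / l)"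
    proof (intro order_trans[OF integral_norm_bound] integral_mono')
      show "integrable lborel (\<lambda>x. l * (cmod (h x))\<^sup>2 + (cmod (F R x - g x))\<^sup>2 / l)"
        using h d by (simp add: L2_def)
      show "0 \<le> l * (cmod (h x))\<^sup>2 + (cmod (F R x - g x))\<^sup>2 / l" for x
        using l by simp
      have "a * b \<le> l * b\<^sup>2 + a\<^sup>2 / l" if "a \<ge> 0" "b \<ge> 0" for a b :: real
      proof -
        have "0 \<le> (a - l * b)\<^sup>2 + a * (l * b)" using that l by simp
        also have "\<dots> = (a\<^sup>2 + l\<^sup>2 * b\<^sup>2) - l * (a * b)" by (simp add: power2_eq_square algebra_simps)
        finally have "l * (a * b) \<le> l * (l * b\<^sup>2 + a\<^sup>2 / l)"
          using l by (simp add: power2_eq_square algebra_simps)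
        then show ?thesis using l by simp
      qed
      then show "cmod ((F R x - g x) * h x) \<le> l * (cmod (h x))\<^sup>2 + (cmod (F R x - g x))\<^sup>2 / l" for x
        by (simp add: norm_mult)
    qed
    also have "\<dots> = l * J + I R / l"
      using h d by (simp add: J_def I_def L2_def)
    also have "I R / l \<le> sqrt (I R)"
    proof -
      have "I R = sqrt (I R) * sqrt (I R)" using I0 by simp
      also have "\<dots> \<le> sqrt (I R) * l" using l I0 by (intro mult_left_mono) auto
      finally show ?thesis using l by (simp add: divide_le_eq)
    qed
    finally show ?thesis unfolding l_def by simp
  qed
  have "((\<lambda>R. (sqrt (I R) + 1 / R) * J + sqrt (I R)) \<longlongrightarrow> (sqrt 0 + 0) * J + sqrt 0) at_top"
    by (intro tendsto_intros I) real_asymp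
  then have "((\<lambda>R. (sqrt (I R) + 1 / R) * J + sqrt (I R)) \<longlongrightarrow> 0) at_top" by simp
  moreover have "eventually (\<lambda>R. cmod ((LINT x|lborel. F R x * h x) - (LINT x|lborel. g x * h x))
      \<le> (sqrt (I R) + 1 / R) * J + sqrt (I R)) at_top"
    using eventually_gt_at_top[of 0] by eventually_elim (rule bound)
  ultimately have "((\<lambda>R. (LINT x|lborel. F R x * h x) - (LINT x|lborel. g x * h x)) \<longlongrightarrow> 0) at_top"
    by (rule Lim_null_comparison[rotated])
  then show ?thesis by (rule Lim_null[THEN iffD2])
qed

lemma tendsto_0_ennrealI:
  fixes f :: "'a \<Rightarrow> ennreal"
  assumes "\<And>e. e > 0 \<Longrightarrow> eventually (\<lambda>x. f x \<le> ennreal e) F"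
  shows "(f \<longlongrightarrow> 0) F"
proof (rule order_tendstoI)
  fix a :: ennreal assume "0 < a"
  then obtain b where b: "0 < b" "b < a" using dense by blast
  then obtain e where e: "b = ennreal e" "e > 0"
    by (cases b) (auto simp: ennreal_zero_less_top top_unique)
  show "eventually (\<lambda>x. f x < a) F"
    using assms[OF e(2)] by eventually_elim (use b e in auto)
qed simp

text \<open>Riesz-Fischer: along a fast subsequence Borel-Cantelli gives pointwise convergence almost
  everywhere, and Fatou's lemma then identifies the limit in \<open>L\<^sup>2\<close>.\<close>

lemma L2_complete:
  assumes F: "\<And>R. L2 (F R)"
    and cauchy: "\<And>e. e > 0 \<Longrightarrow> \<exists>R0. \<forall>R\<ge>R0. \<forall>S\<ge>R0. sqnorm (\<lambda>x. F R x - F S x) \<le> ennreal e"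
  shows "\<exists>g. L2_limit F g"
proof -
  have [measurable]: "F R \<in> borel_measurable borel" for R
    using F by (rule L2_measurable)
  \<comment> \<open>The rate 8^-n leaves room for two summable sequences: with the threshold 4^-n
    for the squared increments, Markov's inequality bounds the exceptional sets by 2^-n, and outside
    them the increments are at most 2^-n.\<close>
  have "\<forall>n. \<exists>R0. \<forall>R\<ge>R0. \<forall>S\<ge>R0. sqnorm (\<lambda>x. F R x - F S x) \<le> ennreal ((1/8) ^ n)"
    by (intro allI cauchy) simp
  then obtain q where q: "\<And>n R S. q n \<le> R \<Longrightarrow> q n \<le> S \<Longrightarrow> sqnorm (\<lambda>x. F R x - F S x) \<le> ennreal ((1/8) ^ n)"
    by metis
  \<comment> \<open>Summing makes the indices increasing and at least \<open>q n\<close>; the added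
    1 in each term makes them tend to infinity.\<close>
  define p where "p n = (\<Sum>i\<le>n. \<bar>q i\<bar> + 1)" for n
  have pq: "p n \<ge> q n" for n
  proof -
    have "\<bar>q n\<bar> + 1 \<le> p n"
      unfolding p_def by (rule member_le_sum) auto
    then show ?thesis by linarith
  qed
  have pS: "p (Suc n) \<ge> p n" for n by (simp add: p_def)
  have pn: "p n \<ge> real n" for n
    by (induction n) (auto simp: p_def)
  define D where "D n x = F (p (Suc n)) x - F (p n) x" for n x
  have [measurable]: "D n \<in> borel_measurable borel" for n
    unfolding D_def[abs_def] by measurable
  have D: "sqnorm (D n) \<le> ennreal ((1/8) ^ n)" for n
    unfolding D_def[abs_def] using q[of n "p (Suc n)" "p n"] pq[of n] pS[of n] by auto
  define A where "A n = {x \<in> space lborel. 1 \<le> ennreal (4 ^ n) * ennreal ((cmod (D n x))\<^sup>2)}" for n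
  have Am[measurable]: "A n \<in> sets lborel" for n unfolding A_def by measurable
  have Ae: "emeasure lborel (A n) \<le> ennreal ((1/2) ^ n)" for n
  proof -
    have "emeasure lborel (A n) \<le> ennreal (4 ^ n) * (\<integral>\<^sup>+x. ennreal ((cmod (D n x))\<^sup>2) * indicator (space lborel) x \<partial>lborel)"
      unfolding A_def by (rule order_trans[OF _ nn_integral_Markov_inequality]) auto
    also have "(\<integral>\<^sup>+x. ennreal ((cmod (D n x))\<^sup>2) * indicator (space lborel) x \<partial>lborel) = sqnorm (D n)"
      by (simp add: sqnorm_def)
    also have "ennreal (4 ^ n) * sqnorm (D n) \<le> ennreal (4 ^ n) * ennreal ((1/8) ^ n)"
      by (intro mult_left_mono D) auto
    also have "\<dots> = ennreal ((1/2) ^ n)"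
      by (subst ennreal_mult'[symmetric]) (auto simp: power_mult_distrib[symmetric])
    finally show ?thesis .
  qed
  have "AE x in lborel. eventually (\<lambda>n. x \<in> space lborel - A n) sequentially"
  proof (rule borel_cantelli_AE1[OF Am])
    show "emeasure lborel (A n) < \<infinity>" for n
      using Ae[of n] by (auto simp: less_top[symmetric] top_unique)
    have "measure lborel (A n) \<le> (1/2) ^ n" for n
      unfolding measure_def using Ae[of n] by (intro enn2real_leI) auto
    then show "summable (\<lambda>n. measure lborel (A n))"
      by (intro summable_comparison_test'[OF summable_geometric[of "1/2::real"]]) auto
  qed
  then have conv: "AE x in lborel. convergent (\<lambda>n. F (p n) x)"
  proof eventually_elim
    case (elim x)
    then have "eventually (\<lambda>n. cmod (D n x) \<le> (1/2) ^ n) sequentially"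
    proof eventually_elim
      case (elim n)
      then have "ennreal (4 ^ n) * ennreal ((cmod (D n x))\<^sup>2) < 1"
        by (simp add: A_def not_le)
      then have "4 ^ n * (cmod (D n x))\<^sup>2 < 1"
        by (subst (asm) ennreal_mult'[symmetric]) auto
      moreover have "(2 ^ n)\<^sup>2 = (4::real) ^ n"
        by (simp add: power2_eq_square flip: power_mult_distrib)
      ultimately have "(2 ^ n * cmod (D n x))\<^sup>2 \<le> 1\<^sup>2"
        by (simp add: power_mult_distrib)
      then have "2 ^ n * cmod (D n x) \<le> 1"
        by (rule power2_le_imp_le) simp
      then show ?case
        by (simp add: field_simps)
    qed
    then have "summable (\<lambda>n. D n x)"
      by (intro summable_comparison_test_ev[OF _ summable_geometric[of "1/2::real"]]) auto
    then have "convergent (\<lambda>n. F (p 0) x + (\<Sum>i<n. D i x))"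
      by (intro convergent_add convergent_const) (simp add: summable_iff_convergent)
    moreover have "F (p 0) x + (\<Sum>i<n. D i x) = F (p n) x" for n
      unfolding D_def sum_lessThan_telescope[of "\<lambda>n. F (p n) x"] by simp
    ultimately show ?case by simp
  qed
  define g where "g x = lim (\<lambda>n. F (p n) x)" for x
  have gm[measurable]: "g \<in> borel_measurable borel"
    unfolding g_def[abs_def] by measurable
  have ae: "AE x in lborel. (\<lambda>n. F (p n) x) \<longlonglongrightarrow> g x"
    using conv by eventually_elim (simp add: g_def convergent_LIMSEQ_iff)
  have fatou: "sqnorm (\<lambda>x. F R x - g x) \<le> ennreal e"
    if "e > 0" "\<forall>R\<ge>R0. \<forall>S\<ge>R0. sqnorm (\<lambda>x. F R x - F S x) \<le> ennreal e" "R \<ge> R0" for R R0 e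
  proof -
    have "AE x in lborel. ennreal ((cmod (F R x - g x))\<^sup>2) = liminf (\<lambda>n. ennreal ((cmod (F R x - F (p n) x))\<^sup>2))"
      using ae
    proof eventually_elim
      case (elim x)
      then have "(\<lambda>n. ennreal ((cmod (F R x - F (p n) x))\<^sup>2)) \<longlonglongrightarrow> ennreal ((cmod (F R x - g x))\<^sup>2)"
        by (intro tendsto_ennrealI tendsto_intros)
      then show ?case by (intro lim_imp_Liminf[symmetric]) auto
    qed
    then have "sqnorm (\<lambda>x. F R x - g x) = (\<integral>\<^sup>+x. liminf (\<lambda>n. ennreal ((cmod (F R x - F (p n) x))\<^sup>2)) \<partial>lborel)"
      unfolding sqnorm_def by (rule nn_integral_cong_AE)
    also have "\<dots> \<le> liminf (\<lambda>n. sqnorm (\<lambda>x. F R x - F (p n) x))"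
      unfolding sqnorm_def by (rule nn_integral_liminf) measurable
    also have "\<dots> \<le> ennreal e"
    proof (rule Liminf_le)
      have "eventually (\<lambda>n. real n \<ge> R0) sequentially"
        by (rule eventually_ge_at_top[THEN filterlim_real_sequentially[unfolded filterlim_iff, rule_format]])
      then show "\<forall>\<^sub>F n in sequentially. sqnorm (\<lambda>x. F R x - F (p n) x) \<le> ennreal e"
        by eventually_elim (use that pn in \<open>meson order_trans\<close>)
    qed simp
    finally show ?thesis .
  qed
  have ev: "eventually (\<lambda>R. sqnorm (\<lambda>x. F R x - g x) \<le> ennreal e) at_top" if e: "e > 0" for e
  proof -
    obtain R0 where R0: "\<forall>R\<ge>R0. \<forall>S\<ge>R0. sqnorm (\<lambda>x. F R x - F S x) \<le> ennreal e"
      using cauchy[OF e] by blast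
    show ?thesis
      using eventually_ge_at_top[of R0] by eventually_elim (rule fatou[OF e R0])
  qed
  \<comment> \<open>One index suffices for membership of the limit: \<open>F R\<close> and
    \<open>F R - g\<close> are square integrable, hence so is \<open>g\<close>.\<close>
  obtain R where "sqnorm (\<lambda>x. F R x - g x) \<le> ennreal 1"
    using eventually_happens[OF ev[of 1]] by auto
  then have "L2 (\<lambda>x. F R x - g x)"
    by (auto simp: L2_iff le_less_trans)
  from L2_diff[OF F[of R] this] have "L2 g" by simp
  then show ?thesis
    unfolding L2_limit_sqnorm using tendsto_0_ennrealI[OF ev] by blast
qed

section \<open>Extension of the transform from truncations to square integrable functions\<close>

definition truncated :: "real \<Rightarrow> (real^2 \<Rightarrow> complex) \<Rightarrow> real^2 \<Rightarrow> complex" where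
  "truncated R f x = indicator (cball 0 R) x * f x"

lemma L2_truncated: "L2 f \<Longrightarrow> L2 (truncated R f)"
  unfolding truncated_def[abs_def]
  by (rule L2_bounded_mult)
    (auto intro!: borel_measurable_indicator borel_closed split: split_indicator)

text \<open>A ball has finite measure, so its indicator is square integrable, and a product of two
  square integrable functions is integrable.\<close>

lemma integrable_truncated:
  assumes "L2 f"
  shows "integrable lborel (truncated R f)"
proof -
  have "L2 (indicator (cball 0 R))"
  proof -
    have "ennreal ((cmod (indicator (cball 0 R) x))\<^sup>2) = indicator (cball 0 R) x" for x :: "real^2"
      by (auto split: split_indicator)
    moreover have "indicator (cball 0 R) \<in> borel_measurable (borel :: (real^2) measure)"
      by (intro borel_measurable_indicator borel_closed closed_cball)
    ultimately show ?thesis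
      using emeasure_bounded_finite[OF bounded_cball, of "0::real^2" R]
      by (simp add: L2_iff sqnorm_def)
  qed
  from integrable_L2_mult[OF this assms] show ?thesis
    by (simp add: truncated_def[abs_def])
qed

lemma L2_limit_truncated:
  assumes f: "L2 f"
  shows "L2_limit (\<lambda>R. truncated R f) f"
proof -
  have [measurable]: "f \<in> borel_measurable borel"
    using f by (rule L2_measurable)
  have "((\<lambda>R. LINT x|lborel. (cmod (truncated R f x - f x))\<^sup>2) \<longlongrightarrow> (LINT x|(lborel::(real^2) measure). 0)) at_top"
  proof (rule integral_dominated_convergence_at_top)
    show "integrable lborel (\<lambda>x. (cmod (f x))\<^sup>2)"
      using f by (simp add: L2_def)
    show "\<forall>\<^sub>F R in at_top. AE x in lborel. norm ((cmod (truncated R f x - f x))\<^sup>2) \<le> (cmod (f x))\<^sup>2"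
      by (intro always_eventually allI AE_I2) (auto simp: truncated_def split: split_indicator)
    show "AE x in lborel. ((\<lambda>R. (cmod (truncated R f x - f x))\<^sup>2) \<longlongrightarrow> 0) at_top"
    proof (rule AE_I2)
      fix x
      have "eventually (\<lambda>R. (cmod (truncated R f x - f x))\<^sup>2 = 0) at_top"
        using eventually_ge_at_top[of "norm x"] by eventually_elim (simp add: truncated_def)
      then show "((\<lambda>R. (cmod (truncated R f x - f x))\<^sup>2) \<longlongrightarrow> 0) at_top"
        by (rule tendsto_eventually)
    qed
    show "(\<lambda>x. (cmod (truncated R f x - f x))\<^sup>2) \<in> borel_measurable lborel" for R
      using L2_measurable[OF L2_diff[OF L2_truncated[OF f, of R] f]] by measurable
  qed simp
  then have "((\<lambda>R. ennreal (LINT x|lborel. (cmod (truncated R f x - f x))\<^sup>2)) \<longlongrightarrow> ennreal 0) at_top"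
    by (intro tendsto_ennrealI) simp
  then show ?thesis
    unfolding L2_limit_sqnorm using f by (simp add: sqnorm_L2 L2_diff L2_truncated)
qed

lemma ft_L2:
  assumes "integrable lborel f" "L2 f" "\<bar>s\<bar> = 1"
  shows "L2 (ft s f)"
  using ft_L2_bound[OF assms(1,3)] assms(2) by (auto simp: L2_iff sqnorm_def)

text \<open>On truncations the transform does not increase the square norm, so it sends the Cauchy
  family of truncations to a Cauchy family, and completeness provides the limit.\<close>

lemma L2_limit_ft_exists:
  assumes f: "L2 f" and s: "\<bar>s\<bar> = 1"
  shows "\<exists>g. L2_limit (\<lambda>R. ft s (truncated R f)) g"
proof (rule L2_complete)
  note i = integrable_truncated[OF f] and l = L2_truncated[OF f]
  show "L2 (ft s (truncated R f))" for R
    by (intro ft_L2 i l s)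
  fix e :: real assume e: "e > 0"
  have "((\<lambda>R. sqnorm (\<lambda>x. truncated R f x - f x)) \<longlongrightarrow> 0) at_top"
    using L2_limit_truncated[OF f] by (simp add: L2_limit_sqnorm)
  \<comment> \<open>The quarter pays for two distances to \<open>f\<close>, each entering the
    triangle inequality with the factor 2.\<close>
  then have "eventually (\<lambda>R. sqnorm (\<lambda>x. truncated R f x - f x) < ennreal (e / 4)) at_top"
    by (rule order_tendstoD) (use e in simp)
  then obtain R0 where R0: "\<And>R. R \<ge> R0 \<Longrightarrow> sqnorm (\<lambda>x. truncated R f x - f x) < ennreal (e / 4)"
    by (auto simp: eventually_at_top_linorder)
  have "sqnorm (\<lambda>x. ft s (truncated R f) x - ft s (truncated S f) x) \<le> ennreal e"
    if "R \<ge> R0" "S \<ge> R0" for R S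
  proof -
    have "sqnorm (\<lambda>x. ft s (truncated R f) x - ft s (truncated S f) x)
        = sqnorm (ft s (\<lambda>x. truncated R f x - truncated S f x))"
      by (simp add: sqnorm_def ft_diff[OF i i])
    also have "\<dots> \<le> sqnorm (\<lambda>x. truncated R f x - truncated S f x)"
      unfolding sqnorm_def by (intro ft_L2_bound s Bochner_Integration.integrable_diff i)
    also have "\<dots> \<le> 2 * sqnorm (\<lambda>x. truncated R f x - f x) + 2 * sqnorm (\<lambda>x. f x - truncated S f x)"
      by (intro sqnorm_triangle L2_measurable l f)
    also have "\<dots> \<le> 2 * ennreal (e / 4) + 2 * ennreal (e / 4)"
      unfolding sqnorm_minus_commute[of f] using R0[OF that(1)] R0[OF that(2)]
      by (intro add_mono mult_left_mono less_imp_le) auto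
    also have "\<dots> = ennreal (2 * (e / 4) + 2 * (e / 4))"
    proof -
      have "2 * ennreal (e / 4) = ennreal (2 * (e / 4))"
        using e by (subst ennreal_mult') auto
      then show ?thesis
        using e by (simp only: ennreal_plus[symmetric])
    qed
    also have "\<dots> = ennreal e" by simp
    finally show ?thesis .
  qed
  then show "\<exists>R0. \<forall>R\<ge>R0. \<forall>S\<ge>R0. sqnorm (\<lambda>x. ft s (truncated R f) x - ft s (truncated S f) x) \<le> ennreal e"
    by blast
qed

text \<open>For the two signs this is the same choice as in \<open>fourier\<close> and
  \<open>inverse_fourier\<close>, because the integral over a ball is the transform of the
  truncation. The identification is therefore an equality of functions and not only almost
  everywhere.\<close>

definition L2_ft :: "real \<Rightarrow> (real^2 \<Rightarrow> complex) \<Rightarrow> real^2 \<Rightarrow> complex" where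
  "L2_ft s f = (SOME g. L2_limit (\<lambda>R. ft s (truncated R f)) g)"

lemma set_integral_eq_ft_truncated:
  "(LINT x:cball 0 R|lborel. cis (s * (2 * pi * (\<xi> \<bullet> x))) * f x) = ft s (truncated R f) \<xi>"
  unfolding set_lebesgue_integral_def ft_def truncated_def
  by (intro Bochner_Integration.integral_cong refl) (auto split: split_indicator)

lemma fourier_eq_L2_ft: "fourier f = L2_ft (-1) f"
  unfolding fourier_def L2_ft_def set_integral_eq_ft_truncated[symmetric] by simp

lemma inverse_fourier_eq_L2_ft: "inverse_fourier f = L2_ft 1 f"
  unfolding inverse_fourier_def L2_ft_def set_integral_eq_ft_truncated[symmetric]
  by (simp add: inner_commute)

lemma L2_limit_L2_ft:
  assumes "L2 f" "\<bar>s\<bar> = 1"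
  shows "L2_limit (\<lambda>R. ft s (truncated R f)) (L2_ft s f)"
  unfolding L2_ft_def by (rule someI_ex[OF L2_limit_ft_exists[OF assms]])

lemma L2_L2_ft: "L2 f \<Longrightarrow> \<bar>s\<bar> = 1 \<Longrightarrow> L2 (L2_ft s f)"
  using L2_limit_L2_ft by (auto simp: L2_limit_def)

text \<open>Truncating \<open>u\<close> gives the formula for integrable functions; both of its
  sides converge as the ball grows, and limits are unique.\<close>

lemma L2_ft_mult_formula_integrable:
  assumes u: "L2 u" and h: "L2 h" "integrable lborel h" and s: "\<bar>s\<bar> = 1"
  shows "(LINT x|lborel. L2_ft s u x * h x) = (LINT \<xi>|lborel. u \<xi> * ft s h \<xi>)"
proof -
  have "((\<lambda>R. LINT x|lborel. ft s (truncated R u) x * h x) \<longlongrightarrow> (LINT x|lborel. L2_ft s u x * h x)) at_top"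
    by (intro L2_limit_pairing L2_limit_L2_ft ft_L2 integrable_truncated L2_truncated u h s)
  moreover have "((\<lambda>R. LINT x|lborel. truncated R u x * ft s h x) \<longlongrightarrow> (LINT x|lborel. u x * ft s h x)) at_top"
    by (intro L2_limit_pairing L2_limit_truncated L2_truncated ft_L2 u h s)
  ultimately show ?thesis
    unfolding ft_mult_formula[OF integrable_truncated[OF u] h(2)]
    by (intro tendsto_unique[OF trivial_limit_at_top_linorder])
qed

text \<open>Weak continuity is tested against arbitrary square integrable functions, so the second
  factor cannot be taken integrable. Truncating it leads back to the preceding case.\<close>

lemma L2_ft_mult_formula:
  assumes u: "L2 u" and h: "L2 h" and s: "\<bar>s\<bar> = 1"
  shows "(LINT x|lborel. L2_ft s u x * h x) = (LINT \<xi>|lborel. u \<xi> * L2_ft s h \<xi>)"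
proof -
  have "((\<lambda>R. LINT x|lborel. truncated R h x * L2_ft s u x) \<longlongrightarrow> (LINT x|lborel. h x * L2_ft s u x)) at_top"
    by (intro L2_limit_pairing L2_limit_truncated L2_truncated L2_L2_ft u h s)
  moreover have "((\<lambda>R. LINT x|lborel. ft s (truncated R h) x * u x) \<longlongrightarrow> (LINT x|lborel. L2_ft s h x * u x)) at_top"
    by (intro L2_limit_pairing L2_limit_L2_ft L2_truncated ft_L2 integrable_truncated u h s)
  moreover have "(LINT x|lborel. truncated R h x * L2_ft s u x) = (LINT x|lborel. ft s (truncated R h) x * u x)" for R
    using L2_ft_mult_formula_integrable[OF u L2_truncated[OF h] integrable_truncated[OF h] s]
    by (simp add: mult.commute)
  ultimately show ?thesis
    using tendsto_unique[OF trivial_limit_at_top_linorder] by (simp add: mult.commute)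
qed

text \<open>Replaces the inversion theorem: it recovers the pairing of a function with a regular one
  from the transforms alone, and so identifies the initial datum.\<close>

lemma L2_ft_parseval:
  assumes f: "L2 f" and h: "L2 h" "integrable lborel h" "continuous_on UNIV h" and B: "\<And>x. cmod (h x) \<le> B"
    and s: "\<bar>s\<bar> = 1"
  shows "(LINT \<xi>|lborel. L2_ft s f \<xi> * cnj (ft s h \<xi>)) = (LINT x|lborel. f x * cnj (h x))"
proof -
  have "((\<lambda>R. LINT \<xi>|lborel. ft s (truncated R f) \<xi> * cnj (ft s h \<xi>)) \<longlongrightarrow> (LINT \<xi>|lborel. L2_ft s f \<xi> * cnj (ft s h \<xi>))) at_top"
    by (intro L2_limit_pairing L2_limit_L2_ft L2_truncated ft_L2 integrable_truncated f h s L2_cnj)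
  moreover have "((\<lambda>R. LINT x|lborel. truncated R f x * cnj (h x)) \<longlongrightarrow> (LINT x|lborel. f x * cnj (h x))) at_top"
    by (intro L2_limit_pairing L2_limit_truncated L2_truncated f h L2_cnj)
  moreover have "(LINT \<xi>|lborel. ft s (truncated R f) \<xi> * cnj (ft s h \<xi>)) = (LINT x|lborel. truncated R f x * cnj (h x))" for R
    by (intro ft_parseval[OF _ _ _ _ B] integrable_L2_mult L2_cnj ft_L2 integrable_truncated L2_truncated f h s)
  ultimately show ?thesis
    using tendsto_unique[OF trivial_limit_at_top_linorder] by simp
qed

section \<open>Expected Fourier modes\<close>

lemma set_lebesgue_integral_has_vector_derivative:
  fixes f :: "real \<Rightarrow> 'a::euclidean_space"
  assumes f: "continuous_on {0..} f" and t: "t \<in> {0..T}"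
  shows "((\<lambda>t. LINT s:{0..t}|lborel. f s) has_vector_derivative f t) (at t within {0..T})"
proof -
  have c: "continuous_on {0..u} f" for u
    using f by (rule continuous_on_subset) auto
  have eq: "(LINT s:{0..u}|lborel. f s) = integral {0..u} f" for u
    by (intro set_borel_integral_eq_integral borel_integrable_atLeastAtMost' c)
  show ?thesis
    unfolding eq by (rule integral_has_vector_derivative[OF c t])
qed

text \<open>Integrating factor: the product of c + B with exp(-A) has derivative 0. The right side c
  + B is differentiated in place of \<open>y\<close>, since its smoothness is that of an integral of
  a continuous function.\<close>

lemma linear_integral_equation_unique:
  fixes y \<alpha> :: "real \<Rightarrow> complex"
  assumes y: "continuous_on {0..} y" and \<alpha>: "continuous_on {0..} \<alpha>"
    and eq: "\<And>t. t \<ge> 0 \<Longrightarrow> y t = c + (LINT s:{0..t}|lborel. \<alpha> s * y s)" and t: "t \<ge> 0"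
  shows "y t = c * exp (LINT s:{0..t}|lborel. \<alpha> s)"
proof -
  define A where "A u = (LINT s:{0..u}|lborel. \<alpha> s)" for u
  define B where "B u = (LINT s:{0..u}|lborel. \<alpha> s * y s)" for u
  define z where "z u = (c + B u) * exp (- A u)" for u
  have dA: "(A has_vector_derivative \<alpha> u) (at u within {0..t})"
    and dB: "(B has_vector_derivative \<alpha> u * y u) (at u within {0..t})" if "u \<in> {0..t}" for u
    unfolding A_def[abs_def] B_def[abs_def]
    by (rule set_lebesgue_integral_has_vector_derivative[OF _ that];
        intro continuous_intros y \<alpha>)+
  have "(z has_vector_derivative 0) (at u within {0..t})" if u: "u \<in> {0..t}" for u
  proof -
    have "((\<lambda>u. - A u) has_vector_derivative - \<alpha> u) (at u within {0..t})"
      by (rule has_vector_derivative_minus[OF dA[OF u]])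
    then have "((exp \<circ> (\<lambda>u. - A u)) has_vector_derivative - \<alpha> u * exp (- A u)) (at u within {0..t})"
      by (rule field_vector_diff_chain_within) (intro DERIV_exp[THEN DERIV_subset] subset_UNIV)
    then have "((\<lambda>u. exp (- A u)) has_vector_derivative - \<alpha> u * exp (- A u)) (at u within {0..t})"
      by (simp add: comp_def)
    moreover have "((\<lambda>u. c + B u) has_vector_derivative 0 + \<alpha> u * y u) (at u within {0..t})"
      by (intro has_vector_derivative_add has_vector_derivative_const dB u)
    ultimately have "((\<lambda>u. (c + B u) * exp (- A u)) has_vector_derivative
        (c + B u) * (- \<alpha> u * exp (- A u)) + (0 + \<alpha> u * y u) * exp (- A u)) (at u within {0..t})"
      by (rule has_vector_derivative_mult[rotated])
    moreover have "y u = c + B u"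
      using eq[of u] u by (simp add: B_def)
    ultimately show ?thesis
      by (simp add: z_def[abs_def] algebra_simps)
  qed
  then obtain d where d: "\<And>u. u \<in> {0..t} \<Longrightarrow> z u = d"
    using has_vector_derivative_zero_constant[of "{0..t}" z] by blast
  have 0: "A 0 = 0" "B 0 = 0"
    unfolding A_def B_def set_lebesgue_integral_def
    by (auto intro!: integral_eq_zero_AE eventually_mono[OF AE_lborel_singleton[of 0]])
  have "z t = z 0" using d[of t] d[of 0] t by simp
  then have "(c + B t) * exp (- A t) = c"
    by (simp add: z_def 0)
  then have "c + B t = c * exp (A t)"
    by (simp add: exp_minus field_simps)
  then show ?thesis
    using eq[OF t] by (simp add: A_def B_def)
qed

section \<open>The regularized noise and its limit\<close>

lemma noise_rate_extend:
  assumes "\<epsilon> > 0" "s \<ge> 0"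
  shows "noise_rate \<epsilon> g s = (g (max 0 (s + \<epsilon>)) - g (max 0 (s - \<epsilon>))) / (2 * \<epsilon>)"
  using assms by (simp add: noise_rate_def max.commute max_absorb2)

lemma continuous_on_max_extension:
  fixes g :: "real \<Rightarrow> 'a::topological_space"
  assumes "continuous_on {0..} g"
  shows "continuous_on UNIV (\<lambda>s. g (max 0 s))"
  by (rule continuous_on_compose2[OF assms]) (auto intro!: continuous_intros)

lemma continuous_on_noise_rate:
  assumes g: "continuous_on {0..} g" and e: "\<epsilon> > 0"
  shows "continuous_on {0..} (noise_rate \<epsilon> g)"
proof -
  have "continuous_on {0..} (\<lambda>s. (g (max 0 (s + \<epsilon>)) - g (max 0 (s - \<epsilon>))) / (2 * \<epsilon>))"
    using e by (intro continuous_intros continuous_on_compose2[OF continuous_on_max_extension[OF g]]) auto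
  then show ?thesis
    by (rule continuous_on_cong[THEN iffD1, rotated -1]) (auto simp: noise_rate_extend[OF e])
qed

text \<open>It is the average of the ordinary difference quotients for the increments h and
  -h.\<close>

lemma symmetric_difference_quotient:
  fixes P :: "real \<Rightarrow> real"
  assumes "(P has_real_derivative D) (at x)"
  shows "((\<lambda>\<epsilon>. (P (x + \<epsilon>) - P (x - \<epsilon>)) / (2 * \<epsilon>)) \<longlongrightarrow> D) (at_right 0)"
proof -
  have l: "((\<lambda>h. (P (x + h) - P x) / h) \<longlongrightarrow> D) (at 0)"
    using assms by (simp add: DERIV_def)
  have 1: "((\<lambda>h. (P (x + h) - P x) / h) \<longlongrightarrow> D) (at_right 0)"
    by (rule tendsto_within_subset[OF l]) auto
  have "filterlim (\<lambda>h::real. - h) (at 0) (at_right 0)"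
    unfolding filterlim_at
    by (auto intro!: tendsto_eq_intros eventually_at_right_less[THEN eventually_mono])
  then have 2: "((\<lambda>h. (P (x + - h) - P x) / (- h)) \<longlongrightarrow> D) (at_right 0)"
    by (rule filterlim_compose[OF l])
  have "((\<lambda>h. ((P (x + h) - P x) / h + (P (x + - h) - P x) / (- h)) / 2) \<longlongrightarrow> (D + D) / 2) (at_right 0)"
    by (intro tendsto_intros 1 2) simp
  moreover have "((P (x + h) - P x) / h + (P (x + - h) - P x) / (- h)) / 2 = (P (x + h) - P (x - h)) / (2 * h)" for h
    by (cases "h = 0") (auto simp: field_simps)
  ultimately have "((\<lambda>h. (P (x + h) - P (x - h)) / (2 * h)) \<longlongrightarrow> (D + D) / 2) (at_right 0)"
    by (simp only:)
  then show ?thesis by simp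
qed

text \<open>The path is merely continuous, but its antiderivative \<open>P\<close> is
  differentiable. The integrated noise is the symmetric difference quotient of \<open>P\<close> at
  \<open>t\<close> minus the one at 0, and these tend to the values of the path.\<close>

lemma noise_rate_integral_tendsto:
  fixes g :: "real \<Rightarrow> real"
  assumes g: "continuous_on {0..} g" and g0: "g 0 = 0" and t: "t \<ge> 0"
  shows "((\<lambda>\<epsilon>. LINT s:{0..t}|lborel. noise_rate \<epsilon> g s) \<longlongrightarrow> g t) (at_right 0)"
proof -
  \<comment> \<open>Freezing the path to the left of time 0 absorbs the positive part in
    \<open>noise_rate\<close> into an ordinary symmetric difference.\<close>
  define h where "h s = g (max 0 s)" for s
  have h: "continuous_on S h" for S
    unfolding h_def using continuous_on_max_extension[OF g] by (rule continuous_on_subset) simp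
  \<comment> \<open>The interval exceeds [0,t] by 1 on both sides, so that shifts by \<epsilon> < 1
    stay in its interior.\<close>
  obtain P where P: "\<And>x. x \<in> {- 1..t + 1} \<Longrightarrow> (P has_vector_derivative h x) (at x within {- 1..t + 1})"
    using antiderivative_continuous[OF h] by metis
  have D: "(P has_real_derivative h x) (at x)" if "x \<in> {- 1<..<t + 1}" for x
  proof -
    have "(P has_vector_derivative h x) (at x)"
      using P[of x] that at_within_interior[of x "{- 1..t + 1}"] by auto
    then show ?thesis
      by (simp add: has_real_derivative_iff_has_vector_derivative)
  qed
  have eq: "(LINT s:{0..t}|lborel. noise_rate \<epsilon> g s)
      = (P (t + \<epsilon>) - P (t - \<epsilon>)) / (2 * \<epsilon>) - (P (0 + \<epsilon>) - P (0 - \<epsilon>)) / (2 * \<epsilon>)"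
    if e: "0 < \<epsilon>" "\<epsilon> < 1" for \<epsilon>
  proof -
    have c: "continuous_on {0..t} (noise_rate \<epsilon> g)"
      using continuous_on_noise_rate[OF g e(1)] by (rule continuous_on_subset) auto
    have "((\<lambda>s. (P (s + \<epsilon>) - P (s - \<epsilon>)) / (2 * \<epsilon>)) has_real_derivative noise_rate \<epsilon> g s) (at s within {0..t})"
      if s: "s \<in> {0..t}" for s
    proof -
      have "(P has_real_derivative h (s + \<epsilon>)) (at (s + \<epsilon>))" "(P has_real_derivative h (s + - \<epsilon>)) (at (s + - \<epsilon>))"
        using s e by (auto intro!: D)
      then have "((\<lambda>s. (P (s + \<epsilon>) - P (s + - \<epsilon>)) / (2 * \<epsilon>)) has_real_derivative (h (s + \<epsilon>) - h (s + - \<epsilon>)) / (2 * \<epsilon>)) (at s)"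
        unfolding DERIV_shift by (rule DERIV_cdivide[OF DERIV_diff])
      then show ?thesis
        using s e by (simp add: noise_rate_extend h_def has_field_derivative_at_within)
    qed
    then have "(noise_rate \<epsilon> g has_integral ((P (t + \<epsilon>) - P (t - \<epsilon>)) / (2 * \<epsilon>) - (P (0 + \<epsilon>) - P (0 - \<epsilon>)) / (2 * \<epsilon>))) {0..t}"
      using t by (intro fundamental_theorem_of_calculus)
        (auto simp: has_real_derivative_iff_has_vector_derivative[symmetric])
    moreover have "(LINT s:{0..t}|lborel. noise_rate \<epsilon> g s) = integral {0..t} (noise_rate \<epsilon> g)"
      by (intro set_borel_integral_eq_integral borel_integrable_atLeastAtMost' c)
    ultimately show ?thesis
      by (simp add: integral_unique)
  qed
  have "((\<lambda>\<epsilon>. (P (t + \<epsilon>) - P (t - \<epsilon>)) / (2 * \<epsilon>) - (P (0 + \<epsilon>) - P (0 - \<epsilon>)) / (2 * \<epsilon>)) \<longlongrightarrow> h t - h 0) (at_right 0)"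
    by (intro tendsto_diff symmetric_difference_quotient D) (use t in auto)
  moreover have "eventually (\<lambda>\<epsilon>. (P (t + \<epsilon>) - P (t - \<epsilon>)) / (2 * \<epsilon>) - (P (0 + \<epsilon>) - P (0 - \<epsilon>)) / (2 * \<epsilon>)
     = (LINT s:{0..t}|lborel. noise_rate \<epsilon> g s)) (at_right 0)"
    using eventually_at_right_real[of 0 1] by (auto elim!: eventually_mono simp: eq)
  ultimately show ?thesis
    using t g0 by (auto simp: h_def dest: Lim_transform_eventually)
qed

text \<open>Discretize time by \<open>floor (n s) / n\<close> and let \<open>n\<close> tend to infinity.\<close>

lemma continuous_process_jointly_measurable:
  fixes X :: "real \<Rightarrow> 'w \<Rightarrow> real"
  assumes X: "\<And>t. t \<ge> 0 \<Longrightarrow> X t \<in> borel_measurable M"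
    and c: "\<And>w. w \<in> space M \<Longrightarrow> continuous_on {0..} (\<lambda>t. X t w)"
  shows "(\<lambda>(w, s). X (max 0 s) w) \<in> borel_measurable (M \<Otimes>\<^sub>M borel)"
proof (rule borel_measurable_LIMSEQ_metric)
  define q where "q n s = real_of_int \<lfloor>real (Suc n) * s\<rfloor> / real (Suc n)" for n s
  fix n
  have [measurable]: "X (max 0 (real_of_int i / real (Suc n))) \<in> borel_measurable M" for i
    by (rule X) simp
  \<comment> \<open>For fixed \<open>n\<close> only countably many times occur, one for each integer
    value of the floor, so measurability at single times is enough.\<close>
  have "(\<lambda>z. (\<lambda>i z. X (max 0 (real_of_int i / real (Suc n))) (fst z)) \<lfloor>real (Suc n) * snd z\<rfloor> z)
      \<in> borel_measurable (M \<Otimes>\<^sub>M borel)"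
    by (rule measurable_compose_countable) measurable
  then show "(\<lambda>(w, s). X (max 0 (q n s)) w) \<in> borel_measurable (M \<Otimes>\<^sub>M borel)"
    by (simp add: q_def case_prod_beta)
next
  define q where "q n s = real_of_int \<lfloor>real (Suc n) * s\<rfloor> / real (Suc n)" for n s
  fix z assume "z \<in> space (M \<Otimes>\<^sub>M (borel :: real measure))"
  then obtain w s where z: "z = (w, s)" "w \<in> space M"
    by (auto simp: space_pair_measure)
  have "(\<lambda>n. q n s) \<longlonglongrightarrow> s"
  proof (rule Lim_null[THEN iffD2], rule Lim_null_comparison)
    have "\<bar>q n s - s\<bar> \<le> 1 / real (Suc n)" for n
    proof -
      have "q n s - s = (real_of_int \<lfloor>real (Suc n) * s\<rfloor> - real (Suc n) * s) / real (Suc n)"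
        by (simp add: q_def field_simps)
      also have "\<bar>\<dots>\<bar> = \<bar>real_of_int \<lfloor>real (Suc n) * s\<rfloor> - real (Suc n) * s\<bar> / real (Suc n)"
        by simp
      also have "\<dots> \<le> 1 / real (Suc n)"
        by (intro divide_right_mono) linarith+
      finally show ?thesis .
    qed
    then show "\<forall>\<^sub>F n in sequentially. norm (q n s - s) \<le> 1 / real (Suc n)"
      by simp
    show "(\<lambda>n. 1 / real (Suc n)) \<longlonglongrightarrow> 0"
      by (rule LIMSEQ_Suc[OF lim_1_over_n])
  qed
  then have "(\<lambda>n. X (max 0 (q n s)) w) \<longlonglongrightarrow> X (max 0 s) w"
    by (rule continuous_on_tendsto_compose[OF continuous_on_max_extension[OF c[OF z(2)]]]) auto
  then show "(\<lambda>n. case z of (w, s) \<Rightarrow> X (max 0 (q n s)) w) \<longlonglongrightarrow> (case z of (w, s) \<Rightarrow> X (max 0 s) w)"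
    by (simp add: z)
qed

lemma noise_rate_integral_measurable:
  fixes X :: "real \<Rightarrow> 'w \<Rightarrow> real"
  assumes X: "\<And>t. t \<ge> 0 \<Longrightarrow> X t \<in> borel_measurable M"
    and c: "\<And>w. w \<in> space M \<Longrightarrow> continuous_on {0..} (\<lambda>t. X t w)" and e: "\<epsilon> > 0"
  shows "(\<lambda>w. LINT s:{0..t}|lborel. noise_rate \<epsilon> (\<lambda>t. X t w) s) \<in> borel_measurable M"
proof -
  have [measurable]: "(\<lambda>(w, s). X (max 0 s) w) \<in> borel_measurable (M \<Otimes>\<^sub>M borel)"
    by (rule continuous_process_jointly_measurable[OF X c])
  have "(\<lambda>w. LINT s|lborel. indicator {0..t} s *\<^sub>R
      (((\<lambda>(w, s). X (max 0 s) w) (w, s + \<epsilon>) - (\<lambda>(w, s). X (max 0 s) w) (w, s - \<epsilon>)) / (2 * \<epsilon>))) \<in> borel_measurable M"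
    by measurable
  moreover have "(LINT s:{0..t}|lborel. noise_rate \<epsilon> (\<lambda>t. X t w) s) = (LINT s|lborel. indicator {0..t} s *\<^sub>R
      (((\<lambda>(w, s). X (max 0 s) w) (w, s + \<epsilon>) - (\<lambda>(w, s). X (max 0 s) w) (w, s - \<epsilon>)) / (2 * \<epsilon>)))" for w
    unfolding set_lebesgue_integral_def
    by (intro Bochner_Integration.integral_cong refl) (auto simp: noise_rate_extend[OF e] split: split_indicator)
  ultimately show ?thesis by simp
qed

section \<open>Averages of Gaussian phases\<close>

lemma (in prob_space) gaussian_rv_characteristic:
  assumes g: "gaussian_rv M X" and m: "expectation X = 0"
  shows "(LINT w|M. cis (a * X w)) = complex_of_real (exp (- (a\<^sup>2 * variance X / 2)))"
proof -
  have [measurable]: "X \<in> borel_measurable M"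
    using g by (simp add: gaussian_rv_def)
  from g consider m s where "s > 0" "distributed M lborel X (\<lambda>x. ennreal (normal_density m s x))"
    | c where "AE w in M. X w = c"
    by (auto simp: gaussian_rv_def)
  then show ?thesis
  proof cases
    case (1 \<mu> s)
    have \<mu>: "\<mu> = 0" and v: "variance X = s\<^sup>2"
      using normal_distributed_expectation[OF 1] normal_distributed_variance[OF 1] m by auto
    have D: "distributed M lborel (\<lambda>w. (X w - \<mu>) / s) std_normal_density"
      using 1 normal_standard_normal_convert by blast
    have "(LINT w|M. cis (a * X w)) = (LINT w|M. iexp (a * s * ((X w - \<mu>) / s)))"
      using 1 \<mu> by (simp add: cis_conv_exp)
    also have "\<dots> = (LINT x|lborel. std_normal_density x *\<^sub>R iexp (a * s * x))"
    proof -
      have [measurable]: "(\<lambda>w. (X w - \<mu>) / s) \<in> borel_measurable M"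
        by measurable
      have "(LINT w|M. iexp (a * s * ((X w - \<mu>) / s)))
          = (LINT x|distr M lborel (\<lambda>w. (X w - \<mu>) / s). iexp (a * s * x))"
        by (subst integral_distr) auto
      then show ?thesis
        unfolding distributed_distr_eq_density[OF D] by (subst (asm) integral_density) auto
    qed
    also have "\<dots> = char std_normal_distribution (a * s)"
      unfolding char_def by (subst integral_density) auto
    also have "\<dots> = complex_of_real (exp (- (a\<^sup>2 * variance X / 2)))"
      unfolding v by (simp add: char_std_normal_distribution power_mult_distrib)
    finally show ?thesis .
  next
    case (2 c)
    have "expectation X = expectation (\<lambda>_. c)"
      by (rule integral_cong_AE) (use 2 in auto)
    \<comment> \<open>In the degenerate case mean zero forces the constant to be 0, and both sides
      of the formula are 1.\<close>
    then have "c = 0" using m by (simp add: prob_space)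
    have "variance X = expectation (\<lambda>_. 0)"
      by (rule integral_cong_AE) (use 2 m \<open>c = 0\<close> in \<open>auto elim!: eventually_mono\<close>)
    moreover have "(LINT w|M. cis (a * X w)) = (LINT w|M. 1)"
      by (rule integral_cong_AE) (use 2 \<open>c = 0\<close> in \<open>auto elim!: eventually_mono\<close>)
    ultimately show ?thesis by (simp add: prob_space)
  qed
qed

text \<open>Viscosity and all noise rates merge into one continuous coefficient
  \<open>\<alpha>\<close>, to which uniqueness for the linear equation applies. The noise
  contributes only to its imaginary part, so the modulus of the mode depends neither on \<epsilon>
  nor on the path.\<close>

lemma regularized_mode_explicit:
  assumes K: "finite K" and g: "\<And>k. k \<in> K \<Longrightarrow> continuous_on {0..} (g k)" and e: "\<epsilon> > 0" and t: "t \<ge> 0"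
    and y: "regularized_mode K \<kappa> \<sigma> g \<epsilon> \<xi> c y"
  shows "y t = c * complex_of_real (exp (- (4 * pi\<^sup>2 * \<kappa> * (norm \<xi>)\<^sup>2 * t)))
    * cis (\<Sum>k\<in>K. 2 * pi * (\<sigma> k \<bullet> \<xi>) * (LINT s:{0..t}|lborel. noise_rate \<epsilon> (g k) s))"
proof -
  define a where "a = 4 * pi\<^sup>2 * \<kappa> * (norm \<xi>)\<^sup>2"
  define b where "b k = 2 * pi * (\<sigma> k \<bullet> \<xi>)" for k
  define r where "r k = noise_rate \<epsilon> (g k)" for k
  define \<alpha> where "\<alpha> s = - complex_of_real a + \<i> * (\<Sum>k\<in>K. complex_of_real (b k) * complex_of_real (r k s))" for s
  have yc: "continuous_on {0..} y"
    and yeq: "\<And>t. t \<ge> 0 \<Longrightarrow> y t = c - complex_of_real a * (LINT s:{0..t}|lborel. y s)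
      + \<i> * (\<Sum>k\<in>K. complex_of_real (b k) * (LINT s:{0..t}|lborel. y s * complex_of_real (r k s)))"
    using y by (auto simp: regularized_mode_def a_def b_def r_def)
  have rc: "continuous_on {0..} (r k)" if "k \<in> K" for k
    unfolding r_def by (rule continuous_on_noise_rate[OF g[OF that] e])
  have \<alpha>c: "continuous_on {0..} \<alpha>"
    unfolding \<alpha>_def by (intro continuous_intros rc)
  have int: "set_integrable lborel {0..u} f" if "continuous_on {0..} f" for f :: "real \<Rightarrow> complex" and u
    by (rule borel_integrable_atLeastAtMost', rule continuous_on_subset[OF that]) auto
  have sum: "(LINT s:{0..u}|lborel. \<Sum>k\<in>K. f k s) = (\<Sum>k\<in>K. LINT s:{0..u}|lborel. f k s)"
    if "\<And>k. k \<in> K \<Longrightarrow> continuous_on {0..} (f k)" for f :: "'a \<Rightarrow> real \<Rightarrow> complex" and u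
    using int[OF that, of _ u]
    by (simp add: set_lebesgue_integral_def set_integrable_def scaleR_sum_right)
  have "y t = c * exp (LINT s:{0..t}|lborel. \<alpha> s)"
  proof (rule linear_integral_equation_unique[OF yc \<alpha>c _ t])
    fix u :: real assume u: "u \<ge> 0"
    have "(LINT s:{0..u}|lborel. \<alpha> s * y s) = (LINT s:{0..u}|lborel.
        - complex_of_real a * y s + \<i> * (\<Sum>k\<in>K. complex_of_real (b k) * (y s * complex_of_real (r k s))))"
      by (simp add: \<alpha>_def algebra_simps sum_distrib_left)
    also have "\<dots> = - complex_of_real a * (LINT s:{0..u}|lborel. y s)
      + \<i> * (\<Sum>k\<in>K. complex_of_real (b k) * (LINT s:{0..u}|lborel. y s * complex_of_real (r k s)))"
      by (subst set_integral_add(2), (intro int continuous_intros yc rc; assumption)+, subst set_integral_mult_right,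
          subst set_integral_mult_right, subst sum, intro continuous_intros yc rc, assumption) simp
    finally show "y u = c + (LINT s:{0..u}|lborel. \<alpha> s * y s)"
      using yeq[OF u] by simp
  qed
  also have "(LINT s:{0..t}|lborel. \<alpha> s) = complex_of_real (- (a * t)) + \<i> * complex_of_real (\<Sum>k\<in>K. b k * (LINT s:{0..t}|lborel. r k s))"
  proof -
    have "(LINT s:{0..t}|lborel. \<alpha> s) = (LINT s:{0..t}|lborel. - complex_of_real a)
       + \<i> * (\<Sum>k\<in>K. complex_of_real (b k) * (LINT s:{0..t}|lborel. complex_of_real (r k s)))"
      unfolding \<alpha>_def
      by (subst set_integral_add(2), (intro int continuous_intros yc rc; assumption)+, subst set_integral_mult_right,
          subst sum, intro continuous_intros yc rc, assumption) simp
    then show ?thesis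
      using t by (simp add: set_integral_complex_of_real set_integral_const scaleR_conv_of_real)
  qed
  finally show ?thesis
    by (simp only: exp_add exp_of_real cis_conv_exp a_def b_def r_def mult.assoc)
qed

text \<open>Independence factors the expectation of the product of phases; with a common variance
  the exponents add up to a multiple of the sum of squares.\<close>

lemma (in prob_space) independent_gaussian_characteristic:
  fixes X :: "'k \<Rightarrow> 'a \<Rightarrow> real"
  assumes K: "finite K" and ind: "indep_vars (\<lambda>_. borel) X K"
    and X: "\<And>k. k \<in> K \<Longrightarrow> gaussian_rv M (X k)" "\<And>k. k \<in> K \<Longrightarrow> expectation (X k) = 0"
    and v: "\<And>k. k \<in> K \<Longrightarrow> variance (X k) = v"
  shows "(LINT w|M. cis (\<Sum>k\<in>K. b k * X k w)) = complex_of_real (exp (- ((\<Sum>k\<in>K. (b k)\<^sup>2) * v / 2)))"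
proof -
  have [measurable]: "X k \<in> borel_measurable M" if "k \<in> K" for k
    using X(1)[OF that] by (simp add: gaussian_rv_def)
  have ci: "cis (\<Sum>k\<in>A. f k) = (\<Prod>k\<in>A. cis (f k))" if "finite A" for A :: "'k set" and f
    using that by (induction A rule: finite_induct) (auto simp flip: cis_mult)
  have ind': "indep_vars (\<lambda>_. borel) (\<lambda>k w. cis (b k * X k w)) K"
    by (rule indep_vars_compose2[OF ind, where Y="\<lambda>k x. cis (b k * x)"]) measurable
  have "(LINT w|M. cis (\<Sum>k\<in>K. b k * X k w)) = (LINT w|M. (\<Prod>k\<in>K. cis (b k * X k w)))"
    by (simp add: ci[OF K])
  also have "\<dots> = (\<Prod>k\<in>K. (LINT w|M. cis (b k * X k w)))"
  proof (rule indep_vars_lebesgue_integral[OF K ind'])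
    show "integrable M (\<lambda>w. cis (b k * X k w))" if "k \<in> K" for k
      using that by (intro integrable_const_bound[where B=1]) auto
  qed
  also have "\<dots> = (\<Prod>k\<in>K. complex_of_real (exp (- ((b k)\<^sup>2 * v / 2))))"
  proof (intro prod.cong refl)
    fix k assume k: "k \<in> K"
    show "(LINT w|M. cis (b k * X k w)) = complex_of_real (exp (- ((b k)\<^sup>2 * v / 2)))"
      using gaussian_rv_characteristic[OF X(1)[OF k] X(2)[OF k], of "b k"] v[OF k] by (simp only:)
  qed
  also have "\<dots> = complex_of_real (exp (\<Sum>k\<in>K. - ((b k)\<^sup>2 * v / 2)))"
    by (simp add: exp_sum[OF K])
  finally show ?thesis
    by (simp add: sum_negf sum_distrib_right sum_divide_distrib)
qed

lemma (in prob_space) expected_mode_explicit: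
  fixes G :: "'k \<Rightarrow> real \<Rightarrow> 'a \<Rightarrow> real"
  assumes K: "finite K" and iid: "iid_processes M K G"
    and gp: "\<And>k. k \<in> K \<Longrightarrow> gaussian_process M (G k)"
    and mz: "\<And>k. k \<in> K \<Longrightarrow> mean_zero M (G k)"
    and cont: "\<And>k w. k \<in> K \<Longrightarrow> w \<in> space M \<Longrightarrow> continuous_on {0..} (\<lambda>t. G k t w)"
    and zero: "\<And>k w. k \<in> K \<Longrightarrow> w \<in> space M \<Longrightarrow> G k 0 w = 0"
    and var: "\<And>k t. k \<in> K \<Longrightarrow> t \<ge> 0 \<Longrightarrow> \<gamma> t = variance (G k t)"
    and mode: "\<And>\<epsilon> w. \<epsilon> > 0 \<Longrightarrow> w \<in> space M \<Longrightarrow>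
           regularized_mode K \<kappa> \<sigma> (\<lambda>k t. G k t w) \<epsilon> \<xi> c (\<lambda>t. \<theta>h \<epsilon> t \<xi> w)"
    and t: "t \<ge> 0"
  shows "expected_mode M \<theta>h t \<xi> = c * complex_of_real (exp (- (4 * pi\<^sup>2 * \<kappa> * (norm \<xi>)\<^sup>2 * t)))
      * complex_of_real (exp (- ((\<Sum>k\<in>K. (2 * pi * (\<sigma> k \<bullet> \<xi>))\<^sup>2) * \<gamma> t / 2)))"
proof -
  define N where "N \<epsilon> k w = (LINT s:{0..t}|lborel. noise_rate \<epsilon> (\<lambda>t. G k t w) s)" for \<epsilon> k w
  define b where "b k = 2 * pi * (\<sigma> k \<bullet> \<xi>)" for k
  define d where "d = c * complex_of_real (exp (- (4 * pi\<^sup>2 * \<kappa> * (norm \<xi>)\<^sup>2 * t)))"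
  have rv: "gaussian_rv M (G k u)" if "k \<in> K" "u \<ge> 0" for k u
  proof -
    have "gaussian_rv M (\<lambda>w. \<Sum>t\<in>{u}. 1 * G k t w)"
      using gp[OF that(1)] that(2) unfolding gaussian_process_def by (elim allE[of _ "{u}"] allE[of _ "\<lambda>_. 1"]) auto
    then show ?thesis by simp
  qed
  have [measurable]: "G k u \<in> borel_measurable M" if "k \<in> K" "u \<ge> 0" for k u
    using rv[OF that] by (simp add: gaussian_rv_def)
  have Nm: "N \<epsilon> k \<in> borel_measurable M" if "k \<in> K" "\<epsilon> > 0" for \<epsilon> k
    unfolding N_def[abs_def] using that by (intro noise_rate_integral_measurable cont) auto
  \<comment> \<open>All integrands have modulus \<open>norm d\<close>, so a constant dominates them
    on the probability space. Dominated convergence is a statement about sequences, hence the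
    passage to sequences decreasing to 0 from above or at least positive.\<close>
  have lim: "((\<lambda>\<epsilon>. LINT w|M. d * cis (\<Sum>k\<in>K. b k * N \<epsilon> k w)) \<longlongrightarrow> (LINT w|M. d * cis (\<Sum>k\<in>K. b k * G k t w))) (at_right 0)"
  proof (rule tendsto_at_right_sequentially[of _ 1])
    fix S :: "nat \<Rightarrow> real" assume S: "\<And>n. 0 < S n" "S \<longlonglongrightarrow> 0"
    have SN: "(\<lambda>n. N (S n) k w) \<longlonglongrightarrow> G k t w" if "k \<in> K" "w \<in> space M" for k w
    proof -
      have "((\<lambda>\<epsilon>. N \<epsilon> k w) \<longlongrightarrow> G k t w) (at_right 0)"
        unfolding N_def by (rule noise_rate_integral_tendsto) (use that cont zero t in auto)
      moreover have "filterlim S (at_right 0) sequentially"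
        using S by (auto simp: filterlim_at order_less_imp_not_eq2)
      ultimately show ?thesis by (rule filterlim_compose)
    qed
    show "(\<lambda>n. LINT w|M. d * cis (\<Sum>k\<in>K. b k * N (S n) k w)) \<longlonglongrightarrow> (LINT w|M. d * cis (\<Sum>k\<in>K. b k * G k t w))"
    proof (rule integral_dominated_convergence)
      show "integrable M (\<lambda>_. norm d)" by simp
      show "AE w in M. (\<lambda>n. d * cis (\<Sum>k\<in>K. b k * N (S n) k w)) \<longlonglongrightarrow> d * cis (\<Sum>k\<in>K. b k * G k t w)"
        unfolding cis_conv_exp by (intro AE_I2 tendsto_intros SN)
      show "(\<lambda>w. d * cis (\<Sum>k\<in>K. b k * N (S n) k w)) \<in> borel_measurable M" for n
        using Nm[OF _ S(1)] by measurable
      show "(\<lambda>w. d * cis (\<Sum>k\<in>K. b k * G k t w)) \<in> borel_measurable M"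
        using t by measurable
    qed (simp add: norm_mult)
  qed simp
  have "expected_mode_eps M \<theta>h \<epsilon> t \<xi> = (LINT w|M. d * cis (\<Sum>k\<in>K. b k * N \<epsilon> k w))" if e: "\<epsilon> > 0" for \<epsilon>
    unfolding expected_mode_eps_def N_def b_def d_def
    by (intro Bochner_Integration.integral_cong refl regularized_mode_explicit[OF K cont e t mode[OF e]])
  then have "eventually (\<lambda>\<epsilon>. (LINT w|M. d * cis (\<Sum>k\<in>K. b k * N \<epsilon> k w)) = expected_mode_eps M \<theta>h \<epsilon> t \<xi>) (at_right 0)"
    by (auto intro: eventually_mono[OF eventually_at_right_less])
  with lim have "((\<lambda>\<epsilon>. expected_mode_eps M \<theta>h \<epsilon> t \<xi>) \<longlongrightarrow> (LINT w|M. d * cis (\<Sum>k\<in>K. b k * G k t w))) (at_right 0)"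
    by (rule Lim_transform_eventually)
  \<comment> \<open>\<open>Lim\<close> has a determined value only because convergence has just been
    proved; this is where existence of the limit mode is settled.\<close>
  then have "expected_mode M \<theta>h t \<xi> = (LINT w|M. d * cis (\<Sum>k\<in>K. b k * G k t w))"
    unfolding expected_mode_def by (intro tendsto_Lim) auto
  also have "\<dots> = d * (LINT w|M. cis (\<Sum>k\<in>K. b k * G k t w))"
    by simp
  also have "(LINT w|M. cis (\<Sum>k\<in>K. b k * G k t w)) = complex_of_real (exp (- ((\<Sum>k\<in>K. (b k)\<^sup>2) * \<gamma> t / 2)))"
  proof (rule independent_gaussian_characteristic[OF K])
    \<comment> \<open>Independence is given for whole paths. Evaluation at time \<open>t\<close> is
      a coordinate of the product space, hence measurable, and carries it over to the
      values.\<close>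
    have "indep_vars (\<lambda>_. path_space) (\<lambda>k. path_of (G k)) K"
      using iid by (simp add: iid_processes_def)
    then have "indep_vars (\<lambda>_. borel) (\<lambda>k w. path_of (G k) w t) K"
      by (rule indep_vars_compose2[where Y="\<lambda>k x. x t"]) (use t in \<open>auto intro!: measurable_component_singleton\<close>)
    then show "indep_vars (\<lambda>_. borel) (\<lambda>k. G k t) K"
      using t by (simp add: path_of_def)
  qed (use mz t var in \<open>auto simp: mean_zero_def intro!: rv\<close>)
  finally show ?thesis
    by (simp add: d_def b_def)
qed

section \<open>Exponentials of absolutely continuous functions\<close>

lemma set_integrable_const_Ioc: "set_integrable lborel {u<..v::real} (\<lambda>_. c::real)"
  using borel_integrable_atLeastAtMost'[of u v "\<lambda>_. c"] by (rule set_integrable_subset) auto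

text \<open>Half-open pieces are disjoint from the initial interval and are also the sets on which
  \<open>interval_measure\<close> is prescribed.\<close>

lemma set_integral_split:
  fixes f :: "real \<Rightarrow> 'b::{banach, second_countable_topology}"
  assumes "set_integrable lborel {0..v} f" "0 \<le> u" "u \<le> v"
  shows "set_integrable lborel {u<..v} f"
    and "(LINT s:{0..v}|lborel. f s) = (LINT s:{0..u}|lborel. f s) + (LINT s:{u<..v}|lborel. f s)"
proof -
  have i: "set_integrable lborel {0..u} f" "set_integrable lborel {u<..v} f"
    using assms by (auto intro: set_integrable_subset)
  then show "set_integrable lborel {u<..v} f" by simp
  have "{0..v} = {0..u} \<union> {u<..v}" using assms by auto
  then show "(LINT s:{0..v}|lborel. f s) = (LINT s:{0..u}|lborel. f s) + (LINT s:{u<..v}|lborel. f s)"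
    by (simp only:) (rule set_integral_Un[OF _ i], auto)
qed

text \<open>Time is clamped at 0 and the initial value of \<gamma> subtracted, so that the factor
  lives on the whole line and equals 1 at time 0 for any \<gamma>.\<close>

definition damping :: "(real \<Rightarrow> real) \<Rightarrow> real \<Rightarrow> real \<Rightarrow> real \<Rightarrow> real" where
  "damping \<gamma> a b s = exp (- (a * max 0 s + b * (\<gamma> (max 0 s) - \<gamma> 0)))"

lemma damping_pos: "damping \<gamma> a b s > 0"
  by (simp add: damping_def)

section \<open>Primitives of a bounded nonnegative density\<close>

context
  fixes \<gamma> g :: "real \<Rightarrow> real" and C :: real
  assumes dens: "has_lebesgue_density \<gamma> g"
    and g_nonneg: "AE s in lborel. s \<ge> 0 \<longrightarrow> g s \<ge> 0"
    and g_bounded: "AE s in lborel. s \<ge> 0 \<longrightarrow> g s \<le> C"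
begin

lemma density_measurable: "g \<in> borel_measurable borel"
  using dens by (simp add: has_lebesgue_density_def)

lemma density_integral:
  assumes "0 \<le> u" "u \<le> v"
  shows "set_integrable lborel {u<..v} g" and "\<gamma> v - \<gamma> u = (LINT s:{u<..v}|lborel. g s)"
proof -
  have *: "set_integrable lborel {0..v} g" "\<gamma> v - \<gamma> 0 = (LINT s:{0..v}|lborel. g s)"
      "\<gamma> u - \<gamma> 0 = (LINT s:{0..u}|lborel. g s)"
    using dens assms by (auto simp: has_lebesgue_density_def)
  show "set_integrable lborel {u<..v} g"
    using set_integral_split(1)[OF *(1) assms] .
  show "\<gamma> v - \<gamma> u = (LINT s:{u<..v}|lborel. g s)"
    using *(2,3) set_integral_split(2)[OF *(1) assms] by simp
qed

lemma primitive_mono: "0 \<le> u \<Longrightarrow> u \<le> v \<Longrightarrow> \<gamma> u \<le> \<gamma> v"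
proof -
  assume uv: "0 \<le> u" "u \<le> v"
  have "AE s in lborel. 0 \<le> indicator {u<..v} s *\<^sub>R g s"
    using g_nonneg by eventually_elim (use uv in \<open>auto simp: indicator_def\<close>)
  then have "0 \<le> (LINT s:{u<..v}|lborel. g s)"
    unfolding set_lebesgue_integral_def by (rule integral_nonneg_AE)
  then show ?thesis
    using density_integral(2)[OF uv] by simp
qed

text \<open>The upper bound on the density makes \<gamma> Lipschitz; continuity in time and the
  quadratic error estimate for the damping factor rest on this.\<close>

lemma primitive_lipschitz: "0 \<le> u \<Longrightarrow> u \<le> v \<Longrightarrow> \<gamma> v - \<gamma> u \<le> C * (v - u)"
proof -
  assume uv: "0 \<le> u" "u \<le> v"
  have "(LINT s:{u<..v}|lborel. g s) \<le> (LINT s:{u<..v}|lborel. C)"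
    unfolding set_lebesgue_integral_def
  proof (rule integral_mono_AE)
    show "AE s in lborel. indicator {u<..v} s *\<^sub>R g s \<le> indicator {u<..v} s *\<^sub>R C"
      using g_bounded by eventually_elim (use uv in \<open>auto simp: indicator_def\<close>)
  qed (use density_integral(1)[OF uv] set_integrable_const_Ioc[of u v C] in \<open>simp_all add: set_integrable_def\<close>)
  then show ?thesis
    using density_integral(2)[OF uv] uv by (simp add: set_integral_const mult.commute)
qed

lemma density_bound_nonneg: "C \<ge> 0"
  using primitive_mono[of 0 1] primitive_lipschitz[of 0 1] by simp

lemma continuous_primitive: "continuous_on UNIV (\<lambda>s. \<gamma> (max 0 s))"
proof (rule lipschitz_on_continuous_on, rule lipschitz_onI)
  show "0 \<le> C" by (rule density_bound_nonneg)
  fix x y :: real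
  have "\<bar>\<gamma> (max 0 x) - \<gamma> (max 0 y)\<bar> \<le> C * \<bar>max 0 x - max 0 y\<bar>"
  proof -
    have *: "\<bar>\<gamma> p - \<gamma> q\<bar> \<le> C * \<bar>p - q\<bar>" if "0 \<le> p" "p \<le> q" for p q
      using primitive_mono[OF that] primitive_lipschitz[OF that] that by simp
    have **: "\<bar>\<gamma> p - \<gamma> q\<bar> \<le> C * \<bar>p - q\<bar>" if "0 \<le> p" "0 \<le> q" for p q
      using *[of p q] *[of q p] that by (cases "p \<le> q") (simp_all add: abs_minus_commute)
    show ?thesis
      by (rule **) simp_all
  qed
  also have "\<dots> \<le> C * \<bar>x - y\<bar>"
    using density_bound_nonneg by (intro mult_left_mono) auto
  finally show "dist (\<gamma> (max 0 x)) (\<gamma> (max 0 y)) \<le> C * dist x y"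
    by (simp add: dist_real_def)
qed

lemma primitive_measurable: "(\<lambda>s. \<gamma> (max 0 s)) \<in> borel_measurable borel"
  by (rule borel_measurable_continuous_onI[OF continuous_primitive])

text \<open>Both measures agree on half-open intervals, a generator stable under intersection, and
  are finite on an exhausting sequence of them. The indicator reflects that the constant extension
  of \<gamma> puts no mass on negative times.\<close>

lemma stieltjes_measure_eq_density:
  "stieltjes_measure \<gamma> = density lborel (\<lambda>s. ennreal (indicator {0..} s * g s))"
proof (rule measure_eqI_generator_eq[where \<Omega>=UNIV and E="range (\<lambda>(a, b). {a<..b::real})" and A="\<lambda>n. {- real n<..real n}"])
  show "Int_stable (range (\<lambda>(a, b). {a<..b::real}))"
    by (auto simp: Int_stable_def)
  show "sets (stieltjes_measure \<gamma>) = sigma_sets UNIV (range (\<lambda>(a, b). {a<..b::real}))"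
    "sets (density lborel (\<lambda>s. ennreal (indicator {0..} s * g s))) = sigma_sets UNIV (range (\<lambda>(a, b). {a<..b::real}))"
    by (simp_all add: stieltjes_measure_def borel_sigma_sets_Ioc)
  note [measurable] = density_measurable
  have right_cont: "continuous (at_right x) (\<lambda>s. \<gamma> (max 0 s))" for x
    using continuous_primitive by (simp add: continuous_on_eq_continuous_within continuous_at_imp_continuous_at_within)
  have incr: "\<gamma> (max 0 x) \<le> \<gamma> (max 0 y)" if "x \<le> y" for x y
    using that by (intro primitive_mono) auto
  have e: "emeasure (stieltjes_measure \<gamma>) {a<..b} = ennreal (\<gamma> (max 0 b) - \<gamma> (max 0 a))" if "a \<le> b" for a b
    unfolding stieltjes_measure_def
    by (rule emeasure_interval_measure_Ioc[OF that incr right_cont])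
  show "emeasure (stieltjes_measure \<gamma>) {- real n<..real n} \<noteq> \<infinity>" for n
    by (subst e) auto
  fix X assume "X \<in> range (\<lambda>(a, b). {a<..b::real})"
  then obtain a b where X: "X = {a<..b}" by auto
  show "emeasure (stieltjes_measure \<gamma>) X = emeasure (density lborel (\<lambda>s. ennreal (indicator {0..} s * g s))) X"
  proof (cases "a \<le> b")
    case True
    define u v where "u = max 0 a" and "v = max 0 b"
    have uv: "0 \<le> u" "u \<le> v" using True by (auto simp: u_def v_def)
    have "emeasure (density lborel (\<lambda>s. ennreal (indicator {0..} s * g s))) X
        = (\<integral>\<^sup>+s. ennreal (indicator {0..} s * g s) * indicator {a<..b} s \<partial>lborel)"
      unfolding X by (rule emeasure_density) measurable
    \<comment> \<open>For a < 0 <= b the two sets differ by the point 0, which is a null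
      set.\<close>
    also have "\<dots> = (\<integral>\<^sup>+s. ennreal (indicator {u<..v} s *\<^sub>R g s) \<partial>lborel)"
      by (rule nn_integral_cong_AE, use AE_lborel_singleton[of 0] in eventually_elim)
        (auto simp: u_def v_def indicator_def)
    also have "\<dots> = ennreal (LINT s:{u<..v}|lborel. g s)"
      unfolding set_lebesgue_integral_def
      by (rule nn_integral_eq_integral)
        (use density_integral(1)[OF uv] g_nonneg uv in
          \<open>auto simp: set_integrable_def indicator_def elim!: eventually_mono\<close>)
    also have "\<dots> = emeasure (stieltjes_measure \<gamma>) X"
      using e[OF True] density_integral(2)[OF uv] by (simp add: X u_def v_def)
    finally show ?thesis ..
  qed (simp add: X)
next
  have "\<exists>n. x \<in> {- real n<..real n}" for x
  proof -
    obtain n where "\<bar>x\<bar> < real n" using reals_Archimedean2 by blast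
    then show ?thesis by (intro exI[of _ n]) auto
  qed
  then show "(\<Union>n. {- real n<..real n}) = UNIV" by blast
qed auto

lemma stieltjes_integral:
  fixes f :: "real \<Rightarrow> complex"
  assumes [measurable]: "f \<in> borel_measurable borel"
  shows "(LINT s:{0..t}|stieltjes_measure \<gamma>. f s) = (LINT s:{0..t}|lborel. g s *\<^sub>R f s)"
proof -
  note [measurable] = density_measurable
  have "(LINT s:{0..t}|stieltjes_measure \<gamma>. f s)
     = (LINT s|lborel. (indicator {0..} s * g s) *\<^sub>R (indicator {0..t} s *\<^sub>R f s))"
    unfolding set_lebesgue_integral_def stieltjes_measure_eq_density
    by (rule integral_density) (use g_nonneg in \<open>auto elim!: eventually_mono simp: indicator_def\<close>)
  also have "\<dots> = (LINT s:{0..t}|lborel. g s *\<^sub>R f s)"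
    unfolding set_lebesgue_integral_def
    by (intro Bochner_Integration.integral_cong) (auto simp: indicator_def)
  finally show ?thesis .
qed

lemma damping_measurable: "damping \<gamma> a b \<in> borel_measurable borel"
proof -
  note [measurable] = primitive_measurable
  show ?thesis unfolding damping_def[abs_def] by measurable
qed

lemma damping_le_1:
  assumes "a \<ge> 0" "b \<ge> 0"
  shows "damping \<gamma> a b s \<le> 1"
proof -
  have "0 \<le> a * max 0 s + b * (\<gamma> (max 0 s) - \<gamma> 0)"
    using assms primitive_mono[of 0 "max 0 s"] by (intro add_nonneg_nonneg mult_nonneg_nonneg) auto
  then show ?thesis by (simp add: damping_def)
qed

lemma continuous_damping: "continuous_on UNIV (damping \<gamma> a b)"
  unfolding damping_def[abs_def] by (intro continuous_intros continuous_primitive)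

text \<open>No differentiation theorem is needed although \<open>\<gamma>\<close> is only absolutely continuous: on
  \<open>[u,v]\<close> both the increment of the exponential and that of the integral lie between
  \<open>exp(-H(v)) (H(v) - H(u))\<close> and \<open>exp(-H(u)) (H(v) - H(u))\<close>, so they differ by \<open>O((v-u)\<^sup>2)\<close>
  because the density is bounded.\<close>

lemma damping_integral_equation:
  assumes a: "a \<ge> 0" and b: "b \<ge> 0" and t: "t \<ge> 0"
  shows "set_integrable lborel {0..t} (\<lambda>s. (a + b * g s) * damping \<gamma> a b s)"
    and "damping \<gamma> a b t = 1 - (LINT s:{0..t}|lborel. (a + b * g s) * damping \<gamma> a b s)"
proof -
  note [measurable] = density_measurable damping_measurable
  define H where "H s = a * s + b * (\<gamma> s - \<gamma> 0)" for s
  have eH: "damping \<gamma> a b s = exp (- H s)" if "s \<ge> 0" for s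
    using that by (simp add: damping_def H_def max_absorb2)
  have Hmono: "H u \<le> H v" if "0 \<le> u" "u \<le> v" for u v
    unfolding H_def using that a b primitive_mono[OF that] by (intro add_mono mult_left_mono) auto
  have HL: "H v - H u \<le> (a + b * C) * (v - u)" if "0 \<le> u" "u \<le> v" for u v
    using mult_left_mono[OF primitive_lipschitz[OF that] b] by (simp add: H_def algebra_simps)
  have int_h: "set_integrable lborel {0..t} (\<lambda>s. a + b * g s)" for t
  proof (cases "t \<ge> 0")
    case True
    then have "set_integrable lborel {0..t} g"
      using dens by (auto simp: has_lebesgue_density_def)
    then show ?thesis
      by (intro set_integral_add(1)[OF borel_integrable_atLeastAtMost'[OF continuous_on_const]]
          set_integrable_mult_right)
  qed (simp add: set_integrable_def)
  have int: "set_integrable lborel {0..t} (\<lambda>s. (a + b * g s) * damping \<gamma> a b s)" for t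
    unfolding set_integrable_def
  proof (rule Bochner_Integration.integrable_bound)
    show "integrable lborel (\<lambda>s. indicator {0..t} s *\<^sub>R (a + b * g s))"
      using int_h by (simp add: set_integrable_def)
    show "AE s in lborel. norm (indicator {0..t} s *\<^sub>R ((a + b * g s) * damping \<gamma> a b s)) \<le> norm (indicator {0..t} s *\<^sub>R (a + b * g s))"
      using damping_pos[of \<gamma> a b] damping_le_1[OF a b]
      by (intro AE_I2) (auto simp: abs_mult indicator_def less_imp_le intro!: mult_left_le)
  qed measurable
  then show "set_integrable lborel {0..t} (\<lambda>s. (a + b * g s) * damping \<gamma> a b s)" .
  \<comment> \<open>The claim is that \<open>F\<close> is constant. Its increments will be quadratic
    in the step, with \<open>L\<close> bounding the rate a + b g, so its derivative
    vanishes.\<close>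
  define F where "F u = exp (- H u) + (LINT s:{0..u}|lborel. (a + b * g s) * damping \<gamma> a b s)" for u
  define L where "L = a + b * C"
  have step: "\<bar>F v - F u\<bar> \<le> L\<^sup>2 * (v - u)\<^sup>2" if uv: "0 \<le> u" "u \<le> v" for u v
  proof -
    define d where "d = H v - H u"
    have d0: "d \<ge> 0" using Hmono[OF uv] by (simp add: d_def)
    have dL: "d \<le> L * (v - u)" using HL[OF uv] by (simp add: d_def L_def)
    have hd: "(LINT s:{u<..v}|lborel. a + b * g s) = d"
    proof -
      have "(LINT s:{u<..v}|lborel. a + b * g s) = a * (v - u) + b * (\<gamma> v - \<gamma> u)"
        using density_integral[OF uv] uv
        by (subst set_integral_add(2)) (auto simp: set_integral_const set_integrable_mult_right set_integrable_const_Ioc)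
      then show ?thesis by (simp add: d_def H_def algebra_simps)
    qed
    define I where "I = (LINT s:{u<..v}|lborel. (a + b * g s) * damping \<gamma> a b s)"
    have FI: "F v - F u = exp (- H v) - exp (- H u) + I"
      using set_integral_split(2)[OF int uv] by (simp add: F_def I_def)
    have i: "set_integrable lborel {u<..v} (\<lambda>s. (a + b * g s) * damping \<gamma> a b s)"
      "set_integrable lborel {u<..v} (\<lambda>s. a + b * g s)"
      using set_integral_split(1)[OF int uv] set_integral_split(1)[OF int_h uv] by auto
    have ge: "AE s in lborel. s \<in> {u<..v} \<longrightarrow> a + b * g s \<ge> 0"
      using g_nonneg by eventually_elim (use uv a b in auto)
    have "I \<le> (LINT s:{u<..v}|lborel. (a + b * g s) * exp (- H u))"
      unfolding I_def set_lebesgue_integral_def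
    proof (rule integral_mono_AE)
      show "AE s in lborel. indicator {u<..v} s *\<^sub>R ((a + b * g s) * damping \<gamma> a b s) \<le> indicator {u<..v} s *\<^sub>R ((a + b * g s) * exp (- H u))"
        using ge by eventually_elim (use uv in \<open>auto simp: indicator_def eH Hmono intro!: mult_left_mono\<close>)
    qed (use i set_integrable_mult_left[of "exp (- H u)", OF i(2)] in \<open>simp_all add: set_integrable_def\<close>)
    then have I1: "I \<le> d * exp (- H u)"
      by (simp add: hd)
    have "(LINT s:{u<..v}|lborel. (a + b * g s) * exp (- H v)) \<le> I"
      unfolding I_def set_lebesgue_integral_def
    proof (rule integral_mono_AE)
      show "AE s in lborel. indicator {u<..v} s *\<^sub>R ((a + b * g s) * exp (- H v)) \<le> indicator {u<..v} s *\<^sub>R ((a + b * g s) * damping \<gamma> a b s)"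
        using ge by eventually_elim (use uv in \<open>auto simp: indicator_def eH Hmono intro!: mult_left_mono\<close>)
    qed (use i set_integrable_mult_left[of "exp (- H v)", OF i(2)] in \<open>simp_all add: set_integrable_def\<close>)
    then have I2: "d * exp (- H v) \<le> I"
      by (simp add: hd)
    \<comment> \<open>The inequality 1 + x <= exp x at x = -d and at x = d encloses the increment of
      the exponential between the bounds already found for \<open>I\<close>.\<close>
    have ev: "exp (- H v) = exp (- H u) * exp (- d)"
      by (simp add: d_def flip: exp_add)
    have "1 - d \<le> exp (- d)"
      using exp_ge_add_one_self[of "- d"] by simp
    then have E1: "exp (- H u) - exp (- H v) \<le> d * exp (- H u)"
      using mult_left_mono[of "1 - d" "exp (- d)" "exp (- H u)"] by (simp add: ev algebra_simps)
    have "1 + d \<le> exp d" by simp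
    then have E2: "d * exp (- H v) \<le> exp (- H u) - exp (- H v)"
      using mult_left_mono[of "1 + d" "exp d" "exp (- H v)"] by (simp add: ev algebra_simps flip: exp_add)
    have "\<bar>F v - F u\<bar> \<le> d * exp (- H u) - d * exp (- H v)"
      using FI I1 I2 E1 E2 by linarith
    also have "\<dots> = d * (exp (- H u) - exp (- H v))" by (simp add: algebra_simps)
    \<comment> \<open>The gap between the two bounds is d times the increment of the exponential,
      and that increment is itself at most d because exp(-H(u)) <= 1.\<close>
    also have "\<dots> \<le> d * d"
    proof (intro mult_left_mono d0)
      have "H u \<ge> 0" using Hmono[of 0 u] uv by (simp add: H_def)
      then have "d * exp (- H u) \<le> d" using d0 by (intro mult_left_le) auto
      with E1 show "exp (- H u) - exp (- H v) \<le> d" by simp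
    qed
    also have "\<dots> \<le> (L * (v - u)) * (L * (v - u))"
      using d0 dL by (intro mult_mono) auto
    finally show ?thesis by (simp add: power2_eq_square mult_ac)
  qed
  have "(F has_real_derivative 0) (at u within {0..t})" if u: "u \<in> {0..t}" for u
    unfolding has_field_derivative_iff
  proof (rule Lim_null_comparison)
    have "\<bar>F v - F u\<bar> \<le> L\<^sup>2 * (v - u)\<^sup>2" if "v \<in> {0..t}" for v
      using step[of u v] step[of v u] u that
      by (cases "u \<le> v") (auto simp: abs_minus_commute power2_commute)
    then have "norm ((F v - F u) / (v - u)) \<le> L\<^sup>2 * \<bar>v - u\<bar>" if "v \<in> {0..t}" "v \<noteq> u" for v
      using that by (simp add: pos_divide_le_eq power2_eq_square mult.assoc)
    then show "\<forall>\<^sub>F v in at u within {0..t}. norm ((F v - F u) / (v - u)) \<le> L\<^sup>2 * \<bar>v - u\<bar>"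
      by (auto simp: eventually_at_filter)
    show "((\<lambda>v. L\<^sup>2 * \<bar>v - u\<bar>) \<longlongrightarrow> 0) (at u within {0..t})"
      by (auto intro!: tendsto_eq_intros)
  qed
  then obtain c where c: "\<And>u. u \<in> {0..t} \<Longrightarrow> F u = c"
    using has_field_derivative_zero_constant[of "{0..t}" F] by blast
  have "F t = F 0" using c[of t] c[of 0] t by simp
  moreover have "F 0 = 1"
  proof -
    have "(LINT s:{0..0}|lborel. (a + b * g s) * damping \<gamma> a b s) = 0"
      unfolding set_lebesgue_integral_def
      by (auto intro!: integral_eq_zero_AE eventually_mono[OF AE_lborel_singleton[of 0]])
    then show ?thesis by (simp add: F_def H_def)
  qed
  ultimately show "damping \<gamma> a b t = 1 - (LINT s:{0..t}|lborel. (a + b * g s) * damping \<gamma> a b s)"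
    using t by (simp add: F_def eH)
qed

end

section \<open>Test functions\<close>

lemma compactly_supported_integrable:
  fixes f :: "real^2 \<Rightarrow> complex"
  assumes c: "continuous_on UNIV f" and S: "compact S" and f: "\<And>x. x \<notin> S \<Longrightarrow> f x = 0"
  shows "integrable lborel f" "L2 f" "\<exists>B. \<forall>x. cmod (f x) \<le> B"
proof -
  have cS: "continuous_on S f" using c by (rule continuous_on_subset) simp
  have "integrable lborel (\<lambda>x. indicator S x *\<^sub>R f x)"
    by (rule borel_integrable_compact[OF S cS])
  moreover have "(\<lambda>x. indicator S x *\<^sub>R f x) = f"
    using f by (auto simp: indicator_def)
  ultimately show "integrable lborel f" by simp
  have "integrable lborel (\<lambda>x. indicator S x *\<^sub>R (cmod (f x))\<^sup>2)"
    by (intro borel_integrable_compact[OF S] continuous_intros cS)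
  moreover have "(\<lambda>x. indicator S x *\<^sub>R (cmod (f x))\<^sup>2) = (\<lambda>x. (cmod (f x))\<^sup>2)"
    using f by (auto simp: indicator_def fun_eq_iff)
  ultimately show "L2 f"
    using c by (auto simp: L2_def intro: borel_measurable_continuous_onI)
  obtain B where B: "\<And>x. x \<in> S \<Longrightarrow> cmod (f x) \<le> B"
    using compact_imp_bounded[OF compact_continuous_image[OF cS S]] by (auto simp: bounded_iff)
  have "cmod (f x) \<le> max B 0" for x
    using B[of x] f[of x] by (cases "x \<in> S") auto
  then show "\<exists>B. \<forall>x. cmod (f x) \<le> B" by blast
qed

lemma test_function_continuous: "test_function \<phi> \<Longrightarrow> continuous_on UNIV \<phi>"
  unfolding test_function_def by (metis C_k.simps(1))

lemma test_function_differentiable: "test_function \<phi> \<Longrightarrow> \<phi> differentiable (at x)"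
  using C_k.simps(2)[of 0 \<phi>] by (auto simp: test_function_def)

lemma test_function_outside_support: "x \<notin> closure {x. \<phi> x \<noteq> 0} \<Longrightarrow> \<phi> x = 0"
  using closure_subset[of "{x. \<phi> x \<noteq> 0}"] by auto

lemma test_function_integrable:
  assumes "test_function \<phi>"
  shows "integrable lborel \<phi>" "L2 \<phi>" "\<exists>B. \<forall>x. cmod (\<phi> x) \<le> B"
proof -
  have "compact (closure {x. \<phi> x \<noteq> 0})"
    using assms by (simp add: test_function_def)
  note compactly_supported_integrable[OF test_function_continuous[OF assms] this test_function_outside_support[of _ \<phi>]]
  then show "integrable lborel \<phi>" "L2 \<phi>" "\<exists>B. \<forall>x. cmod (\<phi> x) \<le> B" by blast+
qed

text \<open>Off its closed support the function vanishes on a neighbourhood, so its derivatives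
  vanish there too and the support cannot grow.\<close>

lemma test_function_partial:
  assumes \<phi>: "test_function \<phi>"
  shows "test_function (partial i \<phi>)"
proof -
  define S where "S = closure {x. \<phi> x \<noteq> 0}"
  have S: "compact S" using \<phi> by (simp add: test_function_def S_def)
  have "partial i \<phi> x = 0" if x: "x \<notin> S" for x
  proof -
    have "(\<phi> has_derivative (\<lambda>_. 0)) (at x)"
    proof (rule has_derivative_transform_within_open)
      show "((\<lambda>_. 0) has_derivative (\<lambda>_. 0)) (at x)" by simp
      show "open (- S)" using S by (simp add: compact_imp_closed open_Compl)
      show "x \<in> - S" using x by simp
      show "0 = \<phi> y" if "y \<in> - S" for y
        using test_function_outside_support[of y \<phi>] that by (simp add: S_def)
    qed
    then have "frechet_derivative \<phi> (at x) = (\<lambda>_. 0)"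
      by (rule frechet_derivative_at[symmetric])
    then show ?thesis by (simp add: partial_def)
  qed
  then have "{x. partial i \<phi> x \<noteq> 0} \<subseteq> S" by blast
  then have "closure {x. partial i \<phi> x \<noteq> 0} \<subseteq> S"
    using S by (intro closure_minimal compact_imp_closed)
  then have "compact (S \<inter> closure {x. partial i \<phi> x \<noteq> 0})"
    using S by (intro compact_Int_closed) auto
  moreover have "S \<inter> closure {x. partial i \<phi> x \<noteq> 0} = closure {x. partial i \<phi> x \<noteq> 0}"
    using \<open>closure {x. partial i \<phi> x \<noteq> 0} \<subseteq> S\<close> by blast
  moreover have "C_k n (partial i \<phi>)" for n
    using \<phi> C_k.simps(2)[of n \<phi>] by (auto simp: test_function_def)
  ultimately show ?thesis
    by (simp add: test_function_def)
qed

text \<open>By the fundamental theorem of calculus \<open>h(x + e) - h(x)\<close> is the average of \<open>h'(x + u e)\<close>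
  over \<open>0 \<le> u \<le> 1\<close>; integrating over \<open>x\<close> and using translation invariance, the left side vanishes
  and every translate on the right contributes the same integral.\<close>

lemma integral_directional_derivative_eq_0:
  fixes h h' :: "'a::euclidean_space \<Rightarrow> complex"
  assumes h: "integrable lborel h" and h': "integrable lborel h'" "continuous_on UNIV h'"
    and D: "\<And>x u. ((\<lambda>u. h (x + u *\<^sub>R e)) has_vector_derivative h' (x + u *\<^sub>R e)) (at u)"
  shows "(LINT x|lborel. h' x) = 0"
proof -
  have [measurable]: "h \<in> borel_measurable borel" "h' \<in> borel_measurable borel"
    using h h' by auto
  have translate: "(LINT x|lborel. f (x + v)) = (LINT x|lborel. f x)"
    if [measurable]: "f \<in> borel_measurable borel" for f :: "'a \<Rightarrow> complex" and v
    using lborel_integral_affine[of f 1 v] by (simp add: add.commute)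
  have ftc: "(LINT u:{0..1}|lborel. h' (x + u *\<^sub>R e)) = h (x + e) - h x" for x
  proof -
    have "((\<lambda>u. h' (x + u *\<^sub>R e)) has_integral (h (x + 1 *\<^sub>R e) - h (x + 0 *\<^sub>R e))) {0..1}"
      by (rule fundamental_theorem_of_calculus) (auto intro: has_vector_derivative_at_within D)
    moreover have "(LINT u:{0..1}|lborel. h' (x + u *\<^sub>R e)) = integral {0..1} (\<lambda>u. h' (x + u *\<^sub>R e))"
      by (intro set_borel_integral_eq_integral borel_integrable_atLeastAtMost'
          continuous_on_compose2[OF h'(2)] continuous_intros) auto
    ultimately show ?thesis by (simp add: integral_unique)
  qed
  define k where "k x u = indicator {0..1} u *\<^sub>R h' (x + u *\<^sub>R e)" for x and u :: real
  have km[measurable]: "case_prod k \<in> borel_measurable (lborel \<Otimes>\<^sub>M lborel)"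
    unfolding k_def by measurable
  have int: "integrable (lborel \<Otimes>\<^sub>M lborel) (case_prod k)"
  proof (rule integrableI_bounded[OF km])
    have "(\<integral>\<^sup>+z. norm (case_prod k z) \<partial>(lborel \<Otimes>\<^sub>M lborel)) = (\<integral>\<^sup>+u. \<integral>\<^sup>+x. norm (k x u) \<partial>lborel \<partial>lborel)"
      by (subst lborel_pair.nn_integral_snd[symmetric]) (simp_all add: case_prod_beta)
    also have "\<dots> = (\<integral>\<^sup>+u. indicator {0..1::real} u * (\<integral>\<^sup>+x. norm (h' x) \<partial>lborel) \<partial>lborel)"
    proof (rule nn_integral_cong)
      fix u :: real
      have "(\<integral>\<^sup>+x. norm (k x u) \<partial>lborel) = indicator {0..1::real} u * (\<integral>\<^sup>+x. norm (h' (u *\<^sub>R e + x)) \<partial>lborel)"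
        by (auto simp: k_def indicator_def add.commute)
      then show "(\<integral>\<^sup>+x. norm (k x u) \<partial>lborel) = indicator {0..1::real} u * (\<integral>\<^sup>+x. norm (h' x) \<partial>lborel)"
        by (subst (asm) lborel_nn_integral_translate[where F="\<lambda>x. ennreal (norm (h' x))"]) auto
    qed
    also have "\<dots> = (\<integral>\<^sup>+x. norm (h' x) \<partial>lborel)"
      by (simp add: nn_integral_multc)
    also have "\<dots> < \<infinity>" using h' by (simp add: integrable_iff_bounded)
    finally show "(\<integral>\<^sup>+z. norm (case_prod k z) \<partial>(lborel \<Otimes>\<^sub>M lborel)) < \<infinity>" .
  qed
  have "(LINT u|lborel. LINT x|lborel. k x u) = (LINT u|lborel. indicator {0..1::real} u *\<^sub>R (LINT x|lborel. h' x))"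
    by (simp add: k_def translate)
  also have "\<dots> = (LINT x|lborel. h' x)"
    by simp
  finally have "(LINT x|lborel. h' x) = (LINT x|lborel. LINT u|lborel. k x u)"
    using lborel_pair.Fubini_integral[OF int] by simp
  also have "\<dots> = (LINT x|lborel. h (x + e) - h x)"
    using ftc by (simp add: k_def set_lebesgue_integral_def)
  also have "\<dots> = 0"
  proof -
    have "integrable lborel (\<lambda>x. h (x + e))"
    proof (rule integrableI_bounded)
      have "(\<integral>\<^sup>+x. norm (h (x + e)) \<partial>lborel) = (\<integral>\<^sup>+x. norm (h x) \<partial>lborel)"
        using lborel_nn_integral_translate[of "\<lambda>x. ennreal (norm (h x))" e] by (simp add: add.commute)
      then show "(\<integral>\<^sup>+x. norm (h (x + e)) \<partial>lborel) < \<infinity>"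
        using h by (simp add: integrable_iff_bounded)
    qed measurable
    then show ?thesis
      using h by (simp add: translate)
  qed
  finally show ?thesis .
qed

section \<open>Derivatives under the transform\<close>

lemma test_function_directional_derivative:
  assumes "test_function \<phi>"
  shows "((\<lambda>u. \<phi> (x + u *\<^sub>R axis i 1)) has_vector_derivative partial i \<phi> (x + u *\<^sub>R axis i 1)) (at u)"
proof -
  let ?z = "x + u *\<^sub>R axis i 1"
  have d: "(\<phi> has_derivative frechet_derivative \<phi> (at ?z)) (at ?z)"
    using test_function_differentiable[OF assms] by (simp add: frechet_derivative_works)
  have "((\<lambda>u. x + u *\<^sub>R axis i 1) has_derivative (\<lambda>v. v *\<^sub>R axis i 1)) (at u)"
    by (auto intro!: derivative_eq_intros)
  from diff_chain_at[OF this d]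
  have "((\<lambda>u. \<phi> (x + u *\<^sub>R axis i 1)) has_derivative (\<lambda>v. frechet_derivative \<phi> (at ?z) (v *\<^sub>R axis i 1))) (at u)"
    by (simp add: comp_def)
  moreover have "frechet_derivative \<phi> (at ?z) (v *\<^sub>R axis i 1) = v *\<^sub>R partial i \<phi> ?z" for v
    unfolding partial_def by (rule linear_cmul) (rule has_derivative_linear[OF d])
  ultimately show ?thesis
    by (simp add: has_vector_derivative_def)
qed

text \<open>Integration by parts: the derivative of plane wave times \<phi> in a coordinate
  direction has integral 0, and the product rule splits it into the two transforms.\<close>

lemma ft_partial:
  assumes \<phi>: "test_function \<phi>"
  shows "ft s (partial i \<phi>) \<xi> = - (\<i> * complex_of_real (s * (2 * pi * \<xi> $ i))) * ft s \<phi> \<xi>"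
proof -
  define c where "c = (\<lambda>x. cis (s * (2 * pi * (\<xi> \<bullet> x))))"
  define d where "d = \<i> * complex_of_real (s * (2 * pi * \<xi> $ i))"
  define h' where "h' x = c x * partial i \<phi> x + d * (c x * \<phi> x)" for x
  note \<phi>' = test_function_partial[OF \<phi>, of i]
  have cc: "continuous_on UNIV c" unfolding c_def by (intro continuous_intros)
  have i1: "integrable lborel (\<lambda>x. c x * \<phi> x)" and i2: "integrable lborel (\<lambda>x. c x * partial i \<phi> x)"
    unfolding c_def by (intro integrable_ft_kernel test_function_integrable \<phi> \<phi>')+
  have "(LINT x|lborel. h' x) = 0"
  proof (rule integral_directional_derivative_eq_0[OF i1])
    show "integrable lborel h'"
      unfolding h'_def using i1 i2 by simp
    show "continuous_on UNIV h'"
      unfolding h'_def by (intro continuous_intros cc test_function_continuous \<phi> \<phi>')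
    fix x :: "real^2" and u :: real
    let ?e = "axis i 1 :: real^2"
    have "((\<lambda>u. c (x + u *\<^sub>R ?e)) has_vector_derivative d * c (x + u *\<^sub>R ?e)) (at u)"
    proof -
      have "((\<lambda>u. \<i> * complex_of_real (s * (2 * pi * (\<xi> \<bullet> (x + u *\<^sub>R ?e))))) has_vector_derivative d) (at u)"
        unfolding d_def by (auto intro!: derivative_eq_intros simp: inner_add_right inner_axis algebra_simps has_vector_derivative_complex_iff)
      then have "((exp \<circ> (\<lambda>u. \<i> * complex_of_real (s * (2 * pi * (\<xi> \<bullet> (x + u *\<^sub>R ?e)))))) has_vector_derivative
          d * exp (\<i> * complex_of_real (s * (2 * pi * (\<xi> \<bullet> (x + u *\<^sub>R ?e)))))) (at u)"
        by (rule field_vector_diff_chain_at) (rule DERIV_exp)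
      then show ?thesis
        by (simp add: c_def cis_conv_exp comp_def)
    qed
    from has_vector_derivative_mult[OF this test_function_directional_derivative[OF \<phi>, of x i u]]
    show "((\<lambda>u. c (x + u *\<^sub>R ?e) * \<phi> (x + u *\<^sub>R ?e)) has_vector_derivative h' (x + u *\<^sub>R ?e)) (at u)"
      by (simp add: h'_def mult.assoc)
  qed
  also have "(LINT x|lborel. h' x) = ft s (partial i \<phi>) \<xi> + d * ft s \<phi> \<xi>"
    unfolding h'_def ft_def using i1 i2 by (simp add: c_def)
  finally show ?thesis
    by (simp add: d_def add_eq_0_iff)
qed

text \<open>Since s^2 = 1, second derivatives have the same symbol for both signs of the
  kernel.\<close>

lemma ft_partial_partial:
  assumes \<phi>: "test_function \<phi>" and s: "\<bar>s\<bar> = 1"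
  shows "ft s (partial j (partial i \<phi>)) \<xi> = - complex_of_real (4 * pi\<^sup>2 * (\<xi> $ i * \<xi> $ j)) * ft s \<phi> \<xi>"
proof -
  have "s * s = 1" using s by (simp add: abs_if split: if_splits)
  then have "complex_of_real s * complex_of_real s = 1" by (metis of_real_1 of_real_mult)
  then have s2: "complex_of_real s * (complex_of_real s * z) = z" for z
    by (simp add: mult.assoc[symmetric])
  show ?thesis
    unfolding ft_partial[OF test_function_partial[OF \<phi>]] ft_partial[OF \<phi>]
    by (simp add: power2_eq_square s2 mult_ac)
qed

section \<open>Distributional operators and the quadratic form of Q\<close>

lemma dist_laplacian_eq: "dist_laplacian T \<phi> = (\<Sum>i\<in>UNIV. T (partial i (partial i \<phi>)))"
  by (simp add: dist_laplacian_def dist_div_def dist_grad_def sum_negf)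

lemma dist_L_eq:
  "dist_L Q T \<phi> = (\<Sum>i\<in>UNIV. \<Sum>j\<in>UNIV. complex_of_real (Q $ i $ j) * T (partial j (partial i \<phi>)))"
  by (simp add: dist_L_def dist_div_def dist_grad_def sum_negf)

text \<open>Links the symbol of the operator with matrix Q to the sum of squares that the Gaussian
  characteristic function produces.\<close>

lemma Q_matrix_form:
  "(\<Sum>i\<in>UNIV. \<Sum>j\<in>UNIV. Q_matrix K \<sigma> $ i $ j * (\<xi> $ i * \<xi> $ j)) = (\<Sum>k\<in>K. (\<sigma> k \<bullet> \<xi>)\<^sup>2)"
proof -
  have "(\<Sum>i\<in>UNIV. \<Sum>j\<in>UNIV. Q_matrix K \<sigma> $ i $ j * (\<xi> $ i * \<xi> $ j))
     = (\<Sum>i\<in>UNIV. \<Sum>j\<in>UNIV. \<Sum>k\<in>K. (\<sigma> k $ i * \<xi> $ i) * (\<sigma> k $ j * \<xi> $ j))"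
    by (simp add: Q_matrix_def tensor_def sum_distrib_left sum_distrib_right mult_ac)
  also have "\<dots> = (\<Sum>i\<in>UNIV. \<Sum>k\<in>K. \<Sum>j\<in>UNIV. (\<sigma> k $ i * \<xi> $ i) * (\<sigma> k $ j * \<xi> $ j))"
    by (intro sum.cong refl sum.swap)
  also have "\<dots> = (\<Sum>k\<in>K. \<Sum>i\<in>UNIV. \<Sum>j\<in>UNIV. (\<sigma> k $ i * \<xi> $ i) * (\<sigma> k $ j * \<xi> $ j))"
    by (rule sum.swap)
  also have "\<dots> = (\<Sum>k\<in>K. (\<sigma> k \<bullet> \<xi>)\<^sup>2)"
    by (simp add: inner_vec_def power2_eq_square sum_product)
  finally show ?thesis .
qed

section \<open>The equation for the mean\<close>

text \<open>At each frequency the damping factor is continuous in time and at most 1, so the norm of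
  \<open>W\<close> dominates.\<close>

lemma damped_integral_continuous:
  fixes W :: "real^2 \<Rightarrow> complex" and a b :: "real^2 \<Rightarrow> real"
  assumes dens: "has_lebesgue_density \<gamma> g"
    and g_nonneg: "AE s in lborel. s \<ge> 0 \<longrightarrow> g s \<ge> 0"
    and g_bounded: "AE s in lborel. s \<ge> 0 \<longrightarrow> g s \<le> C"
    and am[measurable]: "a \<in> borel_measurable borel" and bm[measurable]: "b \<in> borel_measurable borel"
    and a: "\<And>\<xi>. a \<xi> \<ge> 0" and b: "\<And>\<xi>. b \<xi> \<ge> 0"
    and W: "integrable lborel W"
  defines "m \<equiv> \<lambda>s \<xi>. complex_of_real (damping \<gamma> (a \<xi>) (b \<xi>) s)"
  shows "continuous_on UNIV (\<lambda>s. LINT \<xi>|lborel. m s \<xi> * W \<xi>)"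
proof -
  note ctx = dens g_nonneg g_bounded
  have [measurable]: "W \<in> borel_measurable borel"
    using W by auto
  have [measurable]: "m s \<in> borel_measurable borel" for s
    unfolding m_def damping_def by measurable
  have m1: "cmod (m s \<xi>) \<le> 1" for s \<xi>
    using damping_pos[of \<gamma> "a \<xi>" "b \<xi>" s] damping_le_1[OF ctx a b, of \<xi> \<xi> s] by (simp add: m_def)
  show "continuous_on UNIV (\<lambda>s. LINT \<xi>|lborel. m s \<xi> * W \<xi>)"
    unfolding continuous_on_sequentially
  proof (intro allI ballI impI)
    fix x :: "nat \<Rightarrow> real" and s assume "(\<forall>n. x n \<in> UNIV) \<and> x \<longlonglongrightarrow> s"
    then have x: "x \<longlonglongrightarrow> s" by simp
    have "(\<lambda>n. LINT \<xi>|lborel. m (x n) \<xi> * W \<xi>) \<longlonglongrightarrow> (LINT \<xi>|lborel. m s \<xi> * W \<xi>)"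
    proof (rule integral_dominated_convergence)
      show "integrable lborel (\<lambda>\<xi>. cmod (W \<xi>))" using W by simp
      show "AE \<xi> in lborel. (\<lambda>n. m (x n) \<xi> * W \<xi>) \<longlonglongrightarrow> m s \<xi> * W \<xi>"
        unfolding m_def
        by (intro AE_I2 tendsto_intros continuous_on_tendsto_compose[OF continuous_damping[OF ctx] x]) auto
      show "AE \<xi> in lborel. norm (m (x n) \<xi> * W \<xi>) \<le> cmod (W \<xi>)" for n
        using m1 by (intro AE_I2) (auto simp: norm_mult intro: mult_left_le_one_le)
    qed measurable
    then show "((\<lambda>s. LINT \<xi>|lborel. m s \<xi> * W \<xi>) \<circ> x) \<longlonglongrightarrow> (LINT \<xi>|lborel. m s \<xi> * W \<xi>)"
      by (simp add: comp_def)
  qed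
qed

text \<open>The scalar equation for the damping factor is multiplied by \<open>W\<close> and
  integrated over frequency. Integrability of \<open>W\<close> against the unbounded weights
  \<open>a\<close> and \<open>b\<close> justifies exchanging the integrals, once the Stieltjes
  integral is written with its density.\<close>

lemma damped_integral_equation:
  fixes W :: "real^2 \<Rightarrow> complex" and a b :: "real^2 \<Rightarrow> real"
  assumes dens: "has_lebesgue_density \<gamma> g"
    and g_nonneg: "AE s in lborel. s \<ge> 0 \<longrightarrow> g s \<ge> 0"
    and g_bounded: "AE s in lborel. s \<ge> 0 \<longrightarrow> g s \<le> C"
    and am[measurable]: "a \<in> borel_measurable borel" and bm[measurable]: "b \<in> borel_measurable borel"
    and a: "\<And>\<xi>. a \<xi> \<ge> 0" and b: "\<And>\<xi>. b \<xi> \<ge> 0"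
    and W: "integrable lborel W" and aW: "integrable lborel (\<lambda>\<xi>. complex_of_real (a \<xi>) * W \<xi>)"
    and bW: "integrable lborel (\<lambda>\<xi>. complex_of_real (b \<xi>) * W \<xi>)" and t: "t \<ge> 0"
  defines "m \<equiv> \<lambda>s \<xi>. complex_of_real (damping \<gamma> (a \<xi>) (b \<xi>) s)"
  shows "(LINT \<xi>|lborel. m t \<xi> * W \<xi>) = (LINT \<xi>|lborel. W \<xi>)
      + (LINT s:{0..t}|lborel. (LINT \<xi>|lborel. - (complex_of_real (a \<xi>) * (m s \<xi> * W \<xi>))))
      + (LINT s:{0..t}|stieltjes_measure \<gamma>. (LINT \<xi>|lborel. - (complex_of_real (b \<xi>) * (m s \<xi> * W \<xi>))))"
proof -
  note ctx = dens g_nonneg g_bounded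
  have [measurable]: "W \<in> borel_measurable borel" "g \<in> borel_measurable borel"
    using W dens by (auto simp: has_lebesgue_density_def)
  have [measurable]: "(\<lambda>s. \<gamma> (max 0 s)) \<in> borel_measurable borel"
    by (rule primitive_measurable[OF ctx])
  have mm: "(\<lambda>(s, \<xi>). m s \<xi>) \<in> borel_measurable (borel \<Otimes>\<^sub>M borel)"
    unfolding m_def damping_def by measurable
  then have [measurable]: "(\<lambda>(s, \<xi>). m s \<xi>) \<in> borel_measurable (lborel \<Otimes>\<^sub>M lborel)"
    by (simp cong: measurable_cong_sets)
  have [measurable]: "m s \<in> borel_measurable borel" for s
    unfolding m_def damping_def by measurable
  have m1: "cmod (m s \<xi>) \<le> 1" for s \<xi>
    using damping_pos[of \<gamma> "a \<xi>" "b \<xi>" s] damping_le_1[OF ctx a b, of \<xi> \<xi> s] by (simp add: m_def)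
  \<comment> \<open>The time weight \<open>u\<close> lets one statement serve twice: the constant 1
    goes with \<open>a\<close>, the density \<open>g\<close> with \<open>b\<close>.\<close>
  have fubini: "integrable lborel (\<lambda>\<xi>. (LINT s:{0..t}|lborel. - (complex_of_real (u s) * complex_of_real (c \<xi>) * (m s \<xi> * W \<xi>))))"
    "(LINT s:{0..t}|lborel. (LINT \<xi>|lborel. - (complex_of_real (u s) * complex_of_real (c \<xi>) * (m s \<xi> * W \<xi>))))
     = (LINT \<xi>|lborel. (LINT s:{0..t}|lborel. - (complex_of_real (u s) * complex_of_real (c \<xi>) * (m s \<xi> * W \<xi>))))"
    if u: "set_integrable lborel {0..t} u" and c: "integrable lborel (\<lambda>\<xi>. complex_of_real (c \<xi>) * W \<xi>)" for u :: "real \<Rightarrow> real" and c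
  proof -
    define f where "f s = complex_of_real (indicator {0..t} s *\<^sub>R u s)" for s
    have f: "integrable lborel f"
      using u unfolding f_def set_integrable_def by (rule integrable_of_real)
    have "integrable (lborel \<Otimes>\<^sub>M lborel) (\<lambda>(s, \<xi>). - (case (s, \<xi>) of (s, \<xi>) \<Rightarrow> m s \<xi>) * f s * (complex_of_real (c \<xi>) * W \<xi>))"
      by (rule integrable_tensor[OF f c]) (use mm m1 in \<open>auto simp: borel_prod\<close>)
    then have int: "integrable (lborel \<Otimes>\<^sub>M lborel) (\<lambda>(s, \<xi>). indicator {0..t} s *\<^sub>R (- (complex_of_real (u s) * complex_of_real (c \<xi>) * (m s \<xi> * W \<xi>))))"
      by (rule Bochner_Integration.integrable_cong[THEN iffD1, rotated -1])
        (auto simp: f_def indicator_def mult_ac)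
    show "integrable lborel (\<lambda>\<xi>. (LINT s:{0..t}|lborel. - (complex_of_real (u s) * complex_of_real (c \<xi>) * (m s \<xi> * W \<xi>))))"
      unfolding set_lebesgue_integral_def by (rule lborel_pair.integrable_snd[OF int])
    have "(LINT s:{0..t}|lborel. (LINT \<xi>|lborel. - (complex_of_real (u s) * complex_of_real (c \<xi>) * (m s \<xi> * W \<xi>))))
      = (LINT s|lborel. LINT \<xi>|lborel. indicator {0..t} s *\<^sub>R (- (complex_of_real (u s) * complex_of_real (c \<xi>) * (m s \<xi> * W \<xi>))))"
      unfolding set_lebesgue_integral_def by (simp only: integral_scaleR_right)
    also have "\<dots> = (LINT \<xi>|lborel. (LINT s:{0..t}|lborel. - (complex_of_real (u s) * complex_of_real (c \<xi>) * (m s \<xi> * W \<xi>))))"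
      unfolding set_lebesgue_integral_def by (rule lborel_pair.Fubini_integral[OF int, symmetric])
    finally show "(LINT s:{0..t}|lborel. (LINT \<xi>|lborel. - (complex_of_real (u s) * complex_of_real (c \<xi>) * (m s \<xi> * W \<xi>))))
     = (LINT \<xi>|lborel. (LINT s:{0..t}|lborel. - (complex_of_real (u s) * complex_of_real (c \<xi>) * (m s \<xi> * W \<xi>))))" .
  qed
  have one: "set_integrable lborel {0..t} (\<lambda>_. 1::real)"
    by (intro borel_integrable_atLeastAtMost' continuous_on_const)
  have gi: "set_integrable lborel {0..t} g"
    using dens t by (auto simp: has_lebesgue_density_def)
  have A: "(LINT s:{0..t}|lborel. (LINT \<xi>|lborel. - (complex_of_real (a \<xi>) * (m s \<xi> * W \<xi>))))
     = (LINT \<xi>|lborel. (LINT s:{0..t}|lborel. - (complex_of_real (a \<xi>) * (m s \<xi> * W \<xi>))))"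
    and Ai: "integrable lborel (\<lambda>\<xi>. (LINT s:{0..t}|lborel. - (complex_of_real (a \<xi>) * (m s \<xi> * W \<xi>))))"
    using fubini[OF one aW] by simp_all
  have "(LINT s:{0..t}|stieltjes_measure \<gamma>. (LINT \<xi>|lborel. - (complex_of_real (b \<xi>) * (m s \<xi> * W \<xi>))))
     = (LINT s:{0..t}|lborel. g s *\<^sub>R (LINT \<xi>|lborel. - (complex_of_real (b \<xi>) * (m s \<xi> * W \<xi>))))"
    by (rule stieltjes_integral[OF ctx]) measurable
  also have "\<dots> = (LINT s:{0..t}|lborel. (LINT \<xi>|lborel. - (complex_of_real (g s) * complex_of_real (b \<xi>) * (m s \<xi> * W \<xi>))))"
    by (simp add: scaleR_conv_of_real mult.assoc flip: integral_mult_right_zero)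
  also have "\<dots> = (LINT \<xi>|lborel. (LINT s:{0..t}|lborel. - (complex_of_real (g s) * complex_of_real (b \<xi>) * (m s \<xi> * W \<xi>))))"
    by (rule fubini(2)[OF gi bW])
  finally have B: "(LINT s:{0..t}|stieltjes_measure \<gamma>. (LINT \<xi>|lborel. - (complex_of_real (b \<xi>) * (m s \<xi> * W \<xi>))))
     = (LINT \<xi>|lborel. (LINT s:{0..t}|lborel. - (complex_of_real (g s) * complex_of_real (b \<xi>) * (m s \<xi> * W \<xi>))))" .
  note Bi = fubini(1)[OF gi bW]
  have pointwise: "m t \<xi> * W \<xi> = W \<xi> + (LINT s:{0..t}|lborel. - (complex_of_real (a \<xi>) * (m s \<xi> * W \<xi>)))
      + (LINT s:{0..t}|lborel. - (complex_of_real (g s) * complex_of_real (b \<xi>) * (m s \<xi> * W \<xi>)))" for \<xi>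
  proof -
    define d where "d = damping \<gamma> (a \<xi>) (b \<xi>)"
    have dm[measurable]: "d \<in> borel_measurable borel"
      unfolding d_def by (rule damping_measurable[OF ctx])
    have i1: "set_integrable lborel {0..t} (\<lambda>s. a \<xi> * d s)"
      using continuous_damping[OF ctx, of "a \<xi>" "b \<xi>"]
      by (intro borel_integrable_atLeastAtMost' continuous_intros) (auto simp: d_def intro: continuous_on_subset)
    \<comment> \<open>The scalar equation provides integrability of the total rate times the damping
      factor; removing the continuous part leaves the part with the density.\<close>
    have "set_integrable lborel {0..t} (\<lambda>s. (a \<xi> + b \<xi> * g s) * d s - a \<xi> * d s)"
      unfolding d_def by (rule set_integral_diff(1)[OF damping_integral_equation(1)[OF ctx a b t] i1[unfolded d_def]])
    then have i2: "set_integrable lborel {0..t} (\<lambda>s. b \<xi> * g s * d s)"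
      by (simp add: algebra_simps)
    have "d t = 1 - (LINT s:{0..t}|lborel. (a \<xi> + b \<xi> * g s) * d s)"
      unfolding d_def by (rule damping_integral_equation(2)[OF ctx a b t])
    also have "(LINT s:{0..t}|lborel. (a \<xi> + b \<xi> * g s) * d s) = (LINT s:{0..t}|lborel. a \<xi> * d s) + (LINT s:{0..t}|lborel. b \<xi> * g s * d s)"
      using set_integral_add(2)[OF i1 i2] by (simp add: distrib_right)
    finally have d: "complex_of_real (d t) = 1 - complex_of_real (LINT s:{0..t}|lborel. a \<xi> * d s) - complex_of_real (LINT s:{0..t}|lborel. b \<xi> * g s * d s)"
      by simp
    have e1: "(LINT s:{0..t}|lborel. - (complex_of_real (a \<xi>) * (m s \<xi> * W \<xi>))) = - (complex_of_real (LINT s:{0..t}|lborel. a \<xi> * d s) * W \<xi>)"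
    proof -
      have "(LINT s:{0..t}|lborel. - (complex_of_real (a \<xi>) * (m s \<xi> * W \<xi>))) = (LINT s:{0..t}|lborel. complex_of_real (a \<xi> * d s) * (- W \<xi>))"
        by (simp add: m_def d_def mult.assoc)
      then show ?thesis
        unfolding set_integral_mult_left set_integral_complex_of_real by simp
    qed
    have e2: "(LINT s:{0..t}|lborel. - (complex_of_real (g s) * complex_of_real (b \<xi>) * (m s \<xi> * W \<xi>))) = - (complex_of_real (LINT s:{0..t}|lborel. b \<xi> * g s * d s) * W \<xi>)"
    proof -
      have "(LINT s:{0..t}|lborel. - (complex_of_real (g s) * complex_of_real (b \<xi>) * (m s \<xi> * W \<xi>))) = (LINT s:{0..t}|lborel. complex_of_real (b \<xi> * g s * d s) * (- W \<xi>))"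
        by (simp add: m_def d_def mult_ac)
      then show ?thesis
        unfolding set_integral_mult_left set_integral_complex_of_real by simp
    qed
    have "m t \<xi> = complex_of_real (d t)" by (simp add: m_def d_def)
    then show ?thesis
      by (simp only: e1 e2 d left_diff_distrib mult_1_left add_uminus_conv_diff)
  qed
  show "(LINT \<xi>|lborel. m t \<xi> * W \<xi>) = (LINT \<xi>|lborel. W \<xi>)
      + (LINT s:{0..t}|lborel. (LINT \<xi>|lborel. - (complex_of_real (a \<xi>) * (m s \<xi> * W \<xi>))))
      + (LINT s:{0..t}|stieltjes_measure \<gamma>. (LINT \<xi>|lborel. - (complex_of_real (b \<xi>) * (m s \<xi> * W \<xi>))))"
    unfolding pointwise A B using W Ai Bi by simp
qed

theorem corollary13:
  fixes M :: "'w measure"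
    and K :: "'k set"
    and \<kappa> :: real
    and \<sigma> :: "'k \<Rightarrow> real^2"
    and G :: "'k \<Rightarrow> real \<Rightarrow> 'w \<Rightarrow> real"
    and \<gamma> g :: "real \<Rightarrow> real"
    and C :: real
    and \<theta>\<^sub>0 :: "real^2 \<Rightarrow> complex"
    and \<theta>h :: "real \<Rightarrow> real \<Rightarrow> real^2 \<Rightarrow> 'w \<Rightarrow> complex"
    and \<theta> :: "real \<Rightarrow> real^2 \<Rightarrow> complex"
  assumes "prob_space M"
    and "finite K"
    and "\<kappa> \<ge> 0"
    and "iid_processes M K G"
    and "\<And>k. k \<in> K \<Longrightarrow> gaussian_process M (G k)"
    and "\<And>k. k \<in> K \<Longrightarrow> mean_zero M (G k)"
    and "\<And>k. k \<in> K \<Longrightarrow> stationary_increments M (G k)"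
    and "\<And>k w. k \<in> K \<Longrightarrow> w \<in> space M \<Longrightarrow> continuous_on {0..} (\<lambda>t. G k t w)"
    and "\<And>k w. k \<in> K \<Longrightarrow> w \<in> space M \<Longrightarrow> G k 0 w = 0"
    and "\<And>k t. k \<in> K \<Longrightarrow> t \<ge> 0 \<Longrightarrow> \<gamma> t = prob_space.variance M (G k t)"
    and "\<And>T. T \<ge> 0 \<Longrightarrow> bounded_variation_on 0 T \<gamma>"
    and "has_lebesgue_density \<gamma> g"
    and "AE s in lborel. s \<ge> 0 \<longrightarrow> g s \<ge> 0"
    and "C > 0"
    and "AE s in lborel. s \<ge> 0 \<longrightarrow> g s \<le> C"
    and "L2 \<theta>\<^sub>0"
    and "\<And>\<epsilon> \<xi> w. \<epsilon> > 0 \<Longrightarrow> w \<in> space M \<Longrightarrow>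
           regularized_mode K \<kappa> \<sigma> (\<lambda>k t. G k t w) \<epsilon> \<xi> (fourier \<theta>\<^sub>0 \<xi>) (\<lambda>t. \<theta>h \<epsilon> t \<xi> w)"
    and "\<And>t. \<theta> t = inverse_fourier (expected_mode M \<theta>h t)"
  shows "(\<forall>t\<ge>0. L2 (\<theta> t)) \<and>
    weakly_continuous_L2 \<theta> \<and>
    (\<forall>\<phi> t. test_function \<phi> \<and> t \<ge> 0 \<longrightarrow>
       dist_of (\<theta> t) \<phi> = dist_of \<theta>\<^sub>0 \<phi>
         + (LINT s:{0..t}|lborel. complex_of_real \<kappa> * dist_laplacian (dist_of (\<theta> s)) \<phi>)
         + 1 / 2 * (LINT s:{0..t}|stieltjes_measure \<gamma>.
             dist_L (Q_matrix K \<sigma>) (dist_of (\<theta> s)) \<phi>))"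
proof -
  interpret prob_space M by fact
  note ctx = \<open>has_lebesgue_density \<gamma> g\<close> \<open>AE s in lborel. s \<ge> 0 \<longrightarrow> g s \<ge> 0\<close> \<open>AE s in lborel. s \<ge> 0 \<longrightarrow> g s \<le> C\<close>
  define u where "u = fourier \<theta>\<^sub>0"
  have u: "L2 u"
    unfolding u_def fourier_eq_L2_ft using \<open>L2 \<theta>\<^sub>0\<close> by (rule L2_L2_ft) simp
  define a where "a \<xi> = 4 * pi\<^sup>2 * \<kappa> * (norm \<xi>)\<^sup>2" for \<xi> :: "real^2"
  \<comment> \<open>Half of the sum of the squares of 2 pi (\<sigma>_k . \<xi>), the half coming
    from the Gaussian characteristic function.\<close>
  define b where "b \<xi> = 2 * pi\<^sup>2 * (\<Sum>k\<in>K. (\<sigma> k \<bullet> \<xi>)\<^sup>2)" for \<xi> :: "real^2"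
  have a0: "a \<xi> \<ge> 0" and b0: "b \<xi> \<ge> 0" for \<xi>
    using \<open>\<kappa> \<ge> 0\<close> by (simp_all add: a_def b_def sum_nonneg)
  have [measurable]: "a \<in> borel_measurable borel" "b \<in> borel_measurable borel"
    unfolding a_def[abs_def] b_def[abs_def] by measurable
  define m where "m s \<xi> = complex_of_real (damping \<gamma> (a \<xi>) (b \<xi>) s)" for s \<xi>
  have mm[measurable]: "m s \<in> borel_measurable borel" for s
    unfolding m_def damping_def by measurable
  have m1: "cmod (m s \<xi>) \<le> 1" for s \<xi>
    using damping_pos[of \<gamma> "a \<xi>" "b \<xi>" s] damping_le_1[OF ctx a0 b0, of \<xi> \<xi> s] by (simp add: m_def)
  have mode: "expected_mode M \<theta>h t = (\<lambda>\<xi>. m t \<xi> * u \<xi>)" if t: "t \<ge> 0" for t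
  proof
    fix \<xi>
    have e: "expected_mode M \<theta>h t \<xi> = u \<xi> * complex_of_real (exp (- (a \<xi> * t)))
      * complex_of_real (exp (- ((\<Sum>k\<in>K. (2 * pi * (\<sigma> k \<bullet> \<xi>))\<^sup>2) * \<gamma> t / 2)))"
      unfolding u_def a_def by (rule expected_mode_explicit[where G=G]) (use assms t in auto)
    \<comment> \<open>Reconciles \<open>damping\<close>, which subtracts the initial value of
      \<gamma>, with the formula for the mode. If \<open>K\<close> is empty, no process determines
      \<gamma>, but then \<open>b\<close> is 0; otherwise \<gamma> starts at the variance of
      0.\<close>
    have "b \<xi> * \<gamma> 0 = 0"
    proof (cases "K = {}")
      case False
      then obtain k where k: "k \<in> K" by blast
      then have "\<gamma> 0 = variance (G k 0)" using assms(10)[of k 0] by simp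
      also have "\<dots> = expectation (\<lambda>_. 0)"
      proof (rule Bochner_Integration.integral_cong[OF refl])
        have "expectation (G k 0) = expectation (\<lambda>_. 0)"
          by (rule Bochner_Integration.integral_cong) (use assms(9)[OF k] in auto)
        then show "(G k 0 w - expectation (G k 0))\<^sup>2 = 0" if "w \<in> space M" for w
          using assms(9)[OF k that] by simp
      qed
      finally show ?thesis by simp
    qed (simp add: b_def)
    moreover have "(\<Sum>k\<in>K. (2 * pi * (\<sigma> k \<bullet> \<xi>))\<^sup>2) * \<gamma> t / 2 = b \<xi> * \<gamma> t"
      by (simp add: b_def power_mult_distrib flip: sum_distrib_left)
    ultimately have "damping \<gamma> (a \<xi>) (b \<xi>) t
        = exp (- (a \<xi> * t)) * exp (- ((\<Sum>k\<in>K. (2 * pi * (\<sigma> k \<bullet> \<xi>))\<^sup>2) * \<gamma> t / 2))"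
      unfolding damping_def exp_add[symmetric] using t by (simp only: right_diff_distrib max_absorb2) simp
    then have "m t \<xi> = complex_of_real (exp (- (a \<xi> * t))) * complex_of_real (exp (- ((\<Sum>k\<in>K. (2 * pi * (\<sigma> k \<bullet> \<xi>))\<^sup>2) * \<gamma> t / 2)))"
      by (simp only: m_def of_real_mult)
    with e show "expected_mode M \<theta>h t \<xi> = m t \<xi> * u \<xi>"
      by (simp only: mult_ac)
  qed
  have E: "L2 (\<lambda>\<xi>. m t \<xi> * u \<xi>)" for t
    by (rule L2_bounded_mult[OF u mm m1])
  have \<theta>: "\<theta> t = L2_ft 1 (\<lambda>\<xi>. m t \<xi> * u \<xi>)" if "t \<ge> 0" for t
    using assms(18) mode[OF that] by (simp add: inverse_fourier_eq_L2_ft)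
  have \<theta>_L2: "L2 (\<theta> t)" if "t \<ge> 0" for t
    unfolding \<theta>[OF that] by (rule L2_L2_ft[OF E]) simp
  have "weakly_continuous_L2 \<theta>"
    unfolding weakly_continuous_L2_def
  proof (intro allI impI)
    fix \<psi> assume \<psi>: "L2 \<psi>"
    \<comment> \<open>Transforming the conjugated test element moves the pairing to frequencies,
      where time enters only through the damping factor.\<close>
    define \<eta> where "\<eta> = L2_ft 1 (\<lambda>x. cnj (\<psi> x))"
    have \<eta>: "L2 \<eta>" unfolding \<eta>_def by (intro L2_L2_ft L2_cnj \<psi>) simp
    define Z where "Z \<xi> = u \<xi> * \<eta> \<xi>" for \<xi>
    have "integrable lborel Z"
      unfolding Z_def by (rule integrable_L2_mult[OF u \<eta>])
    then have "continuous_on UNIV (\<lambda>t. LINT \<xi>|lborel. m t \<xi> * Z \<xi>)"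
      unfolding m_def by (intro damped_integral_continuous[OF ctx _ _ a0 b0]) measurable
    then have "continuous_on {0..} (\<lambda>t. LINT \<xi>|lborel. m t \<xi> * Z \<xi>)"
      by (rule continuous_on_subset) simp
    moreover have "(LINT \<xi>|lborel. m t \<xi> * Z \<xi>) = (LINT x|lborel. \<theta> t x * cnj (\<psi> x))" if "t \<in> {0..}" for t
      using that L2_ft_mult_formula[OF E L2_cnj[OF \<psi>], of 1 t] by (simp add: \<theta> \<eta>_def Z_def mult.assoc)
    ultimately show "continuous_on {0..} (\<lambda>t. LINT x|lborel. \<theta> t x * cnj (\<psi> x))"
      by (rule continuous_on_eq)
  qed
  moreover have "dist_of (\<theta> t) \<phi> = dist_of \<theta>\<^sub>0 \<phi>
         + (LINT s:{0..t}|lborel. complex_of_real \<kappa> * dist_laplacian (dist_of (\<theta> s)) \<phi>)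
         + 1 / 2 * (LINT s:{0..t}|stieltjes_measure \<gamma>.
             dist_L (Q_matrix K \<sigma>) (dist_of (\<theta> s)) \<phi>)" if \<phi>: "test_function \<phi>" and t: "t \<ge> 0" for \<phi> t
  proof -
    note \<phi>i = test_function_integrable[OF \<phi>]
    \<comment> \<open>With this function the pairing of \<open>\<theta> t\<close> with \<phi> is the
      frequency integral of the damping factor times \<open>W\<close>.\<close>
    define W where "W \<xi> = u \<xi> * ft 1 \<phi> \<xi>" for \<xi>
    have W: "integrable lborel W"
      unfolding W_def by (intro integrable_L2_mult u ft_L2 \<phi>i) simp
    have dist: "dist_of (\<theta> s) \<psi> = (LINT \<xi>|lborel. m s \<xi> * (u \<xi> * ft 1 \<psi> \<xi>))" if "s \<ge> 0" "test_function \<psi>" for s \<psi>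
      unfolding dist_of_def \<theta>[OF that(1)]
      by (subst L2_ft_mult_formula_integrable[OF E]) (use test_function_integrable[OF that(2)] in \<open>auto simp: mult.assoc\<close>)
    have dd: "test_function (partial j (partial i \<phi>))" for i j
      by (intro test_function_partial \<phi>)
    \<comment> \<open>The quadratic weight is absorbed by the test function: up to the constant -4
      pi^2, which is divided out, it turns the transform of \<phi> into that of a second
      derivative.\<close>
    have int2: "integrable lborel (\<lambda>\<xi>. complex_of_real (\<xi> $ i * \<xi> $ j) * W \<xi>)" for i j
    proof -
      have "integrable lborel (\<lambda>\<xi>. complex_of_real (- 1 / (4 * pi\<^sup>2)) * (u \<xi> * ft 1 (partial j (partial i \<phi>)) \<xi>))"
        by (intro integrable_mult_right integrable_L2_mult u ft_L2 test_function_integrable dd) simp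
      also have "(\<lambda>\<xi>. complex_of_real (- 1 / (4 * pi\<^sup>2)) * (u \<xi> * ft 1 (partial j (partial i \<phi>)) \<xi>))
         = (\<lambda>\<xi>. complex_of_real (\<xi> $ i * \<xi> $ j) * W \<xi>)"
        by (rule ext) (simp add: ft_partial_partial[OF \<phi>] W_def)
      finally show ?thesis .
    qed
    have mint2: "integrable lborel (\<lambda>\<xi>. complex_of_real (\<xi> $ i * \<xi> $ j) * (m s \<xi> * W \<xi>))" for i j s
      using integrable_bounded_mult[OF int2, of "m s" 1 i j] m1 mm by (simp add: mult_ac)
    have ddist: "dist_of (\<theta> s) (partial j (partial i \<phi>))
        = (LINT \<xi>|lborel. complex_of_real (- 4 * pi\<^sup>2) * (complex_of_real (\<xi> $ i * \<xi> $ j) * (m s \<xi> * W \<xi>)))" if "s \<ge> 0" for s i j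
      unfolding dist[OF that dd] ft_partial_partial[OF \<phi>, of 1, simplified] by (simp add: W_def mult_ac)
    have sq: "(\<Sum>i\<in>UNIV. \<xi> $ i * \<xi> $ i) = (norm \<xi>)\<^sup>2" for \<xi> :: "real^2"
      by (simp add: power2_norm_eq_inner inner_vec_def)
    have lap: "complex_of_real \<kappa> * dist_laplacian (dist_of (\<theta> s)) \<phi>
        = (LINT \<xi>|lborel. - (complex_of_real (a \<xi>) * (m s \<xi> * W \<xi>)))" if s: "s \<ge> 0" for s
    proof -
      have "complex_of_real \<kappa> * dist_laplacian (dist_of (\<theta> s)) \<phi>
        = (LINT \<xi>|lborel. (\<Sum>i\<in>UNIV. complex_of_real \<kappa> * (complex_of_real (- 4 * pi\<^sup>2) * (complex_of_real (\<xi> $ i * \<xi> $ i) * (m s \<xi> * W \<xi>)))))"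
        unfolding dist_laplacian_eq ddist[OF s] sum_distrib_left
        by (subst Bochner_Integration.integral_sum) (use mint2 in simp_all)
      also have "\<dots> = (LINT \<xi>|lborel. complex_of_real (\<kappa> * (- 4 * pi\<^sup>2) * (\<Sum>i\<in>UNIV. \<xi> $ i * \<xi> $ i)) * (m s \<xi> * W \<xi>))"
        by (simp only: of_real_mult of_real_sum sum_distrib_left sum_distrib_right mult.assoc)
      also have "\<dots> = (LINT \<xi>|lborel. - (complex_of_real (a \<xi>) * (m s \<xi> * W \<xi>)))"
        unfolding sq by (simp add: a_def mult_ac)
      finally show ?thesis .
    qed
    \<comment> \<open>The prefactor 1/2 and the 4 pi^2 produced by two derivatives combine to the 2
      pi^2 in \<open>b\<close>.\<close>
    have dL: "1 / 2 * dist_L (Q_matrix K \<sigma>) (dist_of (\<theta> s)) \<phi>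
        = (LINT \<xi>|lborel. - (complex_of_real (b \<xi>) * (m s \<xi> * W \<xi>)))" if s: "s \<ge> 0" for s
    proof -
      define q where "q i j = Q_matrix K \<sigma> $ i $ j" for i j
      define f where "f i j \<xi> = complex_of_real (1/2 * q i j) * (complex_of_real (- 4 * pi\<^sup>2) * (complex_of_real (\<xi> $ i * \<xi> $ j) * (m s \<xi> * W \<xi>)))" for i j \<xi>
      have fi: "integrable lborel (f i j)" for i j
        unfolding f_def by (intro integrable_mult_right mint2)
      have "1 / 2 * dist_L (Q_matrix K \<sigma>) (dist_of (\<theta> s)) \<phi>
          = (\<Sum>i\<in>UNIV. \<Sum>j\<in>UNIV. complex_of_real (1/2 * q i j) * dist_of (\<theta> s) (partial j (partial i \<phi>)))"
        by (simp add: dist_L_eq sum_distrib_left q_def)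
      also have "\<dots> = (\<Sum>i\<in>UNIV. \<Sum>j\<in>UNIV. (LINT \<xi>|lborel. f i j \<xi>))"
        unfolding f_def ddist[OF s] by (simp only: integral_mult_right_zero)
      also have "\<dots> = (LINT \<xi>|lborel. (\<Sum>i\<in>UNIV. \<Sum>j\<in>UNIV. f i j \<xi>))"
        by (simp add: fi)
      also have "\<dots> = (LINT \<xi>|lborel. - (complex_of_real (b \<xi>) * (m s \<xi> * W \<xi>)))"
      proof (intro Bochner_Integration.integral_cong refl)
        fix \<xi> :: "real^2"
        have "(\<Sum>i\<in>UNIV. \<Sum>j\<in>UNIV. f i j \<xi>)
            = complex_of_real (- 2 * pi\<^sup>2 * (\<Sum>i\<in>UNIV. \<Sum>j\<in>UNIV. q i j * (\<xi> $ i * \<xi> $ j))) * (m s \<xi> * W \<xi>)"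
          by (simp add: f_def sum_distrib_left sum_distrib_right sum_negf mult_ac)
        then show "(\<Sum>i\<in>UNIV. \<Sum>j\<in>UNIV. f i j \<xi>) = - (complex_of_real (b \<xi>) * (m s \<xi> * W \<xi>))"
          unfolding q_def Q_matrix_form by (simp add: b_def)
      qed
      finally show ?thesis .
    qed
    have aW: "integrable lborel (\<lambda>\<xi>. complex_of_real (a \<xi>) * W \<xi>)"
    proof -
      have "integrable lborel (\<lambda>\<xi>. \<Sum>i\<in>UNIV. complex_of_real (4 * pi\<^sup>2 * \<kappa>) * (complex_of_real (\<xi> $ i * \<xi> $ i) * W \<xi>))"
        by (intro Bochner_Integration.integrable_sum integrable_mult_right int2)
      then show ?thesis
        by (simp only: a_def sq[symmetric] of_real_mult of_real_sum sum_distrib_left sum_distrib_right mult.assoc)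
    qed
    have bW: "integrable lborel (\<lambda>\<xi>. complex_of_real (b \<xi>) * W \<xi>)"
    proof -
      have "integrable lborel (\<lambda>\<xi>. \<Sum>i\<in>UNIV. \<Sum>j\<in>UNIV. complex_of_real (2 * pi\<^sup>2) * (complex_of_real (Q_matrix K \<sigma> $ i $ j) * (complex_of_real (\<xi> $ i * \<xi> $ j) * W \<xi>)))"
        by (intro Bochner_Integration.integrable_sum integrable_mult_right int2)
      then show ?thesis
        by (simp only: b_def Q_matrix_form[symmetric] of_real_mult of_real_sum sum_distrib_left sum_distrib_right mult.assoc)
    qed
    have init: "dist_of \<theta>\<^sub>0 \<phi> = (LINT \<xi>|lborel. W \<xi>)"
    proof -
      obtain B where B: "\<And>x. cmod (\<phi> x) \<le> B" using \<phi>i(3) by blast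
      \<comment> \<open>Parseval is applied to the conjugate of \<phi> with the sign of
        \<open>fourier\<close>; conjugating its transform then yields \<open>ft 1 \<phi>\<close>,
        the factor in \<open>W\<close>.\<close>
      have "(LINT \<xi>|lborel. L2_ft (-1) \<theta>\<^sub>0 \<xi> * cnj (ft (-1) (\<lambda>x. cnj (\<phi> x)) \<xi>)) = (LINT x|lborel. \<theta>\<^sub>0 x * cnj (cnj (\<phi> x)))"
        by (rule L2_ft_parseval[where B=B])
          (use assms(16) \<phi>i B test_function_continuous[OF \<phi>] in \<open>auto intro!: L2_cnj continuous_on_cnj\<close>)
      then show ?thesis
        by (simp add: dist_of_def W_def u_def fourier_eq_L2_ft cnj_ft)
    qed
    have "dist_of (\<theta> t) \<phi> = (LINT \<xi>|lborel. m t \<xi> * W \<xi>)"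
      unfolding W_def by (rule dist[OF t \<phi>])
    also have "\<dots> = (LINT \<xi>|lborel. W \<xi>)
      + (LINT s:{0..t}|lborel. (LINT \<xi>|lborel. - (complex_of_real (a \<xi>) * (m s \<xi> * W \<xi>))))
      + (LINT s:{0..t}|stieltjes_measure \<gamma>. (LINT \<xi>|lborel. - (complex_of_real (b \<xi>) * (m s \<xi> * W \<xi>))))"
      unfolding m_def by (rule damped_integral_equation[OF ctx _ _ a0 b0 W aW bW t]) measurable
    also have "(LINT s:{0..t}|lborel. (LINT \<xi>|lborel. - (complex_of_real (a \<xi>) * (m s \<xi> * W \<xi>))))
       = (LINT s:{0..t}|lborel. complex_of_real \<kappa> * dist_laplacian (dist_of (\<theta> s)) \<phi>)"
      \<comment> \<open>The formula for the Laplacian is available for nonnegative times only; the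
        indicator of [0,t] removes the others.\<close>
      unfolding set_lebesgue_integral_def
      by (intro Bochner_Integration.integral_cong refl) (auto simp: lap indicator_def)
    also have "(LINT s:{0..t}|stieltjes_measure \<gamma>. (LINT \<xi>|lborel. - (complex_of_real (b \<xi>) * (m s \<xi> * W \<xi>))))
       = (LINT s:{0..t}|stieltjes_measure \<gamma>. 1 / 2 * dist_L (Q_matrix K \<sigma>) (dist_of (\<theta> s)) \<phi>)"
    proof (rule set_lebesgue_integral_cong)
      show "\<forall>s. s \<in> {0..t} \<longrightarrow> (LINT \<xi>|lborel. - (complex_of_real (b \<xi>) * (m s \<xi> * W \<xi>)))
          = 1 / 2 * dist_L (Q_matrix K \<sigma>) (dist_of (\<theta> s)) \<phi>"
        by (intro allI impI dL[symmetric]) simp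
    qed (simp add: stieltjes_measure_def)
    also have "\<dots> = 1 / 2 * (LINT s:{0..t}|stieltjes_measure \<gamma>. dist_L (Q_matrix K \<sigma>) (dist_of (\<theta> s)) \<phi>)"
      by (rule set_integral_mult_right)
    finally show ?thesis
      by (simp only: init)
  qed
  ultimately show ?thesis
    using \<theta>_L2 by blast
qed

end
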